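(* There exists an absolute constant $c>0$ with the following property. Let $\mathbb{F}$ be a field with characteristic not equal to $2$, and let $A\subset \mathbb{F}^2$ be a finite nonempty set. If $\mathbb{F}$ has positive characteristic $p$, suppose in addition that $|A|\le p^{8/5}$. Then either $$\{\|a-b\| : a,b\in A\}=\{0\},$$ or there exists $a\in A$ such that $$|\{\|a-b\| : b\in A\}|\ \ge\ c\,|A|^{20/37}.$$
   Context: For $x=(x_1,x_2),y=(y_1,y_2)\in\mathbb{F}^2$ write $x\cdot y=x_1y_1+x_2y_2$ and $\|x\|=x\cdot x$; thus $\|a-b\|=(a_1-b_1)^2+(a_2-b_2)^2$ is the (algebraic) distance between $a$ and $b$. *)

theory Defs
  imports "HOL-Algebra.Ring" Complex_Main
begin

definition ring_char :: "('a, 'm) ring_scheme \<Rightarrow> nat" where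
  "ring_char F = (if \<exists>n::nat. n > 0 \<and> [n] \<cdot>\<^bsub>F\<^esub> \<one>\<^bsub>F\<^esub> = \<zero>\<^bsub>F\<^esub>
                  then LEAST n::nat. n > 0 \<and> [n] \<cdot>\<^bsub>F\<^esub> \<one>\<^bsub>F\<^esub> = \<zero>\<^bsub>F\<^esub>
                  else 0)"

definition dot :: "('a, 'm) ring_scheme \<Rightarrow> 'a \<times> 'a \<Rightarrow> 'a \<times> 'a \<Rightarrow> 'a" where
  "dot F x y = fst x \<otimes>\<^bsub>F\<^esub> fst y \<oplus>\<^bsub>F\<^esub> snd x \<otimes>\<^bsub>F\<^esub> snd y"

definition qnorm :: "('a, 'm) ring_scheme \<Rightarrow> 'a \<times> 'a \<Rightarrow> 'a" where
  "qnorm F x = dot F x x"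

definition alg_dist :: "('a, 'm) ring_scheme \<Rightarrow> 'a \<times> 'a \<Rightarrow> 'a \<times> 'a \<Rightarrow> 'a" where
  "alg_dist F a b = qnorm F (fst a \<ominus>\<^bsub>F\<^esub> fst b, snd a \<ominus>\<^bsub>F\<^esub> snd b)"

text \<open>The pinned distance bound with constant \<open>c\<close> for one structure \<open>F\<close>; it holds vacuously
  unless \<open>F\<close> is a field of characteristic different from 2.

  HOL cannot quantify over types inside a formula, so ``there is an absolute \<open>c\<close> such that for
  all fields'' cannot be written as a single existential: in a statement of the form
  \<open>\<exists>c>0. \<forall>F :: 'a ring. pinned_distance_bound c F\<close> the constant could depend on \<open>'a\<close>.
  Independence of \<open>'a\<close> is obtained by first asserting the existence of \<open>c\<close> over the
  fixed type \<open>nat\<close> (no type variable, so \<open>c\<close> is an absolute number) and then asserting, with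
  \<open>'a\<close> free, that each such \<open>c\<close> works for every field carried by \<open>'a\<close>.  This loses and adds
  nothing mathematically: for given \<open>A\<close> the bound only involves the subfield generated by the
  coordinates of \<open>A\<close>, which is countable.\<close>

definition pinned_distance_bound :: "real \<Rightarrow> ('a, 'm) ring_scheme \<Rightarrow> bool" where
  "pinned_distance_bound c F \<longleftrightarrow>
     (field F \<and> ring_char F \<noteq> 2 \<longrightarrow>
       (\<forall>A. A \<subseteq> carrier F \<times> carrier F \<and> finite A \<and> A \<noteq> {} \<and>
            (ring_char F > 0 \<longrightarrow> real (card A) \<le> real (ring_char F) powr (8/5)) \<longrightarrow>
            {alg_dist F a b | a b. a \<in> A \<and> b \<in> A} = {\<zero>\<^bsub>F\<^esub>} \<or>
            (\<exists>a\<in>A. real (card {alg_dist F a b | b. b \<in> A}) \<ge> c * real (card A) powr (20/37))))"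

end

theory Submission
  imports Defs "HOL-Algebra.Algebraic_Closure_Type" "HOL-Algebra.Generated_Fields"
    "HOL-Library.Countable_Set" "Subresultants.Subresultant_Gcd"
begin

text \<open>Over an algebraically closed field the distance becomes \<open>(a\<^sub>1 - b\<^sub>1) (a\<^sub>2 - b\<^sub>2)\<close>. If every point of \<open>A\<close> sees at most \<open>D\<close>
  distances, then there are at least \<open>|A|\<^sup>3 / D\<close> isosceles triangles, and by Cauchy--Schwarz many pairs of pairs \<open>(b, c)\<close>,
  \<open>(b\<^sub>2, c\<^sub>2)\<close> have the same perpendicular bisector. Then \<open>(b, b\<^sub>2)\<close> and \<open>(c, c\<^sub>2)\<close> are at the same distance \<open>r\<close>, and for fixed \<open>r\<close>
  having a common bisector is an incidence between a point and a plane of \<open>P\<^sup>3\<close>. Such incidences become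
  intersections between a family of red lines, in planes \<open>X = const\<close>, and a family of blue lines, in
  planes \<open>Y = const\<close>.

  If there are many intersections, a polynomial of low degree vanishing on a random sample of the red
  lines vanishes on most lines of both families. By Bezout, a component of its zero set with many lines of
  both families satisfies the differential equation of a ruled surface; as the degree is smaller
  than the characteristic, the component is then the graph of a bilinear function of \<open>X\<close> and \<open>Y\<close>. The lines on such a graph come from
  points of \<open>A\<close> on a circle or a line, and these are few because a point of a circle sees at
  least half as many distances as there are points on it.\<close>

text \<open>Write N = |A| and suppose that every class of n pairs at one nonzero distance has at
  most k n incidences. The energy argument then gives N <= C D sqrt k up to smaller terms, so D =
  N^(20/37) asks for k about N^(34/37). A class with more than k pairs needs an interpolating
  polynomial of degree about n / k. Since n <= 3 N^(3/2), this is at most about N^(43/74), while |A|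
  <= p^(8/5) means p >= N^(5/8): the condition on p only keeps these degrees small enough for
  differentiation. The algebraic closure also supplies infinitely many scalars for generic
  coordinates, even if the given field is finite. The obstacle is isotropic lines, on which all
  distances vanish. If A has some nonzero distance, then some point of A lies off any given
  isotropic line and sees the points on it at distinct distances, so such a line carries at most D
  points of A.\<close>

section \<open>Degree functions and resultants\<close>

text \<open>The negative of a nonarchimedean valuation, with value 0 at 0 by convention. Polynomials
  in three variables are nested, and \<open>lift_deg\<close> turns a degree in an inner variable
  into another instance, so one set of estimates serves X, Y and Z.\<close>

locale degree_function =
  fixes \<delta> :: "'a::idom \<Rightarrow> nat"
  assumes zero [simp]: "\<delta> 0 = 0"
    and add_le: "\<delta> (a + b) \<le> max (\<delta> a) (\<delta> b)"
    and mult: "a \<noteq> 0 \<Longrightarrow> b \<noteq> 0 \<Longrightarrow> \<delta> (a * b) = \<delta> a + \<delta> b"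
begin

lemma one [simp]: "\<delta> 1 = 0"
  using mult[of 1 1] by simp

lemma uminus [simp]: "\<delta> (- a) = \<delta> a"
proof (cases "a = 0")
  case False
  have "\<delta> (-1) = 0" using mult[of "-1" "-1"] by simp
  then show ?thesis using mult[of "-1" a] False by simp
qed simp

lemma mult_le: "\<delta> (a * b) \<le> \<delta> a + \<delta> b"
  by (cases "a = 0 \<or> b = 0") (auto simp: mult)

lemma sum_le: "(\<And>i. i \<in> I \<Longrightarrow> \<delta> (f i) \<le> e) \<Longrightarrow> \<delta> (sum f I) \<le> e"
proof (induction I rule: infinite_finite_induct)
  case (insert x F)
  then show ?case using add_le[of "f x" "sum f F"] by (simp, smt (verit) insert.IH insertCI le_trans max.bounded_iff)
qed auto

lemma prod_le: "(\<And>i. i \<in> I \<Longrightarrow> \<delta> (f i) \<le> e) \<Longrightarrow> \<delta> (prod f I) \<le> card I * e"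
proof (induction I rule: infinite_finite_induct)
  case (insert x F)
  have "\<delta> (prod f (insert x F)) \<le> \<delta> (f x) + \<delta> (prod f F)"
    using insert.hyps mult_le by simp
  also have "\<dots> \<le> e + card F * e" using insert by (intro add_mono) auto
  finally show ?case using insert.hyps by simp
qed auto

lemma add_eq: assumes "\<delta> b < \<delta> a" shows "\<delta> (a + b) = \<delta> a"
proof -
  have "\<delta> a \<le> max (\<delta> (a + b)) (\<delta> b)" using add_le[of "a + b" "- b"] by simp
  then show ?thesis using add_le[of a b] assms by linarith
qed

lemma of_int_le: "\<delta> (of_int k) = 0"
proof -
  have "\<delta> (of_nat n) = 0" for n
  proof (induction n)
    case (Suc n)
    then show ?case using add_le[of 1 "of_nat n"] by simp
  qed simp
  then show ?thesis by (cases k rule: int_cases2) auto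
qed

lemma dvd_le: "a dvd b \<Longrightarrow> b \<noteq> 0 \<Longrightarrow> \<delta> a \<le> \<delta> b"
  using mult by fastforce

text \<open>Every term of the Leibniz expansion is a product of \<open>n\<close> entries.\<close>

lemma det_le:
  assumes A: "A \<in> carrier_mat n n" and e: "\<And>i j. i < n \<Longrightarrow> j < n \<Longrightarrow> \<delta> (A $$ (i, j)) \<le> e"
  shows "\<delta> (det A) \<le> n * e"
  unfolding det_def'[OF A]
proof (rule sum_le)
  fix p assume "p \<in> {p. p permutes {0..<n}}"
  then have p: "p permutes {0..<n}" by simp
  have "\<delta> (\<Prod>i = 0..<n. A $$ (i, p i)) \<le> card {0..<n} * e"
    by (rule prod_le) (use e p permutes_in_image[OF p] in fastforce)
  moreover have "\<delta> (signof p :: 'a) = 0" by (auto simp: sign_def)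
  ultimately show "\<delta> (signof p * (\<Prod>i = 0..<n. A $$ (i, p i))) \<le> n * e"
    using mult_le[of "signof p" "\<Prod>i = 0..<n. A $$ (i, p i)"] by simp
qed

lemma resultant_le:
  assumes "\<And>i. \<delta> (coeff p i) \<le> e" "\<And>i. \<delta> (coeff q i) \<le> e"
  shows "\<delta> (resultant p q) \<le> (degree p + degree q) * e"
  unfolding resultant_def
  by (rule det_le[OF sylvester_carrier_mat]) (use assms in \<open>auto simp: sylvester_index_mat\<close>)

end

section \<open>Degrees in inner variables\<close>

definition lift_deg :: "('a::zero \<Rightarrow> nat) \<Rightarrow> 'a poly \<Rightarrow> nat" where
  "lift_deg \<delta> p = Max ((\<lambda>i. \<delta> (coeff p i)) ` {..degree p})"

context degree_function
begin

lemma lift_deg_le_iff: "lift_deg \<delta> p \<le> e \<longleftrightarrow> (\<forall>i. \<delta> (coeff p i) \<le> e)"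
proof -
  have "\<delta> (coeff p i) = 0" if "\<not> i \<le> degree p" for i
    using that by (simp add: coeff_eq_0)
  then have "(\<forall>i. \<delta> (coeff p i) \<le> e) \<longleftrightarrow> (\<forall>i\<le>degree p. \<delta> (coeff p i) \<le> e)"
    by (metis le0)
  then show ?thesis unfolding lift_deg_def by auto
qed

lemma coeff_le_lift_deg: "\<delta> (coeff p i) \<le> lift_deg \<delta> p"
  using lift_deg_le_iff by blast

lemma lift_deg_attained: "\<exists>i. \<delta> (coeff p i) = lift_deg \<delta> p"
proof -
  have "lift_deg \<delta> p \<in> (\<lambda>i. \<delta> (coeff p i)) ` {..degree p}"
    unfolding lift_deg_def by (rule Max_in) auto
  then show ?thesis by auto
qed

text \<open>As in Gauss's lemma: the lowest coefficients of maximal degree give a dominant term.\<close>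

lemma degree_function_lift: "degree_function (lift_deg \<delta>)"
proof
  show "lift_deg \<delta> 0 = 0" using lift_deg_le_iff[of 0 0] by simp
  show "lift_deg \<delta> (p + q) \<le> max (lift_deg \<delta> p) (lift_deg \<delta> q)" for p q
    unfolding lift_deg_le_iff
    by (metis add_le coeff_add coeff_le_lift_deg le_trans max.mono)
next
  fix p q :: "'a poly" assume p: "p \<noteq> 0" and q: "q \<noteq> 0"
  have le: "lift_deg \<delta> (p * q) \<le> lift_deg \<delta> p + lift_deg \<delta> q"
    unfolding lift_deg_le_iff coeff_mult
    by (intro allI sum_le order.trans[OF mult_le] add_mono coeff_le_lift_deg)
  have ex: "\<exists>i. \<delta> (coeff p i) = lift_deg \<delta> p \<and> coeff p i \<noteq> 0 \<and>
      (\<forall>i'<i. coeff p i' = 0 \<or> \<delta> (coeff p i') < lift_deg \<delta> p)" if "p \<noteq> 0" for p :: "'a poly"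
  proof -
    let ?P = "\<lambda>i. \<delta> (coeff p i) = lift_deg \<delta> p \<and> coeff p i \<noteq> 0"
    obtain j where j: "\<delta> (coeff p j) = lift_deg \<delta> p" using lift_deg_attained by blast
    have "\<exists>i. ?P i"
    \<comment> \<open>Since \<open>\<delta> 0 = 0\<close>, a maximal degree 0 may be attained at a
      zero coefficient; then the leading coefficient serves.\<close>
    proof (cases "coeff p j = 0")
      case True
      then have "lift_deg \<delta> p = 0" using j by simp
      then show ?thesis using that coeff_le_lift_deg[of p "degree p"] by (intro exI[of _ "degree p"]) auto
    qed (use j in auto)
    then have "?P (LEAST i. ?P i)" by (rule LeastI_ex)
    moreover have "\<forall>i'<(LEAST i. ?P i). \<not> ?P i'" using not_less_Least by blast
    ultimately show ?thesis using coeff_le_lift_deg[of p] by (metis le_neq_implies_less)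
  qed
  obtain i where i: "\<delta> (coeff p i) = lift_deg \<delta> p" "coeff p i \<noteq> 0"
      "\<forall>i'<i. coeff p i' = 0 \<or> \<delta> (coeff p i') < lift_deg \<delta> p" using ex[OF p] by blast
  obtain j where j: "\<delta> (coeff q j) = lift_deg \<delta> q" "coeff q j \<noteq> 0"
      "\<forall>j'<j. coeff q j' = 0 \<or> \<delta> (coeff q j') < lift_deg \<delta> q" using ex[OF q] by blast
  let ?e = "lift_deg \<delta> p + lift_deg \<delta> q"
  let ?f = "\<lambda>k. coeff p k * coeff q (i + j - k)"
  have "coeff (p * q) (i + j) = ?f i + (\<Sum>k\<in>{..i+j} - {i}. ?f k)"
    unfolding coeff_mult by (subst sum.remove[of _ i]) auto
  moreover have small: "?f k = 0 \<or> \<delta> (?f k) < ?e" if "k \<in> {..i+j} - {i}" for k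
  proof (cases "k < i")
    case True
    then show ?thesis using i(3) coeff_le_lift_deg[of q "i+j-k"] mult_le[of "coeff p k" "coeff q (i+j-k)"]
      by (smt (verit) add_less_le_mono le_less_trans mult_zero_left)
  next
    case False
    then have "i + j - k < j" using that by auto
    then show ?thesis using j(3) coeff_le_lift_deg[of p k] mult_le[of "coeff p k" "coeff q (i+j-k)"]
      by (smt (verit) add_le_less_mono le_less_trans mult_zero_right)
  qed
  have fi: "\<delta> (?f i) = ?e" using i j mult by simp
  have "lift_deg \<delta> (p * q) \<ge> ?e"
  \<comment> \<open>For positive \<open>?e\<close> a zero term also has degree at most
    \<open>?e - 1\<close>.\<close>
  proof (cases "?e = 0")
    case False
    then have "\<delta> (?f k) \<le> ?e - 1" if "k \<in> {..i+j} - {i}" for k using small[OF that] by auto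
    then have "\<delta> (\<Sum>k\<in>{..i+j} - {i}. ?f k) \<le> ?e - 1" by (rule sum_le)
    then have "\<delta> (\<Sum>k\<in>{..i+j} - {i}. ?f k) < \<delta> (?f i)" using fi False by linarith
    then have "\<delta> (coeff (p * q) (i + j)) = ?e"
      using add_eq fi calculation by metis
    then show ?thesis using coeff_le_lift_deg[of "p * q" "i + j"] by simp
  qed simp
  with le show "lift_deg \<delta> (p * q) = ?e" by simp
qed

lemma lift_deg_pderiv: "lift_deg \<delta> (pderiv p) \<le> lift_deg \<delta> p"
  unfolding lift_deg_le_iff
proof
  fix i
  have "\<delta> (of_nat (Suc i)) = 0" using of_int_le[of "int (Suc i)"] by simp
  then show "\<delta> (coeff (pderiv p) i) \<le> lift_deg \<delta> p"
    unfolding coeff_pderiv using mult_le[of "of_nat (Suc i)" "coeff p (Suc i)"] coeff_le_lift_deg[of p "Suc i"]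
    by (metis add_0 le_trans)
qed

lemma lift_deg_map_poly:
  assumes "f 0 = 0" "\<And>c. \<delta> (f c) \<le> \<delta> c"
  shows "lift_deg \<delta> (map_poly f p) \<le> lift_deg \<delta> p"
  unfolding lift_deg_le_iff using assms coeff_le_lift_deg by (metis coeff_map_poly le_trans)

end

interpretation degree_poly: degree_function "degree :: 'a::idom poly \<Rightarrow> nat"
  by standard (auto simp: degree_mult_eq degree_add_le_max)

text \<open>\<open>hom\<close> may kill leading coefficients, so the resultant of the images need
  not be the image of the resultant. The mapped Sylvester matrix still annihilates the vector of
  descending powers of \<open>z\<close>, hence is singular.\<close>

lemma resultant_vanishes:
  fixes hom :: "'a::comm_ring_1 \<Rightarrow> 'b::idom"
  assumes "comm_ring_hom hom"
    and p: "poly (map_poly hom p) z = 0" and q: "poly (map_poly hom q) z = 0"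
    and pos: "degree p + degree q > 0"
  shows "hom (resultant p q) = 0"
proof -
  interpret comm_ring_hom hom by fact
  let ?m = "degree p" let ?n = "degree q" let ?N = "?m + ?n"
  let ?M = "map_mat hom (sylvester_mat p q)"
  let ?v = "vec ?N (\<lambda>j. z ^ (?N - 1 - j))"
  have M: "?M \<in> carrier_mat ?N ?N" by auto
  have sum0: "(\<Sum>k\<le>degree f. hom (coeff f k) * z ^ k) = 0" if "poly (map_poly hom f) z = 0" for f
  proof -
    have "poly (map_poly hom f) z = (\<Sum>k\<le>degree f. hom (coeff f k) * z ^ k)"
    proof -
      have "poly (map_poly hom f) z = (\<Sum>k\<le>degree (map_poly hom f). coeff (map_poly hom f) k * z ^ k)"
        by (rule poly_altdef)
      also have "\<dots> = (\<Sum>k\<le>degree f. coeff (map_poly hom f) k * z ^ k)"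
        by (rule sum.mono_neutral_left) (auto simp: degree_map_poly_le le_degree)
      finally show ?thesis by simp
    qed
    with that show ?thesis by simp
  qed
  have "?M *\<^sub>v ?v = 0\<^sub>v ?N"
  proof (rule eq_vecI)
    fix i assume "i < dim_vec (0\<^sub>v ?N :: 'b vec)"
    then have i: "i < ?N" by simp
    have *: "(?M *\<^sub>v ?v) $ i = (\<Sum>j = 0..<?N. hom (sylvester_mat p q $$ (i, j)) * z ^ (?N - 1 - j))"
      using i by (simp add: scalar_prod_def)
    show "(?M *\<^sub>v ?v) $ i = (0\<^sub>v ?N) $ i"
    proof (cases "i < ?n")
      case True
      have "(\<Sum>j = 0..<?N. hom (sylvester_mat p q $$ (i, j)) * z ^ (?N - 1 - j))
        = (\<Sum>j\<in>{i..i+?m}. hom (sylvester_mat p q $$ (i, j)) * z ^ (?N - 1 - j))"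
        by (rule sum.mono_neutral_right) (use True i in \<open>auto simp: sylvester_index_mat\<close>)
      also have "\<dots> = (\<Sum>k\<in>{..?m}. hom (coeff p k) * z ^ k * z ^ (?n - 1 - i))"
        by (rule sum.reindex_bij_witness[of _ "\<lambda>k. ?m + i - k" "\<lambda>j. ?m + i - j"])
          (use True i in \<open>auto simp: sylvester_index_mat mult.assoc simp flip: power_add\<close>)
      also have "\<dots> = 0" using sum0[OF p] by (simp flip: sum_distrib_right)
      finally show ?thesis using * i by simp
    next
      case False
      have "(\<Sum>j = 0..<?N. hom (sylvester_mat p q $$ (i, j)) * z ^ (?N - 1 - j))
        = (\<Sum>j\<in>{i-?n..i}. hom (sylvester_mat p q $$ (i, j)) * z ^ (?N - 1 - j))"
        by (rule sum.mono_neutral_right) (use False i in \<open>auto simp: sylvester_index_mat\<close>)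
      also have "\<dots> = (\<Sum>k\<in>{..?n}. hom (coeff q k) * z ^ k * z ^ (?N - 1 - i))"
        by (rule sum.reindex_bij_witness[of _ "\<lambda>k. i - k" "\<lambda>j. i - j"])
          (use False i in \<open>auto simp: sylvester_index_mat mult.assoc simp flip: power_add\<close>)
      also have "\<dots> = 0" using sum0[OF q] by (simp flip: sum_distrib_right)
      finally show ?thesis using * i by simp
    qed
  qed simp
  \<comment> \<open>The last entry is \<open>z ^ 0 = 1\<close>, also for
    \<open>z = 0\<close>.\<close>
  moreover have "?v \<noteq> 0\<^sub>v ?N"
  proof
    assume "?v = 0\<^sub>v ?N"
    then have "?v $ (?N - 1) = (0\<^sub>v ?N :: 'b vec) $ (?N - 1)" by (rule arg_cong)
    then show False using pos by simp
  qed
  ultimately have "det ?M = 0" unfolding det_0_iff_vec_prod_zero[OF M] by (metis vec_carrier)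
  then show ?thesis unfolding resultant_def by simp
qed

lemma prime_resultant_nonzero:
  fixes p q :: "'a::{factorial_ring_gcd,semiring_gcd_mult_normalize} poly"
  assumes p: "prime_elem p" and "\<not> p dvd q"
  shows "resultant p q \<noteq> 0"
proof -
  have "coprime p q" using assms prime_elem_imp_coprime by blast
  then show ?thesis unfolding resultant_0_gcd by simp
qed

section \<open>Red and blue lines on surfaces\<close>

abbreviation degX :: "'a::idom poly poly poly \<Rightarrow> nat" where
  "degX \<equiv> lift_deg (lift_deg degree)"

abbreviation degY :: "'a::idom poly poly poly \<Rightarrow> nat" where
  "degY \<equiv> lift_deg degree"

interpretation lift_degree: degree_function "lift_deg degree :: 'a::idom poly poly \<Rightarrow> nat"
  by (rule degree_poly.degree_function_lift)

interpretation degX: degree_function "degX :: 'a::idom poly poly poly \<Rightarrow> nat"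
  by (rule lift_degree.degree_function_lift)

abbreviation dZ :: "'a::idom poly poly poly \<Rightarrow> 'a poly poly poly" where
  "dZ \<equiv> pderiv"

abbreviation dY :: "'a::idom poly poly poly \<Rightarrow> 'a poly poly poly" where
  "dY \<equiv> map_poly pderiv"

text \<open>A triple \<open>(x, y, z)\<close> encodes the red line \<open>X = x\<close>, \<open>Z = z + y Y\<close>, a triple \<open>(a, b, c)\<close> the
  blue line \<open>Y = b\<close>, \<open>Z = c + a X\<close>; polynomials in \<open>X, Y, Z\<close> have \<open>Z\<close> as outermost variable.\<close>

definition red_eval :: "'a::idom \<times> 'a \<times> 'a \<Rightarrow> 'a poly poly poly \<Rightarrow> 'a poly" where
  "red_eval = (\<lambda>(x, y, z) P. map_poly (\<lambda>q. poly q x) (poly P [:[:z:], [:y:]:]))"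

definition blue_eval :: "'a::idom \<times> 'a \<times> 'a \<Rightarrow> 'a poly poly poly \<Rightarrow> 'a poly" where
  "blue_eval = (\<lambda>(a, b, c) P. poly (poly P [:[:c, a:]:]) [:b:])"

text \<open>The only possible common point has X = \<open>x\<close> and Y = \<open>b\<close>; the
  two sides are the heights Z of the lines there.\<close>

definition meets :: "'a::comm_ring_1 \<times> 'a \<times> 'a \<Rightarrow> 'a \<times> 'a \<times> 'a \<Rightarrow> bool" where
  "meets = (\<lambda>(x, y, z) (a, b, c). z + y * b = c + a * x)"

interpretation map_eval: map_poly_idom_hom "\<lambda>q::'a::idom poly. poly q x" for x ..

lemma red_eval_mult: "red_eval r (P * Q) = red_eval r P * red_eval r Q"
  by (cases r) (simp add: red_eval_def hom_distribs)

lemma red_eval_add: "red_eval r (P + Q) = red_eval r P + red_eval r Q"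
  by (cases r) (simp add: red_eval_def hom_distribs)

lemma red_eval_diff: "red_eval r (P - Q) = red_eval r P - red_eval r Q"
  by (cases r) (simp add: red_eval_def hom_distribs)

lemma red_eval_0 [simp]: "red_eval r 0 = 0"
  by (cases r) (simp add: red_eval_def)

lemma blue_eval_mult: "blue_eval r (P * Q) = blue_eval r P * blue_eval r Q"
  by (cases r) (simp add: blue_eval_def)

lemma blue_eval_0 [simp]: "blue_eval r 0 = 0"
  by (cases r) (simp add: blue_eval_def)

lemma poly_poly_eq: "poly (poly P R) s = poly (poly P [:poly R s:]) s"
  by (induction P) auto

lemma poly_map_eval: "poly (map_poly (\<lambda>q. poly q x) W) b = poly (poly W [:b:]) x"
  by (induction W) (auto simp: hom_distribs)

text \<open>Both sides are the value of \<open>P\<close> at the common point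
  \<open>(x, b, z + y * b)\<close>.\<close>

lemma meets_eval:
  assumes "meets (x, y, z) (a, b, c)"
  shows "poly (red_eval (x, y, z) P) b = poly (blue_eval (a, b, c) P) x"
proof -
  have *: "z + b * y = c + x * a" using assms by (simp add: meets_def mult.commute)
  have "poly (red_eval (x, y, z) P) b = poly (poly (poly P [:[:z:], [:y:]:]) [:b:]) x"
    by (simp add: red_eval_def poly_map_eval)
  also have "\<dots> = poly (poly (poly P [:[:z + b * y:]:]) [:b:]) x"
    by (subst poly_poly_eq) (simp add: mult.commute)
  also have "\<dots> = poly (poly (poly P [:[:c, a:]:]) [:b:]) x"
  proof -
    have aux: "poly (poly (poly P [:R:]) S) x = poly (poly (poly P [:[:poly R x:]:]) S) x"
      for P :: "'a poly poly poly" and R S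
    proof (induction P)
      case (pCons c P)
      then show ?case by simp
    qed simp
    show ?thesis unfolding * aux[of _ "[:c, a:]"] by simp
  qed
  finally show ?thesis by (simp add: blue_eval_def)
qed

lemma map_poly_pderiv_pCons:
  "map_poly pderiv (pCons c P) = pCons (pderiv c) (map_poly pderiv P)"
  by (rule poly_eqI) (simp add: coeff_map_poly coeff_pCons split: nat.split)

lemma pderiv_poly:
  fixes P :: "'a::idom poly poly"
  shows "pderiv (poly P R) = poly (map_poly pderiv P) R + poly (pderiv P) R * pderiv R"
proof (induction P)
  case (pCons c P)
  then show ?case
    by (simp add: pderiv_add pderiv_mult pderiv_pCons map_poly_pderiv_pCons algebra_simps)
qed simp

text \<open>The second fundamental form of the surface in the direction tangent to a plane \<open>X = const\<close>.\<close>

definition flec :: "'a::idom poly poly poly \<Rightarrow> 'a poly poly poly" where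
  "flec P = dZ P * dZ P * dY (dY P) - (dZ P * dY P * dZ (dY P) + dZ P * dY P * dZ (dY P))
            + dY P * dY P * dZ (dZ P)"

lemma dY_dZ: "dY (dZ P) = dZ (dY P)"
  by (rule poly_eqI) (simp add: coeff_pderiv coeff_map_poly pderiv_mult pderiv_of_nat flip: of_nat_Suc)

lemma pderiv_red_eval: "pderiv (red_eval (x, y, z) P) = red_eval (x, y, z) (dY P) + red_eval (x, y, z) (dZ P) * [:y:]"
proof -
  have "pderiv (red_eval (x, y, z) P) = map_poly (\<lambda>q. poly q x) (pderiv (poly P [:[:z:], [:y:]:]))"
    unfolding red_eval_def by (simp add: poly_hom.map_poly_pderiv)
  also have "\<dots> = red_eval (x, y, z) (dY P) + red_eval (x, y, z) (dZ P) * [:y:]"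
    by (simp add: red_eval_def pderiv_poly hom_distribs pderiv_pCons)
  finally show ?thesis .
qed

text \<open>Along a red line in the surface the derivative of \<open>P\<close> in direction (0, 1,
  y) vanishes, so \<open>dY P\<close> equals \<open>- y\<close> times \<open>dZ P\<close> there.
  Then \<open>flec P\<close> becomes the square of \<open>dZ P\<close> times the second derivative
  in that direction, which vanishes as well.\<close>

lemma red_eval_flec:
  assumes "red_eval r P = 0" shows "red_eval r (flec P) = 0"
proof -
  obtain x y z where r: "r = (x, y, z)" by (cases r)
  let ?e = "red_eval r"
  have 1: "?e (dY P) + ?e (dZ P) * [:y:] = 0"
    using pderiv_red_eval[of x y z P] assms r by simp
  have "pderiv (?e (dY P) + ?e (dZ P) * [:y:]) = 0" using 1 by (metis pderiv_0)
  then have 2: "?e (dY (dY P)) + ?e (dZ (dY P)) * [:y:]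
      + (?e (dZ (dY P)) + ?e (dZ (dZ P)) * [:y:]) * [:y:] = 0"
    using pderiv_red_eval[of x y z] r
    by (simp add: pderiv_add pderiv_mult pderiv_smult pderiv_pCons dY_dZ)
  have 3: "?e (dY P) = - (?e (dZ P) * [:y:])" using 1 by (simp add: eq_neg_iff_add_eq_0)
  have ring: "u * u * p - (u * - (u * v) * q + u * - (u * v) * q) + - (u * v) * - (u * v) * s
      = u * u * (p + q * v + (q + s * v) * v)" for u v p q s :: "'a poly"
    by (simp add: algebra_simps)
  have "?e (flec P) = ?e (dZ P) * ?e (dZ P) * (?e (dY (dY P)) + ?e (dZ (dY P)) * [:y:]
      + (?e (dZ (dY P)) + ?e (dZ (dZ P)) * [:y:]) * [:y:])"
    unfolding flec_def red_eval_add red_eval_diff red_eval_mult 3 by (rule ring)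
  then show ?thesis using 2 by simp
qed

lemma degX_dZ: "degX (dZ P) \<le> degX P"
  by (rule lift_degree.lift_deg_pderiv)

lemma degX_dY: "degX (dY P) \<le> degX P"
  by (rule lift_degree.lift_deg_map_poly) (auto intro: degree_poly.lift_deg_pderiv)

lemma degY_dZ: "degY (dZ P) \<le> degY P"
  by (rule degree_poly.lift_deg_pderiv)

lemma degree_dZ: "degree (dZ P) \<le> degree P"
  by (rule order.trans[OF degree_pderiv_le]) simp

lemma degree_dY: "degree (dY P) \<le> degree P"
  by (rule degree_map_poly_le)

lemma (in degree_function) flec_expr_le:
  assumes "\<delta> a \<le> e" "\<delta> b \<le> e" "\<delta> c \<le> e" "\<delta> d \<le> e" "\<delta> f \<le> e"
  shows "\<delta> (a * a * c - (a * b * d + a * b * d) + b * b * f) \<le> 3 * e"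
proof -
  have m: "\<delta> (u * v * w) \<le> 3 * e" if "\<delta> u \<le> e" "\<delta> v \<le> e" "\<delta> w \<le> e" for u v w
    using that mult_le[of "u * v" w] mult_le[of u v] by linarith
  have s: "\<delta> (u + v) \<le> 3 * e" if "\<delta> u \<le> 3 * e" "\<delta> v \<le> 3 * e" for u v
    using that add_le[of u v] by linarith
  have n: "\<delta> (u - v) \<le> 3 * e" if "\<delta> u \<le> 3 * e" "\<delta> v \<le> 3 * e" for u v
    using s[of u "- v"] that by simp
  show ?thesis by (intro s n m assms)
qed

lemma degX_flec: "degX (flec P) \<le> 3 * degX P"
  unfolding flec_def
  by (intro degX.flec_expr_le) (meson degX_dZ degX_dY le_trans)+

lemma degree_flec: "degree (flec P) \<le> 3 * degree P"
  unfolding flec_def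
  by (intro degree_poly.flec_expr_le) (meson degree_dZ degree_dY le_trans)+

lemma red_eval_altdef:
  "red_eval (x, y, z) P = poly (map_poly (map_poly (\<lambda>q. poly q x)) P) [:z, y:]"
proof -
  have "[:z, y:] = map_poly (\<lambda>q. poly q x) [:[:z:], [:y:]:]" by (simp add: hom_distribs)
  then show ?thesis unfolding red_eval_def by (simp add: map_eval.poly_map_poly)
qed

lemma blue_eval_altdef:
  "blue_eval (a, b, c) P = poly (map_poly (\<lambda>q. poly q [:b:]) P) [:c, a:]"
proof -
  have "[:c, a:] = (\<lambda>q. poly q [:b:]) [:[:c, a:]:]" by simp
  then show ?thesis unfolding blue_eval_def by (metis poly_hom.poly_map_poly split_conv)
qed

text \<open>Bezout for lines: eliminating Z leaves a polynomial in X and Y that vanishes on the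
  whole plane X = \<open>x\<close> of a common red line, so \<open>x\<close> is a root of each of
  its coefficients.\<close>

lemma card_common_red_lines:
  fixes P Q :: "'a::field_gcd poly poly poly"
  assumes P: "prime_elem P" "\<not> P dvd Q" "degree P > 0"
    and d: "degX P \<le> e" "degX Q \<le> e"
    and R: "inj_on fst R" "\<And>r. r \<in> R \<Longrightarrow> red_eval r P = 0 \<and> red_eval r Q = 0"
  shows "card R \<le> (degree P + degree Q) * e"
proof -
  let ?W = "resultant P Q"
  have W: "?W \<noteq> 0" using P by (intro prime_resultant_nonzero)
  have deg: "lift_deg degree ?W \<le> (degree P + degree Q) * e"
    using d by (intro lift_degree.resultant_le) (auto simp: lift_degree.lift_deg_le_iff)
  have van: "map_poly (\<lambda>q. poly q x) ?W = 0" if "(x, y, z) \<in> R" for x y z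
    by (rule resultant_vanishes[where z = "[:z, y:]"])
      (use R(2)[OF that] P(3) in \<open>auto simp: red_eval_altdef intro: map_eval.comm_ring_hom_axioms\<close>)
  obtain j where j: "coeff ?W j \<noteq> 0" using W leading_coeff_neq_0 by blast
  have "fst ` R \<subseteq> {x. poly (coeff ?W j) x = 0}"
  proof
    fix x assume "x \<in> fst ` R"
    then obtain y z where "(x, y, z) \<in> R" by force
    from van[OF this] have "coeff (map_poly (\<lambda>q. poly q x) ?W) j = 0" by simp
    then show "x \<in> {x. poly (coeff ?W j) x = 0}" by simp
  qed
  then have "card (fst ` R) \<le> card {x. poly (coeff ?W j) x = 0}"
    using j by (intro card_mono poly_roots_finite) auto
  also have "\<dots> \<le> degree (coeff ?W j)" using j by (rule card_poly_roots_bound)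
  also have "\<dots> \<le> lift_deg degree ?W" by (rule degree_poly.coeff_le_lift_deg)
  finally show ?thesis using deg card_image[OF R(1)] by simp
qed

text \<open>Here \<open>b\<close> is a root of the resultant as a polynomial in Y over the
  polynomials in X.\<close>

lemma card_common_blue_lines:
  fixes P Q :: "'a::field_gcd poly poly poly"
  assumes P: "prime_elem P" "\<not> P dvd Q" "degree P > 0"
    and d: "degY P \<le> e" "degY Q \<le> e"
    and R: "inj_on (fst \<circ> snd) B" "\<And>r. r \<in> B \<Longrightarrow> blue_eval r P = 0 \<and> blue_eval r Q = 0"
  shows "card B \<le> (degree P + degree Q) * e"
proof -
  let ?W = "resultant P Q"
  have W: "?W \<noteq> 0" using P by (intro prime_resultant_nonzero)
  have deg: "degree ?W \<le> (degree P + degree Q) * e"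
    using d by (intro degree_poly.resultant_le) (auto simp: degree_poly.lift_deg_le_iff)
  have van: "poly ?W [:b:] = 0" if "(a, b, c) \<in> B" for a b c
    by (rule resultant_vanishes[where z = "[:c, a:]"])
      (use R(2)[OF that] P(3) in \<open>auto simp: blue_eval_altdef intro: poly_hom.comm_ring_hom_axioms\<close>)
  have "(\<lambda>b. [:b:]) ` (fst \<circ> snd) ` B \<subseteq> {x. poly ?W x = 0}" using van by auto
  then have "card ((\<lambda>b. [:b:]) ` (fst \<circ> snd) ` B) \<le> card {x. poly ?W x = 0}"
    using W by (intro card_mono poly_roots_finite) auto
  also have "\<dots> \<le> degree ?W" using W by (rule card_poly_roots_bound)
  finally show ?thesis using deg card_image[OF R(1)]
    by (simp add: card_image inj_on_def)
qed

section \<open>Restriction to tangent lines, with X left in the coefficient ring\<close>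

definition subst2 :: "'a::idom poly \<Rightarrow> 'a poly \<Rightarrow> 'a poly poly \<Rightarrow> 'a poly" where
  "subst2 L M P = poly (map_poly (\<lambda>c. c \<circ>\<^sub>p L) P) M"

interpretation map_pcompose: map_poly_idom_hom "\<lambda>c::'a::idom poly. c \<circ>\<^sub>p L" for L ..

lemma subst2_simps [simp]:
  "subst2 L M 0 = 0"
  "subst2 L M (pCons c P) = (c \<circ>\<^sub>p L) + M * subst2 L M P"
  "subst2 L M (P + Q) = subst2 L M P + subst2 L M Q"
  "subst2 L M (P - Q) = subst2 L M P - subst2 L M Q"
  "subst2 L M (P * Q) = subst2 L M P * subst2 L M Q"
  "subst2 L M (smult c P) = (c \<circ>\<^sub>p L) * subst2 L M P"
  unfolding subst2_def by (simp_all add: hom_distribs)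

lemma pderiv_subst2:
  "pderiv (subst2 L M P) = subst2 L M (map_poly pderiv P) * pderiv L + subst2 L M (pderiv P) * pderiv M"
proof (induction P)
  case (pCons c P)
  then show ?case
    by (simp add: pderiv_add pderiv_mult pderiv_pCons pderiv_pcompose map_poly_pderiv_pCons algebra_simps)
qed simp

lemma poly_subst2_0: "poly (subst2 L M P) 0 = poly (poly P [:poly M 0:]) (poly L 0)"
  by (induction P) (auto simp: poly_pcompose)

text \<open>For a restriction to lines this bounds the integers that \<open>ode_unique\<close>
  requires to be nonzero in the field.\<close>

lemma degree_subst2_le:
  assumes "degree L \<le> 1" "degree M \<le> 1"
  shows "degree (subst2 L M P) \<le> lift_deg degree P + degree P"
proof -
  have "subst2 L M P = (\<Sum>i\<le>degree P. (coeff P i \<circ>\<^sub>p L) * M ^ i)"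
    unfolding subst2_def by (subst poly_altdef, rule sum.mono_neutral_cong_left)
      (auto simp: degree_map_poly_le le_degree)
  also have "degree \<dots> \<le> lift_deg degree P + degree P"
  proof (rule degree_sum_le)
    fix i assume i: "i \<in> {..degree P}"
    have "degree ((coeff P i \<circ>\<^sub>p L) * M ^ i) \<le> degree (coeff P i \<circ>\<^sub>p L) + degree (M ^ i)"
      by (rule degree_mult_le)
    also have "\<dots> \<le> degree (coeff P i) * degree L + degree M * i"
      by (intro add_mono degree_pcompose_le degree_power_le)
    also have "\<dots> \<le> degree (coeff P i) * 1 + 1 * i" using assms by (intro add_mono mult_mono) auto
    also have "\<dots> \<le> lift_deg degree P + degree P"
      using i degree_poly.coeff_le_lift_deg[of P i] by simp
    finally show "degree ((coeff P i \<circ>\<^sub>p L) * M ^ i) \<le> lift_deg degree P + degree P" .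
  qed simp
  finally show ?thesis .
qed

lemma coeff_mult_lowest:
  assumes "\<And>i. i < n \<Longrightarrow> coeff v i = 0"
  shows "coeff (u * v) n = coeff u 0 * coeff v n"
proof -
  have "coeff (u * v) n = (\<Sum>i\<le>n. coeff u i * coeff v (n - i))" by (rule coeff_mult)
  also have "\<dots> = (\<Sum>i\<in>{0}. coeff u i * coeff v (n - i))"
    by (rule sum.mono_neutral_right) (auto simp: assms)
  finally show ?thesis by simp
qed

text \<open>Let \<open>s\<close> be the least index with \<open>coeff h s\<close> nonzero. In the
  coefficient of index \<open>s - 2\<close> the terms with \<open>w\<close> and \<open>v\<close>
  drop out, and \<open>coeff u 0 * s * (s - 1) * coeff h s = 0\<close> remains.\<close>

lemma ode_unique:
  fixes h u v w :: "'a::idom poly"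
  assumes eq: "u * pderiv (pderiv h) + w * pderiv h = v * h"
    and u: "coeff u 0 \<noteq> 0" and h: "coeff h 0 = 0" "coeff h 1 = 0"
    and char: "\<And>s. 0 < s \<Longrightarrow> s \<le> degree h \<Longrightarrow> of_nat s \<noteq> (0::'a)"
  shows "h = 0"
proof (rule ccontr)
  assume "h \<noteq> 0"
  then have ex: "\<exists>s. coeff h s \<noteq> 0" using leading_coeff_neq_0 by blast
  define s where "s = (LEAST s. coeff h s \<noteq> 0)"
  have s: "coeff h s \<noteq> 0" unfolding s_def using ex by (rule LeastI_ex)
  have low: "coeff h i = 0" if "i < s" for i using that not_less_Least unfolding s_def by blast
  have s2: "s \<ge> 2" using s h by (metis One_nat_def less_2_cases not_le_imp_less)
  have deg: "s \<le> degree h" using s by (rule le_degree)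
  define n where "n = s - 2"
  have n: "s = Suc (Suc n)" using s2 n_def by simp
  have "coeff (v * h) n = 0"
    using coeff_mult_lowest[of n h v] low n by simp
  moreover have "coeff (w * pderiv h) n = 0"
    using coeff_mult_lowest[of n "pderiv h" w] low n by (simp add: coeff_pderiv)
  moreover have "coeff (u * pderiv (pderiv h)) n = coeff u 0 * coeff (pderiv (pderiv h)) n"
    by (rule coeff_mult_lowest) (simp add: coeff_pderiv low n)
  ultimately have "coeff u 0 * (of_nat (Suc n) * (of_nat (Suc (Suc n)) * coeff h s)) = 0"
    using arg_cong[OF eq, of "\<lambda>p. coeff p n"] by (simp add: coeff_pderiv n)
  moreover have "of_nat (Suc n) \<noteq> (0::'a)" "of_nat (Suc (Suc n)) \<noteq> (0::'a)"
    using char[of "Suc n"] char[of "Suc (Suc n)"] deg n by auto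
  ultimately show False using u s by (simp del: of_nat_Suc)
qed

lemma poly_of_nat_neq_0:
  "of_nat n \<noteq> (0::'a::comm_ring_1) \<Longrightarrow> of_nat n \<noteq> (0::'a poly)"
  by (metis coeff_0 coeff_pCons_0 of_nat_poly)

text \<open>Leaving a blue line in the direction tangent to the surface and to the plane \<open>X = const\<close>, the restriction
  of \<open>P\<close> satisfies a linear differential equation of second order with zero initial values, because \<open>P\<close>
  divides \<open>flec P\<close>. Hence \<open>P\<close> vanishes on these tangent lines.\<close>

lemma prime_dvd_linear:
  fixes P :: "'a::field_gcd poly poly poly"
  assumes P: "prime_elem P" "degree P > 0" "P dvd flec P"
    and d: "degY P \<le> d" "degree P \<le> d"
    and char: "\<And>s. 0 < s \<Longrightarrow> s \<le> 2 * d \<Longrightarrow> of_nat s \<noteq> (0::'a)"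
    and blue: "blue_eval (a, b, c) P = 0" and ns: "blue_eval (a, b, c) (dZ P) \<noteq> 0"
  shows "\<exists>pY. P dvd [:[:pY * - [:b:], pY:] - [:blue_eval (a, b, c) (dZ P) * [:c, a:]:],
                    [:blue_eval (a, b, c) (dZ P):]:]"
proof -
  define W where "W = [:c, a:]"
  define pZ where "pZ = blue_eval (a, b, c) (dZ P)"
  define pY where "pY = blue_eval (a, b, c) (dY P)"
  \<comment> \<open>On the blue line the direction \<open>(0, pZ, - pY)\<close> is annihilated by
    the differential of \<open>P\<close>. As X stays a variable, the tangent lines at all points of
    the blue line are treated at once.\<close>
  define L where "L = [:[:b:], pZ:]"
  define M where "M = [:W, - pY:]"
  let ?s = "subst2 L M"
  define h where "h = ?s P"
  have dL: "pderiv L = [:pZ:]" and dM: "pderiv M = [:- pY:]"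
    by (simp_all add: L_def M_def pderiv_pCons)
  have ev: "coeff (?s Q) 0 = blue_eval (a, b, c) Q" for Q
    unfolding poly_0_coeff_0[symmetric] poly_subst2_0
    by (simp add: L_def M_def W_def blue_eval_def)
  have h': "pderiv h = ?s (dY P) * [:pZ:] - ?s (dZ P) * [:pY:]"
    unfolding h_def pderiv_subst2 dL dM by simp
  have h'': "pderiv (pderiv h) = ?s (dY (dY P)) * [:pZ:] * [:pZ:]
      - (?s (dZ (dY P)) * [:pY:] * [:pZ:] + ?s (dZ (dY P)) * [:pY:] * [:pZ:])
      + ?s (dZ (dZ P)) * [:pY:] * [:pY:]"
    unfolding h' pderiv_diff pderiv_mult pderiv_subst2 dL dM dY_dZ
    by (simp add: pderiv_pCons algebra_simps)
  obtain A where A: "flec P = P * A" using P(3) by (elim dvdE)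
  \<comment> \<open>Found by inserting \<open>?s (dY P) * pZ = pderiv h + ?s (dZ P) * pY\<close>
    into \<open>pZ * pZ * ?s (flec P)\<close>: what is left besides the second derivative of
    \<open>h\<close> is a multiple of \<open>pderiv h\<close>.\<close>
  define G where "G = - (?s (dZ P) * ?s (dZ (dY P)) * [:pZ:] + ?s (dZ P) * ?s (dZ (dY P)) * [:pZ:])
     + (pderiv h + ?s (dZ P) * [:pY:] + ?s (dZ P) * [:pY:]) * ?s (dZ (dZ P))"
  have ring: "z * z * (yy * q * q - (zy * p * q + zy * p * q) + zz * p * p)
     + (- (z * zy * q + z * zy * q) + (t + z * p + z * p) * zz) * t
     = q * q * (z * z * yy - (z * y * zy + z * y * zy) + y * y * zz)"
    if "t = y * q - z * p" for z y p q yy zy zz t :: "'a poly poly"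
    unfolding that by (simp add: algebra_simps)
  have eq: "?s (dZ P) * ?s (dZ P) * pderiv (pderiv h) + G * pderiv h = [:pZ:] * [:pZ:] * ?s A * h"
  proof -
    have "?s (dZ P) * ?s (dZ P) * pderiv (pderiv h) + G * pderiv h = [:pZ:] * [:pZ:] * ?s (flec P)"
      unfolding h'' G_def flec_def subst2_simps by (rule ring[OF h'])
    also have "\<dots> = [:pZ:] * [:pZ:] * ?s A * h"
      unfolding A h_def by (simp add: algebra_simps)
    finally show ?thesis .
  qed
  have "h = 0"
  proof (rule ode_unique[OF eq])
    show "coeff (?s (dZ P) * ?s (dZ P)) 0 \<noteq> 0"
      using ns by (simp add: ev coeff_mult)
    show "coeff h 0 = 0" unfolding h_def ev by (rule blue)
    have "coeff (pderiv h) 0 = 0"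
      unfolding h' by (simp add: coeff_mult ev pZ_def pY_def)
    then show "coeff h 1 = 0" by (simp add: coeff_pderiv)
    fix s assume s: "0 < s" "s \<le> degree h"
    have "degree L \<le> 1" "degree M \<le> 1" by (simp_all add: L_def M_def)
    then have "degree h \<le> lift_deg degree P + degree P" unfolding h_def by (rule degree_subst2_le)
    then have "s \<le> 2 * d" using s d by linarith
    then show "of_nat s \<noteq> (0::'a poly)" using char s by (intro poly_of_nat_neq_0) auto
  qed
  \<comment> \<open>This is \<open>pY * (Y - b) + pZ * (Z - W)\<close>, which vanishes on all the
    tangent lines.\<close>
  define G1 where "G1 = [:[:pY * - [:b:], pY:] - [:pZ * W:], [:pZ:]:]"
  have pZ0: "pZ \<noteq> 0" using ns by (simp add: pZ_def)
  then have G10: "G1 \<noteq> 0" and dG1: "degree G1 = 1" by (simp_all add: G1_def)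
  obtain H r where Hr: "pseudo_divmod P G1 = (H, r)" by fastforce
  note pd = pseudo_divmod[OF G10 Hr]
  have "degree r = 0" using pd(2) dG1 by auto
  then obtain r0 where r0: "r = [:r0:]" by (metis degree_eq_zeroE)
  have sG1: "?s G1 = 0"
    by (simp add: G1_def L_def M_def pcompose_pCons algebra_simps)
  have eq1: "smult (coeff G1 (degree G1) ^ (Suc (degree P) - degree G1)) P = G1 * H + r"
    using pd(1) .
  have "?s (G1 * H + r) = 0"
    using \<open>h = 0\<close> unfolding eq1[symmetric] subst2_simps h_def by simp
  then have "r0 \<circ>\<^sub>p L = 0" unfolding subst2_simps sG1 r0 by simp
  \<comment> \<open>The remainder is free of Z, and \<open>L\<close> is not constant because
    \<open>pZ\<close> is nonzero.\<close>
  then have "r0 = 0" using pZ0 by (subst (asm) pcompose_eq_0_iff) (auto simp: L_def)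
  then have eq2: "smult ([:pZ:] ^ degree P) P = G1 * H"
    using eq1 dG1 r0 by (simp add: G1_def)
  have "P dvd G1 * H" unfolding eq2[symmetric] by (rule dvd_smult) simp
  \<comment> \<open>In Z the degree of \<open>H\<close> is one less than that of
    \<open>P\<close>.\<close>
  moreover have "\<not> P dvd H"
  proof
    assume *: "P dvd H"
    have P0: "P \<noteq> 0" using P by auto
    have "G1 * H \<noteq> 0" unfolding eq2[symmetric] using P0 pZ0 by simp
    then have H0: "H \<noteq> 0" by auto
    have "degree (G1 * H) = degree P" unfolding eq2[symmetric] using pZ0 by simp
    then have "1 + degree H = degree P" using degree_mult_eq[OF G10 H0] dG1 by simp
    then show False using dvd_imp_degree_le[OF * H0] by simp
  qed
  ultimately have "P dvd G1" using P(1) prime_elem_dvd_mult_iff by blast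
  then show ?thesis unfolding G1_def pZ_def W_def by blast
qed

text \<open>A second blue line shows that \<open>pY\<close> is a multiple of \<open>pZ\<close> by a linear polynomial.\<close>

lemma prime_surface_bilinear:
  fixes P :: "'a::field_gcd poly poly poly"
  assumes P: "prime_elem P" "degree P > 0"
    and d: "degX P \<le> d" "degY P \<le> d" "degree P \<le> d"
    and char: "\<And>s. 0 < s \<Longrightarrow> s \<le> 2 * d \<Longrightarrow> of_nat s \<noteq> (0::'a)"
    and R: "inj_on fst R" "\<And>r. r \<in> R \<Longrightarrow> red_eval r P = 0" "card R > 12 * degree P * d"
    and B: "inj_on (fst \<circ> snd) B" "\<And>r. r \<in> B \<Longrightarrow> blue_eval r P = 0" "card B > 12 * degree P * d"
  shows "\<exists>\<alpha> \<beta> \<gamma> \<delta>. \<forall>(a, b, c)\<in>B. c = \<alpha> + \<gamma> * b \<and> a = \<beta> + \<delta> * b"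
proof -
  have flec: "P dvd flec P"
  proof (rule ccontr)
    assume *: "\<not> P dvd flec P"
    \<comment> \<open>The degrees of \<open>flec P\<close> are at most three times those of
      \<open>P\<close>; the 12 in the hypotheses is the Bezout factor (1 + 3) * 3.\<close>
    have "card R \<le> (degree P + degree (flec P)) * (3 * d)"
      using d degX_flec[of P] R(1)
      by (intro card_common_red_lines[OF P(1) * P(2)]) (auto intro: R(2) red_eval_flec)
    also have "\<dots> \<le> (4 * degree P) * (3 * d)" using degree_flec[of P] by (intro mult_right_mono) auto
    finally show False using R(3) by simp
  qed
  \<comment> \<open>In positive characteristic a derivative may vanish identically; the bound on
    \<open>degree P\<close> excludes this.\<close>
  have dZ0: "\<not> P dvd dZ P"
  proof
    assume *: "P dvd dZ P"
    have "coeff (dZ P) (degree P - 1) = of_nat (degree P) * lead_coeff P"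
      using P(2) by (simp add: coeff_pderiv)
    moreover have "of_nat (degree P) \<noteq> (0::'a)" using char[of "degree P"] d P by simp
    then have "of_nat (degree P) \<noteq> (0::'a poly poly)" by (intro poly_of_nat_neq_0)
    ultimately have "dZ P \<noteq> 0" using P(2) by auto
    then have "degree P \<le> degree (dZ P)" using * by (intro dvd_imp_degree_le)
    then show False using degree_pderiv_le[of P] P(2) by linarith
  qed
  have "\<exists>r\<in>B. blue_eval r (dZ P) \<noteq> 0"
  proof (rule ccontr)
    assume "\<not> (\<exists>r\<in>B. blue_eval r (dZ P) \<noteq> 0)"
    then have "card B \<le> (degree P + degree (dZ P)) * d"
      using d degY_dZ[of P] B by (intro card_common_blue_lines[OF P(1) dZ0 P(2)]) auto
    also have "\<dots> \<le> (12 * degree P) * d" using degree_dZ[of P] P(2) by (intro mult_right_mono) auto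
    finally show False using B(3) by simp
  qed
  then obtain a b c where abc: "(a, b, c) \<in> B" and ns: "blue_eval (a, b, c) (dZ P) \<noteq> 0"
    by (metis prod_cases3)
  define pZ where "pZ = blue_eval (a, b, c) (dZ P)"
  have pZ0: "pZ \<noteq> 0" using ns by (simp add: pZ_def)
  obtain pY where pY: "P dvd [:[:pY * - [:b:], pY:] - [:pZ * [:c, a:]:], [:pZ:]:]"
    using prime_dvd_linear[OF P flec d(2,3) char B(2)[OF abc] ns] unfolding pZ_def by auto
  have on: "blue_eval r Q = 0" if "P dvd Q" "r \<in> B" for r Q
    using that B(2)[OF that(2)] by (elim dvdE) (simp add: blue_eval_mult)
  have "12 * degree P * d \<ge> 1" using d(3) P(2) by (simp add: Suc_le_eq)
  then have "card B > 1" using B(3) by linarith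
  then have "\<not> B \<subseteq> {(a, b, c)}" using card_mono[of "{(a, b, c)}" B] by auto
  then obtain r2 where r2: "r2 \<in> B" "r2 \<noteq> (a, b, c)" by blast
  obtain a2 b2 c2 where abc2: "r2 = (a2, b2, c2)" by (cases r2)
  have bb: "b2 \<noteq> b" using inj_onD[OF B(1), of r2 "(a, b, c)"] r2 abc abc2 by auto
  define l0 l1 where "l0 = (c - c2) / (b2 - b)" and "l1 = (a - a2) / (b2 - b)"
  have alg: "u + (v - w) = 0 \<Longrightarrow> v = w - u" for u v w :: "'a poly"
    by (simp add: algebra_simps)
  have "pZ * [:c2, a2:] + (pY * [:b2 - b:] - pZ * [:c, a:]) = 0"
    using on[OF pY r2(1)] unfolding abc2 blue_eval_def by (simp add: algebra_simps smult_diff_left)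
  then have "pY * [:b2 - b:] = pZ * [:c, a:] - pZ * [:c2, a2:]"
    by (rule alg)
  also have "\<dots> = pZ * [:c - c2, a - a2:]"
    unfolding right_diff_distrib[symmetric] by simp
  also have "[:c - c2, a - a2:] = [:l0, l1:] * [:b2 - b:]"
    using bb by (simp add: l0_def l1_def)
  finally have "pY * [:b2 - b:] = pZ * [:l0, l1:] * [:b2 - b:]" by (simp only: mult.assoc)
  moreover have "[:b2 - b:] \<noteq> 0" using bb by simp
  ultimately have pYl: "pY = pZ * [:l0, l1:]" using mult_right_cancel by blast
  \<comment> \<open>Dividing the linear polynomial by \<open>pZ\<close> leaves
    \<open>Z - (c + a * X) + (l0 + l1 * X) * (Y - b)\<close>, the equation of a bilinear
    graph.\<close>
  define g where "g = [:[:[:l0, l1:] * - [:b:] - [:c, a:], [:l0, l1:]:], 1:]"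
  have factor: "[:[:p * l * - t, p * l:] - [:p * w:], [:p:]:] = [:[:p:]:] * [:[:l * - t - w, l:], 1:]"
    for p l t w :: "'a poly"
    by (simp add: algebra_simps)
  have "[:[:pY * - [:b:], pY:] - [:pZ * [:c, a:]:], [:pZ:]:] = [:[:pZ:]:] * g"
    unfolding g_def pYl by (rule factor)
  then have "P dvd [:[:pZ:]:] * g" using pY by simp
  moreover have "\<not> P dvd [:[:pZ:]:]"
    using dvd_imp_degree_le[of P "[:[:pZ:]:]"] pZ0 P(2) by auto
  ultimately have Pg: "P dvd g" using P(1) prime_elem_dvd_mult_iff by blast
  have "c' = (c + l0 * b) + (- l0) * b' \<and> a' = (a + l1 * b) + (- l1) * b'" if "(a', b', c') \<in> B" for a' b' c'
    using on[OF Pg that] unfolding g_def blue_eval_def by (simp add: algebra_simps)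
  then show ?thesis by blast
qed

section \<open>Incidences between red and blue lines\<close>

lemma homogeneous_system_nontrivial:
  fixes M :: "'e \<Rightarrow> 'v \<Rightarrow> 'a::field"
  assumes "finite E" "finite V" "card E < card V"
  shows "\<exists>x. (\<exists>v\<in>V. x v \<noteq> 0) \<and> (\<forall>e\<in>E. (\<Sum>v\<in>V. M e v * x v) = 0)"
  using assms
proof (induction E arbitrary: V M rule: finite_induct)
  case empty
  then have "V \<noteq> {}" by auto
  then show ?case by (intro exI[of _ "\<lambda>_. 1"]) auto
next
  case (insert e E)
  show ?case
  proof (cases "\<forall>v\<in>V. M e v = 0")
    case True
    have "card E < card V" using insert by simp
    from insert.IH[OF insert.prems(1) this, of M] True show ?thesis by auto
  next
    case False
    then obtain w where w: "w \<in> V" "M e w \<noteq> 0" by auto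
    let ?V = "V - {w}"
    have "card E < card ?V" using insert w by simp
    from insert.IH[OF _ this, of "\<lambda>e' v. M e' v - M e' w * M e v / M e w"] insert.prems
    obtain x where x: "\<exists>v\<in>?V. x v \<noteq> 0"
      "\<And>e'. e' \<in> E \<Longrightarrow> (\<Sum>v\<in>?V. (M e' v - M e' w * M e v / M e w) * x v) = 0" by auto
    define t where "t = - (\<Sum>v\<in>?V. M e v * x v) / M e w"
    define x' where "x' = x(w := t)"
    have split: "(\<Sum>v\<in>V. M e' v * x' v) = M e' w * t + (\<Sum>v\<in>?V. M e' v * x v)" for e'
      using w insert.prems by (subst sum.remove[of V w]) (auto simp: x'_def intro!: sum.cong)
    have "(\<Sum>v\<in>V. M e v * x' v) = 0" unfolding split t_def using w by simp
    moreover have "(\<Sum>v\<in>V. M e' v * x' v) = 0" if "e' \<in> E" for e'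
    proof -
      have "(\<Sum>v\<in>?V. (M e' v - M e' w * M e v / M e w) * x v)
        = (\<Sum>v\<in>?V. M e' v * x v) - M e' w * (\<Sum>v\<in>?V. M e v * x v) / M e w"
        by (simp add: sum_subtractf left_diff_distrib sum_distrib_left sum_divide_distrib mult.assoc)
      then show ?thesis unfolding split t_def using x(2)[OF that] by simp
    qed
    moreover have "\<exists>v\<in>V. x' v \<noteq> 0" using x(1) by (auto simp: x'_def)
    ultimately show ?thesis by blast
  qed
qed

lemma red_eval_sum: "red_eval r (sum f I) = (\<Sum>i\<in>I. red_eval r (f i))"
  by (induction I rule: infinite_finite_induct) (auto simp: red_eval_add)

lemma red_eval_monom:
  "red_eval (x, y, z) (monom (monom (monom c i) j) l) = smult c (smult (x ^ i) (monom 1 j * [:z, y:] ^ l))"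
  unfolding red_eval_altdef by (simp add: poly_monom hom_distribs, simp add: monom_altdef)

text \<open>The restriction of \<open>P\<close> to a red line has degree at most
  \<open>2 * d\<close>, so each line imposes \<open>2 * d + 1\<close> linear conditions on the
  \<open>(d + 1) ^ 3\<close> coefficients.\<close>

lemma interpolate_red_lines:
  fixes S :: "('a::field_gcd \<times> 'a \<times> 'a) set"
  assumes S: "finite S" "card S * (2 * d + 1) < (d + 1) ^ 3"
  obtains P where "P \<noteq> 0" "degX P \<le> d" "degY P \<le> d" "degree P \<le> d" "\<And>r. r \<in> S \<Longrightarrow> red_eval r P = 0"
proof -
  let ?V = "{..d} \<times> {..d} \<times> {..d}"
  let ?E = "S \<times> {..2 * d}"
  let ?m = "\<lambda>(i, j, l). (\<lambda>c::'a. monom (monom (monom c i) j) l)"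
  define M where "M = (\<lambda>(r, k) v. coeff (red_eval r (?m v 1)) k)"
  have "card ?V = (d + 1) ^ 3" by (simp only: card_cartesian_product card_atMost) (simp add: power3_eq_cube)
  then have "card ?E < card ?V" using S(2) by (simp only: card_cartesian_product card_atMost) simp
  then have "\<exists>f. (\<exists>v\<in>?V. f v \<noteq> 0) \<and> (\<forall>e\<in>?E. (\<Sum>v\<in>?V. M e v * f v) = 0)"
    by (intro homogeneous_system_nontrivial) (use S(1) in auto)
  then obtain f where f: "\<exists>v\<in>?V. f v \<noteq> 0" "\<And>e. e \<in> ?E \<Longrightarrow> (\<Sum>v\<in>?V. M e v * f v) = 0"
    by blast
  define P where "P = (\<Sum>v\<in>?V. ?m v (f v))"
  have cP: "coeff (coeff (coeff P l) j) i = (if i \<le> d \<and> j \<le> d \<and> l \<le> d then f (i, j, l) else 0)" for i j l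
  proof -
    have "coeff (coeff (coeff P l) j) i = (\<Sum>v\<in>?V. if v = (i, j, l) then f v else 0)"
      unfolding P_def coeff_sum
    proof (intro sum.cong refl)
      fix v :: "nat \<times> nat \<times> nat"
      obtain i' j' l' where "v = (i', j', l')" by (cases v)
      then show "coeff (coeff (coeff (?m v (f v)) l) j) i = (if v = (i, j, l) then f v else 0)"
        by (cases "l' = l"; cases "j' = j"; cases "i' = i") simp_all
    qed
    also have "\<dots> = (if (i, j, l) \<in> ?V then f (i, j, l) else 0)" by (subst sum.delta) auto
    finally show ?thesis by auto
  qed
  show ?thesis
  proof
    obtain i j l where "(i, j, l) \<in> ?V" "f (i, j, l) \<noteq> 0" using f(1) by auto
    then have "coeff (coeff (coeff P l) j) i \<noteq> 0" by (simp add: cP)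
    then show "P \<noteq> 0" by auto
    show "degX P \<le> d" unfolding lift_degree.lift_deg_le_iff degree_poly.lift_deg_le_iff
      by (intro allI degree_le) (simp add: cP)
    show "degY P \<le> d" unfolding degree_poly.lift_deg_le_iff
      by (intro allI degree_le) (simp add: cP poly_eq_iff)
    show "degree P \<le> d" by (intro degree_le) (simp add: cP poly_eq_iff)
    fix r assume r: "r \<in> S"
    obtain x y z where xyz: "r = (x, y, z)" by (cases r)
    have lin: "red_eval r (?m v c) = smult c (red_eval r (?m v 1))" for v c
      by (cases v) (simp add: xyz red_eval_monom)
    have e: "red_eval r P = (\<Sum>v\<in>?V. smult (f v) (red_eval r (?m v 1)))"
      unfolding P_def red_eval_sum by (intro sum.cong refl lin)
    have dg: "degree (red_eval r (?m v 1)) \<le> 2 * d" if "v \<in> ?V" for v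
    proof -
      obtain i j l where v: "v = (i, j, l)" by (cases v)
      have "degree (red_eval r (?m v 1)) \<le> degree (monom (1::'a) j * [:z, y:] ^ l)"
        by (simp add: v xyz red_eval_monom)
      also have "\<dots> \<le> degree (monom (1::'a) j) + degree ([:z, y:] ^ l)" by (rule degree_mult_le)
      also have "\<dots> \<le> j + degree [:z, y:] * l"
        by (intro add_mono degree_monom_le degree_power_le)
      also have "\<dots> \<le> d + 1 * d" using that v by (intro add_mono mult_mono) auto
      finally show ?thesis by simp
    qed
    show "red_eval r P = 0"
    proof (rule poly_eqI)
      fix k
      show "coeff (red_eval r P) k = coeff 0 k"
      proof (cases "k \<le> 2 * d")
        case True
        then have "(r, k) \<in> ?E" using r by simp
        from f(2)[OF this] show ?thesis unfolding e coeff_sum by (simp add: M_def mult.commute)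
      next
        case False
        have "degree (red_eval r P) \<le> 2 * d"
          unfolding e using dg degree_smult_le le_trans by (intro degree_sum_le) (simp, blast)
        then show ?thesis using False by (simp add: coeff_eq_0)
      qed
    qed
  qed
qed

text \<open>Derandomised second moment method: each point is kept with probability \<open>1/q\<close>.\<close>

lemma second_moment_sample:
  fixes w :: "'b \<Rightarrow> real" and q :: nat
  assumes "finite R" "q \<ge> 1" "\<And>b. b \<in> B \<Longrightarrow> w b \<ge> 0"
  shows "\<exists>S\<subseteq>R. (\<Sum>b\<in>B. w b * (real q * card (S \<inter> D b) - card (R \<inter> D b))\<^sup>2)
            \<le> (\<Sum>b\<in>B. w b * ((real q - 1) * card (R \<inter> D b)))"
  using assms(1)
proof (induction R rule: finite_induct)
  case (insert r R)
  then obtain S where S: "S \<subseteq> R" and le: "(\<Sum>b\<in>B. w b * (real q * card (S \<inter> D b) - card (R \<inter> D b))\<^sup>2)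
            \<le> (\<Sum>b\<in>B. w b * ((real q - 1) * card (R \<inter> D b)))" by auto
  define f where "f T = (\<Sum>b\<in>B. w b * (real q * card (T \<inter> D b) - card (insert r R \<inter> D b))\<^sup>2)" for T
  define Y where "Y b = real q * card (S \<inter> D b) - card (R \<inter> D b)" for b
  let ?i = "\<lambda>b. if r \<in> D b then 1 else 0 :: real"
  have finS: "finite S" using S insert finite_subset by blast
  have rS: "r \<notin> S" using S insert by auto
  have cR: "real (card (insert r R \<inter> D b)) = card (R \<inter> D b) + ?i b" for b
    using insert by (auto simp: Int_insert_left)
  have cS: "real (card (insert r S \<inter> D b)) = card (S \<inter> D b) + ?i b" for b
    using finS rS by (auto simp: Int_insert_left)
  have 1: "f (insert r S) = (\<Sum>b\<in>B. w b * (Y b + (real q - 1) * ?i b)\<^sup>2)"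
    unfolding f_def cR cS Y_def by (intro sum.cong refl) (simp add: algebra_simps)
  have 2: "f S = (\<Sum>b\<in>B. w b * (Y b - ?i b)\<^sup>2)"
    unfolding f_def cR Y_def by (intro sum.cong refl) (simp add: algebra_simps)
  \<comment> \<open>This is \<open>q\<close> times the mean when \<open>r\<close> is kept with
    probability \<open>1 / q\<close>; the cross terms cancel.\<close>
  have "f (insert r S) + (real q - 1) * f S
      = (\<Sum>b\<in>B. real q * (w b * (Y b)\<^sup>2) + real q * (w b * ((real q - 1) * ?i b)))"
    unfolding 1 2 sum_distrib_left sum.distrib[symmetric]
    by (intro sum.cong refl) (simp add: power2_eq_square algebra_simps)
  also have "\<dots> = real q * ((\<Sum>b\<in>B. w b * (Y b)\<^sup>2) + (\<Sum>b\<in>B. w b * ((real q - 1) * ?i b)))"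
    by (simp add: sum.distrib sum_distrib_left distrib_left)
  also have "\<dots> \<le> real q * ((\<Sum>b\<in>B. w b * ((real q - 1) * card (R \<inter> D b))) + (\<Sum>b\<in>B. w b * ((real q - 1) * ?i b)))"
    using le unfolding Y_def by (intro mult_left_mono add_mono) auto
  also have "\<dots> = real q * (\<Sum>b\<in>B. w b * ((real q - 1) * card (insert r R \<inter> D b)))"
    unfolding cR by (simp add: sum.distrib[symmetric] algebra_simps)
  finally have le2: "f (insert r S) + (real q - 1) * f S \<le> real q * (\<Sum>b\<in>B. w b * ((real q - 1) * card (insert r R \<inter> D b)))"
    (is "_ \<le> real q * ?T") .
  have "f (insert r S) \<le> ?T \<or> f S \<le> ?T"
  proof (rule ccontr)
    assume "\<not> ?thesis"
    then have a: "f (insert r S) > ?T" and "f S > ?T" by auto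
    then have "(real q - 1) * f S \<ge> (real q - 1) * ?T" using assms(2) by (intro mult_left_mono) auto
    then have "f (insert r S) + (real q - 1) * f S > real q * ?T" using a by (simp add: algebra_simps)
    then show False using le2 by simp
  qed
  then show ?case
  proof
    assume "f (insert r S) \<le> ?T"
    then show ?case using S unfolding f_def by (intro exI[of _ "insert r S"] conjI) auto
  next
    assume "f S \<le> ?T"
    then show ?case using S unfolding f_def by (intro exI[of _ S] conjI) auto
  qed
qed auto

section \<open>Incidence bounds from codegrees\<close>

definition inc :: "('a::comm_ring_1 \<times> 'a \<times> 'a) set \<Rightarrow> ('a \<times> 'a \<times> 'a) set \<Rightarrow> (('a \<times> 'a \<times> 'a) \<times> ('a \<times> 'a \<times> 'a)) set" where
  "inc R B = {(r, b). r \<in> R \<and> b \<in> B \<and> meets r b}"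

text \<open>The blue lines of \<open>B\<close> on the surface
  \<open>Z = \<alpha> + \<beta> X + \<gamma> Y + \<delta> X Y\<close>.\<close>

definition bilinear_blues :: "('a::comm_ring_1 \<times> 'a \<times> 'a) set \<Rightarrow> 'a \<Rightarrow> 'a \<Rightarrow> 'a \<Rightarrow> 'a \<Rightarrow> ('a \<times> 'a \<times> 'a) set" where
  "bilinear_blues B \<alpha> \<beta> \<gamma> \<delta> = {(a, b, c) \<in> B. c = \<alpha> + \<gamma> * b \<and> a = \<beta> + \<delta> * b}"

lemma finite_inc [simp]: "finite R \<Longrightarrow> finite B \<Longrightarrow> finite (inc R B)"
  by (rule finite_subset[of _ "R \<times> B"]) (auto simp: inc_def)

lemma card_inc_blue:
  assumes "finite R" "finite B"
  shows "card (inc R B) = (\<Sum>b\<in>B. card {r\<in>R. meets r b})"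
proof -
  have "inc R B = (\<lambda>(b, r). (r, b)) ` (SIGMA b:B. {r\<in>R. meets r b})" by (auto simp: inc_def)
  then have "card (inc R B) = card (SIGMA b:B. {r\<in>R. meets r b})"
    by (simp add: card_image inj_on_def)
  then show ?thesis using assms by simp
qed

lemma card_inc_red:
  assumes "finite R" "finite B"
  shows "card (inc R B) = (\<Sum>r\<in>R. card {b\<in>B. meets r b})"
proof -
  have "inc R B = (SIGMA r:R. {b\<in>B. meets r b})" by (auto simp: inc_def)
  then show ?thesis using assms by simp
qed

text \<open>For given \<open>b\<close>, meeting both lines is a linear system for \<open>a\<close>
  and \<open>c\<close> with determinant \<open>x - x'\<close> up to sign, and its solution is affine
  in \<open>b\<close>. So the codegree of two red lines is bounded by the blue lines on one bilinear
  surface.\<close>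

lemma two_red_lines_bilinear:
  fixes r r' :: "'a::field \<times> 'a \<times> 'a"
  assumes "fst r \<noteq> fst r'"
  shows "\<exists>\<alpha> \<beta> \<gamma> \<delta>. {b\<in>B. meets r b \<and> meets r' b} \<subseteq> bilinear_blues B \<alpha> \<beta> \<gamma> \<delta>"
proof -
  obtain x y z where r: "r = (x, y, z)" by (cases r)
  obtain x' y' z' where r': "r' = (x', y', z')" by (cases r')
  define \<beta> \<delta> where "\<beta> = (z - z') / (x - x')" and "\<delta> = (y - y') / (x - x')"
  have x: "x - x' \<noteq> 0" using assms r r' by simp
  have "c = (z - \<beta> * x) + (y - \<delta> * x) * b \<and> a = \<beta> + \<delta> * b"
    if "z + y * b = c + a * x" "z' + y' * b = c + a * x'" for a b c
  proof -
    have "a * (x - x') = (z - z') + (y - y') * b" using that by (simp add: algebra_simps)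
    then have "a = ((z - z') + (y - y') * b) / (x - x')" using x by (simp add: field_simps)
    then have a: "a = \<beta> + \<delta> * b" by (simp add: \<beta>_def \<delta>_def add_divide_distrib)
    have "c = z + y * b - a * x" using that(1) by (simp add: algebra_simps)
    then show ?thesis using a by (simp add: algebra_simps)
  qed
  then have "{b\<in>B. meets r b \<and> meets r' b} \<subseteq> bilinear_blues B (z - \<beta> * x) \<beta> (y - \<delta> * x) \<delta>"
    by (auto simp: meets_def r r' bilinear_blues_def)
  then show ?thesis by blast
qed

text \<open>Cauchy-Schwarz, read off from the nonnegativity of the variance.\<close>

lemma sum_squared_le_card_sum_squares:
  fixes f :: "'b \<Rightarrow> real"
  assumes "finite B"
  shows "(\<Sum>b\<in>B. f b)\<^sup>2 \<le> card B * (\<Sum>b\<in>B. (f b)\<^sup>2)"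
proof (cases "B = {}")
  case False
  define n where "n = real (card B)"
  define m where "m = (\<Sum>b\<in>B. f b) / n"
  have n: "n > 0" using False assms by (simp add: n_def card_gt_0_iff)
  have "0 \<le> (\<Sum>b\<in>B. (f b - m)\<^sup>2)" by (intro sum_nonneg) simp
  also have "\<dots> = (\<Sum>b\<in>B. (f b)\<^sup>2) - 2 * m * (\<Sum>b\<in>B. f b) + n * m\<^sup>2"
  proof -
    have "(\<Sum>b\<in>B. 2 * f b * m) = 2 * m * (\<Sum>b\<in>B. f b)"
      by (subst sum_distrib_left, rule sum.cong) auto
    then show ?thesis by (simp add: power2_diff sum.distrib sum_subtractf n_def)
  qed
  also have "\<dots> = (\<Sum>b\<in>B. (f b)\<^sup>2) - (\<Sum>b\<in>B. f b)\<^sup>2 / n"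
    using n by (simp add: m_def power2_eq_square)
  finally show ?thesis using n by (simp add: n_def field_simps)
qed simp

text \<open>The Kovari-Sos-Turan argument. The squared degrees of the elements of \<open>B\<close>
  count triples \<open>(r, r', b)\<close>, so Cauchy-Schwarz gives
  \<open>I^2 <= |B| (I + \<kappa> |R|^2)\<close> for the number \<open>I\<close> of related
  pairs.\<close>

lemma card_relation_codegree:
  fixes E :: "'b \<Rightarrow> 'c \<Rightarrow> bool" and \<kappa> :: nat
  assumes fin: "finite R" "finite B"
    and \<kappa>: "\<And>r r'. r \<in> R \<Longrightarrow> r' \<in> R \<Longrightarrow> r \<noteq> r' \<Longrightarrow> card {b\<in>B. E r b \<and> E r' b} \<le> \<kappa>"
  shows "real (card {(r, b). r \<in> R \<and> b \<in> B \<and> E r b}) \<le> card B + card R * sqrt (\<kappa> * card B)"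
proof -
  define g where "g b = card {r\<in>R. E r b}" for b
  define I where "I = card {(r, b). r \<in> R \<and> b \<in> B \<and> E r b}"
  have I: "I = (\<Sum>b\<in>B. g b)" 
  proof -
    have "{(r, b). r \<in> R \<and> b \<in> B \<and> E r b} = (\<lambda>(b, r). (r, b)) ` (SIGMA b:B. {r\<in>R. E r b})" by auto
    then have "I = card (SIGMA b:B. {r\<in>R. E r b})" unfolding I_def by (simp add: card_image inj_on_def)
    then show ?thesis using fin by (simp add: g_def)
  qed
  have "(real I)\<^sup>2 \<le> card B * (\<Sum>b\<in>B. (real (g b))\<^sup>2)"
    unfolding I using sum_squared_le_card_sum_squares[of B "\<lambda>b. real (g b)"] fin by simp
  moreover have "(\<Sum>b\<in>B. (g b)\<^sup>2) \<le> I + (card R)\<^sup>2 * \<kappa>"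
  proof -
    let ?D = "\<lambda>b. {r\<in>R. E r b}"
    have "(g b)\<^sup>2 \<le> g b + card {(r, r'). r \<in> ?D b \<and> r' \<in> ?D b \<and> r \<noteq> r'}" for b
    proof -
      have "(g b)\<^sup>2 = card (?D b \<times> ?D b)" by (simp add: g_def card_cartesian_product power2_eq_square)
      also have "?D b \<times> ?D b = (\<lambda>r. (r, r)) ` ?D b \<union> {(r, r'). r \<in> ?D b \<and> r' \<in> ?D b \<and> r \<noteq> r'}" by auto
      also have "card \<dots> \<le> card ((\<lambda>r. (r, r)) ` ?D b) + card {(r, r'). r \<in> ?D b \<and> r' \<in> ?D b \<and> r \<noteq> r'}"
        by (rule card_Un_le)
      also have "card ((\<lambda>r. (r, r)) ` ?D b) = g b" by (simp add: g_def card_image inj_on_def)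
      finally show ?thesis .
    qed
    then have "(\<Sum>b\<in>B. (g b)\<^sup>2) \<le> (\<Sum>b\<in>B. g b + card {(r, r'). r \<in> ?D b \<and> r' \<in> ?D b \<and> r \<noteq> r'})"
      by (rule sum_mono)
    also have "\<dots> = I + (\<Sum>b\<in>B. card {(r, r'). r \<in> ?D b \<and> r' \<in> ?D b \<and> r \<noteq> r'})"
      by (simp add: sum.distrib I)
    also have "(\<Sum>b\<in>B. card {(r, r'). r \<in> ?D b \<and> r' \<in> ?D b \<and> r \<noteq> r'})
       = card (SIGMA b:B. {(r, r'). r \<in> ?D b \<and> r' \<in> ?D b \<and> r \<noteq> r'})"
      using fin by (subst card_SigmaI) (auto intro: finite_subset[of _ "R \<times> R"])
    also have "\<dots> = card (SIGMA p:{(r, r'). r \<in> R \<and> r' \<in> R \<and> r \<noteq> r'}. {b\<in>B. E (fst p) b \<and> E (snd p) b})"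
      by (rule bij_betw_same_card[of "\<lambda>(b, p). (p, b)"], rule bij_betwI[of _ _ _ "\<lambda>(p, b). (b, p)"]) auto
    also have "\<dots> = (\<Sum>p\<in>{(r, r'). r \<in> R \<and> r' \<in> R \<and> r \<noteq> r'}. card {b\<in>B. E (fst p) b \<and> E (snd p) b})"
      using fin by (subst card_SigmaI) (auto intro: finite_subset[of _ "R \<times> R"])
    also have "\<dots> \<le> card {(r, r'). r \<in> R \<and> r' \<in> R \<and> r \<noteq> r'} * \<kappa>"
    proof (rule sum_bounded_above[where K = \<kappa>, simplified])
      fix p assume "p \<in> {(r, r'). r \<in> R \<and> r' \<in> R \<and> r \<noteq> r'}"
      then show "card {b\<in>B. E (fst p) b \<and> E (snd p) b} \<le> \<kappa>" using \<kappa>[of "fst p" "snd p"] by auto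
    qed
    also have "\<dots> \<le> card (R \<times> R) * \<kappa>"
      using fin by (intro mult_right_mono card_mono) auto
    finally show ?thesis by (simp add: card_cartesian_product power2_eq_square)
  qed
  then have "real (\<Sum>b\<in>B. (g b)\<^sup>2) \<le> real (I + (card R)\<^sup>2 * \<kappa>)" by (rule of_nat_mono)
  then have "(\<Sum>b\<in>B. (real (g b))\<^sup>2) \<le> real I + (real (card R))\<^sup>2 * \<kappa>" by simp
  ultimately have le: "(real I)\<^sup>2 \<le> card B * (real I + (real (card R))\<^sup>2 * \<kappa>)"
    by (meson mult_left_mono of_nat_0_le_iff order_trans)
  show ?thesis
  proof (rule ccontr)
    assume "\<not> ?thesis"
    then have gt: "real I > card B + card R * sqrt (\<kappa> * card B)" by (simp add: I_def)
    let ?t = "real (card R) * sqrt (\<kappa> * card B)"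
    have t0: "?t \<ge> 0" by simp
    have "?t * ?t = card B * ((real (card R))\<^sup>2 * \<kappa>)"
      by (simp add: power2_eq_square)
    then have "real I * (real I - card B) \<le> ?t * ?t"
      using le by (simp add: power2_eq_square algebra_simps)
    moreover have "real I * (real I - card B) > ?t * ?t"
      using gt t0 by (intro mult_strict_mono') auto
    ultimately show False by simp
  qed
qed

lemma card_inc_codegree:
  fixes R B :: "('a::field \<times> 'a \<times> 'a) set"
  assumes fin: "finite R" "finite B" and inj: "inj_on fst R"
    and \<kappa>: "\<And>\<alpha> \<beta> \<gamma> \<delta>. card (bilinear_blues B \<alpha> \<beta> \<gamma> \<delta>) \<le> \<kappa>"
  shows "real (card (inc R B)) \<le> card B + card R * sqrt (\<kappa> * card B)"
  unfolding inc_def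
proof (rule card_relation_codegree[OF fin])
  fix r r' assume "r \<in> R" "r' \<in> R" "r \<noteq> r'"
  then have "fst r \<noteq> fst r'" using inj_onD[OF inj, of r r'] by auto
  from two_red_lines_bilinear[OF this, of B] obtain \<alpha> \<beta> \<gamma> \<delta>
    where "{b\<in>B. meets r b \<and> meets r' b} \<subseteq> bilinear_blues B \<alpha> \<beta> \<gamma> \<delta>" by blast
  then have "card {b\<in>B. meets r b \<and> meets r' b} \<le> card (bilinear_blues B \<alpha> \<beta> \<gamma> \<delta>)"
    using fin by (intro card_mono) (auto simp: bilinear_blues_def intro: finite_subset[of _ B])
  then show "card {b\<in>B. meets r b \<and> meets r' b} \<le> \<kappa>" using \<kappa> le_trans by blast
qed

section \<open>Restrictions to lines and prime components\<close>

lemma (in degree_function) prod_eq: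
  "(\<And>i. i \<in> I \<Longrightarrow> f i \<noteq> 0) \<Longrightarrow> \<delta> (prod f I) = (\<Sum>i\<in>I. \<delta> (f i))"
  by (induction I rule: infinite_finite_induct) (auto simp: mult)

lemma degree_blue_eval_le: "degree (blue_eval b P) \<le> degX P + degree P"
proof -
  obtain u v w where b: "b = (u, v, w)" by (cases b)
  have "blue_eval b P = (\<Sum>i\<le>degree P. poly (coeff P i) [:v:] * [:w, u:] ^ i)"
    unfolding b blue_eval_altdef by (subst poly_altdef, rule sum.mono_neutral_cong_left)
      (auto simp: degree_map_poly_le le_degree)
  also have "degree \<dots> \<le> degX P + degree P"
  proof (rule degree_sum_le)
    fix i assume i: "i \<in> {..degree P}"
    have "degree (poly (coeff P i) [:v:]) \<le> degX P"
      unfolding poly_altdef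
    proof (rule degree_sum_le)
      fix j
      have "degree (coeff (coeff P i) j * [:v:] ^ j) \<le> degree (coeff (coeff P i) j) + degree ([:v:] ^ j)"
        by (rule degree_mult_le)
      also have "degree ([:v:] ^ j) \<le> 0" using degree_power_le[of "[:v:]" j] by simp
      also have "degree (coeff (coeff P i) j) \<le> degX P"
        by (meson degree_poly.coeff_le_lift_deg le_trans lift_degree.coeff_le_lift_deg)
      finally show "degree (coeff (coeff P i) j * [:v:] ^ j) \<le> degX P" by simp
    qed simp
    moreover have "degree ([:w, u:] ^ i) \<le> degree P"
      using degree_power_le[of "[:w, u:]" i] i by (auto intro: order.trans split: if_splits)
    ultimately show "degree (poly (coeff P i) [:v:] * [:w, u:] ^ i) \<le> degX P + degree P"
      by (meson add_mono degree_mult_le le_trans)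
  qed simp
  finally show ?thesis .
qed

lemma degree_red_eval_le: "degree (red_eval r P) \<le> degY P + degree P"
proof -
  obtain x y z where r: "r = (x, y, z)" by (cases r)
  have "red_eval r P = (\<Sum>i\<le>degree P. map_poly (\<lambda>q. poly q x) (coeff P i) * [:z, y:] ^ i)"
    unfolding r red_eval_altdef by (subst poly_altdef, rule sum.mono_neutral_cong_left)
      (auto simp: degree_map_poly_le le_degree)
  also have "degree \<dots> \<le> degY P + degree P"
  proof (rule degree_sum_le)
    fix i assume i: "i \<in> {..degree P}"
    have "degree (map_poly (\<lambda>q. poly q x) (coeff P i)) \<le> degY P"
      by (meson degree_map_poly_le degree_poly.coeff_le_lift_deg le_trans)
    moreover have "degree ([:z, y:] ^ i) \<le> degree P"
      using degree_power_le[of "[:z, y:]" i] i by (auto intro: order.trans split: if_splits)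
    ultimately show "degree (map_poly (\<lambda>q. poly q x) (coeff P i) * [:z, y:] ^ i) \<le> degY P + degree P"
      by (meson add_mono degree_mult_le le_trans)
  qed simp
  finally show ?thesis .
qed

text \<open>Each line of \<open>R\<close> contributes its own \<open>x\<close> as a root of the
  restriction of \<open>P\<close> to the blue line.\<close>

lemma card_meeting_reds_le:
  assumes "blue_eval b P \<noteq> 0" "inj_on fst R" "\<And>r. r \<in> R \<Longrightarrow> meets r b \<and> red_eval r P = 0"
  shows "card R \<le> degX P + degree P"
proof -
  obtain u v w where b: "b = (u, v, w)" by (cases b)
  have "fst ` R \<subseteq> {x. poly (blue_eval b P) x = 0}"
    using assms(3) meets_eval[of _ _ _ u v w P] b by fastforce
  then have "card (fst ` R) \<le> card {x. poly (blue_eval b P) x = 0}"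
    using assms(1) by (intro card_mono poly_roots_finite) auto
  also have "\<dots> \<le> degree (blue_eval b P)" using assms(1) by (rule card_poly_roots_bound)
  finally show ?thesis using card_image[OF assms(2)] degree_blue_eval_le[of b P] by simp
qed

lemma card_meeting_blues_le:
  assumes "red_eval r P \<noteq> 0" "inj_on (fst \<circ> snd) B" "\<And>b. b \<in> B \<Longrightarrow> meets r b \<and> blue_eval b P = 0"
  shows "card B \<le> degY P + degree P"
proof -
  obtain x y z where r: "r = (x, y, z)" by (cases r)
  have "(fst \<circ> snd) ` B \<subseteq> {t. poly (red_eval r P) t = 0}"
    using assms(3) meets_eval[of x y z _ _ _ P] r by fastforce
  then have "card ((fst \<circ> snd) ` B) \<le> card {t. poly (red_eval r P) t = 0}"
    using assms(1) by (intro card_mono poly_roots_finite) auto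
  also have "\<dots> \<le> degree (red_eval r P)" using assms(1) by (rule card_poly_roots_bound)
  finally show ?thesis using card_image[OF assms(2)] degree_red_eval_le[of r P] by simp
qed

text \<open>Such a prime would be both \<open>X - x\<close> and \<open>Y - b\<close> up to units.\<close>

lemma prime_degree_0_lines:
  fixes P :: "'a::field_gcd poly poly poly"
  assumes P: "prime_elem P" "degree P = 0" and b: "blue_eval b P = 0" and r: "red_eval r P = 0"
  shows False
proof -
  obtain w where w: "P = [:w:]" using P(2) by (rule degree_eq_zeroE)
  obtain u v s where bb: "b = (u, v, s)" by (cases b)
  obtain x y z where rr: "r = (x, y, z)" by (cases r)
  have "irreducible w" using P(1) unfolding w by (simp add: prime_elem_const_poly_iff prime_elem_imp_irreducible)
  have "poly w [:v:] = 0" using b by (simp add: bb w blue_eval_def)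
  then obtain k where k: "w = [:- [:v:], 1:] * k" by (auto simp: poly_eq_0_iff_dvd)
  have "\<not> is_unit [:- [:v:], 1:]" by (simp add: is_unit_poly_iff)
  then have "is_unit k" using \<open>irreducible w\<close> k irreducibleD by blast
  then obtain e where e: "k = [:e:]" "is_unit e" by (auto simp: is_unit_poly_iff)
  have "e \<noteq> 0" "degree e = 0" using e(2) by (auto simp: is_unit_iff_degree)
  then obtain t where t: "e = [:t:]" "t \<noteq> 0" by (metis degree_eq_zeroE pCons_0_0)
  have "map_poly (\<lambda>q. poly q x) w = 0" using r by (simp add: rr w red_eval_def)
  then have "coeff (map_poly (\<lambda>q. poly q x) w) 1 = 0" by simp
  then show False using t by (simp add: k e)
qed

text \<open>Every prime is taken once, so a product of components is again a divisor of
  \<open>P\<close> and inherits its degree bounds.\<close>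

lemma prime_factors_facts:
  fixes P :: "'a::factorial_semiring"
  assumes "P \<noteq> 0"
  shows "finite (prime_factors P)" "F \<subseteq> prime_factors P \<Longrightarrow> \<Prod>F dvd P"
    "\<And>f. f \<in> prime_factors P \<Longrightarrow> prime_elem f \<and> f \<noteq> 0 \<and> f dvd P"
proof -
  show "finite (prime_factors P)" by simp
  show "\<And>f. f \<in> prime_factors P \<Longrightarrow> prime_elem f \<and> f \<noteq> 0 \<and> f dvd P"
    by (auto simp: in_prime_factors_iff)
  assume F: "F \<subseteq> prime_factors P"
  have "mset_set F \<subseteq># mset_set (prime_factors P)"
    using F by (simp add: msubset_mset_set_iff finite_subset)
  also have "\<dots> \<subseteq># prime_factorization P" by (rule mset_set_set_mset_msubset)
  finally have "prod_mset (mset_set F) dvd prod_mset (prime_factorization P)"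
    by (rule prod_mset_subset_imp_dvd)
  then show "\<Prod>F dvd P"
    using prod_mset_prime_factorization_weak[OF assms] F
    by (simp add: prod_unfold_prod_mset) (metis dvd_trans normalize_dvd_iff dvd_refl)
qed

lemma exists_prime_factor_vanishing:
  fixes P :: "'a::{factorial_semiring} " and ev :: "'a \<Rightarrow> 'b::idom"
  assumes "P \<noteq> 0" "ev P = 0" and mult: "\<And>p q. ev (p * q) = ev p * ev q" and one: "ev 1 = 1"
  shows "\<exists>f\<in>prime_factors P. ev f = 0"
proof -
  have "P dvd prod_mset (prime_factorization P)"
    using prod_mset_prime_factorization_weak[OF assms(1)] by (metis dvd_refl normalize_dvd_iff dvd_normalize_iff)
  then have "ev (prod_mset (prime_factorization P)) = 0" using assms(2) by (auto elim!: dvdE simp: mult)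
  moreover have "\<exists>f\<in>#M. ev f = 0" if "ev (prod_mset M) = 0" for M
    using that by (induction M) (auto simp: mult one)
  ultimately show ?thesis by blast
qed

lemma red_eval_1: "red_eval r 1 = 1"
  by (cases r) (simp add: red_eval_def)

lemma blue_eval_1: "blue_eval b 1 = 1"
  by (cases b) (simp add: blue_eval_def)

text \<open>Every blue line meets few lines of a component it is not contained in, components with few red
  or few blue lines are handled by the codegree bound, and all other components are bilinear.\<close>

lemma card_inc_surface:
  fixes R B :: "('a::field_gcd \<times> 'a \<times> 'a) set" and n d \<kappa> :: nat
  assumes fin: "finite R" "finite B" and inj: "inj_on fst R" "inj_on (fst \<circ> snd) B"
    and n: "card R \<le> n" "card B \<le> n"
    and char: "\<And>s. 0 < s \<Longrightarrow> s \<le> 2 * d \<Longrightarrow> of_nat s \<noteq> (0::'a)"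
    and \<kappa>: "\<And>\<alpha> \<beta> \<gamma> \<delta>. card (bilinear_blues B \<alpha> \<beta> \<gamma> \<delta>) \<le> \<kappa>"
    and P: "P \<noteq> 0" "degX P \<le> d" "degY P \<le> d" "degree P \<le> d"
    and R0: "\<And>r. r \<in> R \<Longrightarrow> red_eval r P = 0"
  shows "real (card (inc R B)) \<le> 2 * d * n + n * \<kappa> + (n + 12 * d\<^sup>2 * sqrt (\<kappa> * n))
            + (12 * d\<^sup>2 + n * sqrt (\<kappa> * (12 * d\<^sup>2)))"
proof -
  define Fs where "Fs = prime_factors P"
  note pf = prime_factors_facts[OF P(1), folded Fs_def]
  have "\<forall>r\<in>R. \<exists>f\<in>Fs. red_eval r f = 0"
    unfolding Fs_def
    by (intro ballI exists_prime_factor_vanishing P(1)) (simp_all add: R0 red_eval_mult red_eval_1)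
  \<comment> \<open>Each red line is charged to one component only, while a blue line may belong to
    several sets \<open>Bf f\<close>.\<close>
  then obtain \<phi> where \<phi>: "\<And>r. r \<in> R \<Longrightarrow> \<phi> r \<in> Fs" "\<And>r. r \<in> R \<Longrightarrow> red_eval r (\<phi> r) = 0" by metis
  define Rf where "Rf f = {r\<in>R. \<phi> r = f}" for f
  define Bf where "Bf f = {b\<in>B. blue_eval b f = 0}" for f
  have bounds: "degX G \<le> d" "degY G \<le> d" "degree G \<le> d" if "G dvd P" for G
    using degX.dvd_le[OF that P(1)] lift_degree.dvd_le[OF that P(1)] degree_poly.dvd_le[OF that P(1)] P
    by auto
  have "(\<Sum>f\<in>Fs. degree f) = degree (\<Prod>Fs)"
    using degree_poly.prod_eq[of Fs "\<lambda>f. f"] pf(3) by simp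
  also have "\<dots> \<le> d" using bounds(3)[OF pf(2)] by simp
  finally have sumdeg: "(\<Sum>f\<in>Fs. degree f) \<le> d" .
  \<comment> \<open>The degrees of the components add up to at most \<open>d\<close>, so these
    thresholds sum to at most \<open>12 * d^2\<close> over all poor components.\<close>
  define FR where "FR = {f\<in>Fs. card (Rf f) \<le> 12 * degree f * d}"
  define FB where "FB = {f\<in>Fs. card (Bf f) \<le> 12 * degree f * d}"
  have sub: "(\<Sum>f\<in>F. 12 * degree f * d) \<le> 12 * d\<^sup>2" if "F \<subseteq> Fs" for F
  proof -
    have "(\<Sum>f\<in>F. 12 * degree f * d) \<le> (\<Sum>f\<in>Fs. 12 * degree f * d)"
      using that pf(1) by (intro sum_mono2) auto
    also have "\<dots> = 12 * (\<Sum>f\<in>Fs. degree f) * d" by (simp add: sum_distrib_left sum_distrib_right mult.assoc)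
    also have "\<dots> \<le> 12 * d * d" using sumdeg by simp
    finally show ?thesis by (simp add: power2_eq_square)
  qed
  define Rs where "Rs = (\<Union>f\<in>FR. Rf f)"
  define Bs where "Bs = (\<Union>f\<in>FB. Bf f)"
  have "card Rs \<le> (\<Sum>f\<in>FR. card (Rf f))" unfolding Rs_def FR_def using pf(1) by (intro card_UN_le) simp
  also have "\<dots> \<le> (\<Sum>f\<in>FR. 12 * degree f * d)" by (intro sum_mono) (simp add: FR_def)
  also have "\<dots> \<le> 12 * d\<^sup>2" by (rule sub) (auto simp: FR_def)
  finally have cRs: "card Rs \<le> 12 * d\<^sup>2" .
  have "card Bs \<le> (\<Sum>f\<in>FB. card (Bf f))" unfolding Bs_def FB_def using pf(1) by (intro card_UN_le) simp
  also have "\<dots> \<le> (\<Sum>f\<in>FB. 12 * degree f * d)" by (intro sum_mono) (simp add: FB_def)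
  also have "\<dots> \<le> 12 * d\<^sup>2" by (rule sub) (auto simp: FB_def)
  finally have cBs: "card Bs \<le> 12 * d\<^sup>2" .
  have RsR: "Rs \<subseteq> R" and BsB: "Bs \<subseteq> B" by (auto simp: Rs_def Rf_def Bs_def Bf_def)
  define Cr where "Cr b = {r\<in>R. meets r b \<and> blue_eval b (\<phi> r) \<noteq> 0}" for b
  have cCr: "card (Cr b) \<le> 2 * d" for b
  proof -
    \<comment> \<open>The product of all components that do not contain \<open>b\<close> vanishes on
      every line of \<open>Cr b\<close> but not on \<open>b\<close>, so the bound
      \<open>2 * d\<close> does not grow with the number of components.\<close>
    define F where "F = {f\<in>Fs. blue_eval b f \<noteq> 0}"
    have FP: "\<Prod>F dvd P" by (rule pf(2)) (auto simp: F_def)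
    have "blue_eval b (\<Prod>F') \<noteq> 0" if "F' \<subseteq> F" "finite F'" for F'
      using that(2,1) by (induction F' rule: finite_induct) (auto simp: blue_eval_mult blue_eval_1 F_def)
    then have "blue_eval b (\<Prod>F) \<noteq> 0" using pf(1) by (simp add: F_def)
    moreover have "red_eval r (\<Prod>F) = 0" if "r \<in> Cr b" for r
    proof -
      have "\<phi> r \<in> F" using that \<phi> by (auto simp: Cr_def F_def)
      then have "\<phi> r dvd \<Prod>F" using pf(1) by (intro dvd_prodI) (simp add: F_def)
      then show ?thesis using \<phi>(2)[of r] that by (auto elim!: dvdE simp: red_eval_mult Cr_def)
    qed
    ultimately have "card (Cr b) \<le> degX (\<Prod>F) + degree (\<Prod>F)"
      using inj(1) by (intro card_meeting_reds_le) (auto simp: Cr_def inj_on_def)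
    then show ?thesis using bounds[OF FP] by linarith
  qed
  define Y where "Y r = {b\<in>Bf (\<phi> r). \<phi> r \<notin> FR \<and> \<phi> r \<notin> FB}" for r
  have cY: "card (Y r) \<le> \<kappa>" if r: "r \<in> R" for r
  proof (cases "Y r = {}")
    case False
    then obtain b where b: "b \<in> Bf (\<phi> r)" and nF: "\<phi> r \<notin> FR" "\<phi> r \<notin> FB" by (auto simp: Y_def)
    let ?f = "\<phi> r"
    have f: "?f \<in> Fs" using \<phi> r by simp
    have prime: "prime_elem ?f" and dvd: "?f dvd P" using pf(3)[OF f] by auto
    have "blue_eval b ?f = 0" using b by (simp add: Bf_def)
    then have "degree ?f \<noteq> 0" using prime_degree_0_lines[OF prime _ _ \<phi>(2)[OF r]] by blast
    have "\<exists>\<alpha> \<beta> \<gamma> \<delta>. \<forall>(a, b, c)\<in>Bf ?f. c = \<alpha> + \<gamma> * b \<and> a = \<beta> + \<delta> * b"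
    proof (rule prime_surface_bilinear[OF prime _ bounds[OF dvd] char])
      show "0 < degree ?f" using \<open>degree ?f \<noteq> 0\<close> by simp
      show "inj_on fst (Rf ?f)" using inj(1) by (rule inj_on_subset) (auto simp: Rf_def)
      show "inj_on (fst \<circ> snd) (Bf ?f)" using inj(2) by (rule inj_on_subset) (auto simp: Bf_def)
      show "red_eval r' ?f = 0" if "r' \<in> Rf ?f" for r' using that \<phi>(2)[of r'] by (simp add: Rf_def)
      show "blue_eval b' ?f = 0" if "b' \<in> Bf ?f" for b' using that by (simp add: Bf_def)
      show "12 * degree ?f * d < card (Rf ?f)" using nF(1) f by (simp add: FR_def)
      show "12 * degree ?f * d < card (Bf ?f)" using nF(2) f by (simp add: FB_def)
    qed
    then obtain \<alpha> \<beta> \<gamma> \<delta> where *: "\<forall>(a, b, c)\<in>Bf ?f. c = \<alpha> + \<gamma> * b \<and> a = \<beta> + \<delta> * b"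
      by (elim exE)
    have "Y r \<subseteq> bilinear_blues B \<alpha> \<beta> \<gamma> \<delta>"
      using * by (auto simp: Y_def Bf_def bilinear_blues_def)
    then have "card (Y r) \<le> card (bilinear_blues B \<alpha> \<beta> \<gamma> \<delta>)"
      using fin by (intro card_mono) (auto simp: bilinear_blues_def intro: finite_subset[of _ B])
    then show ?thesis using \<kappa> le_trans by blast
  qed simp
  have cover: "inc R B \<subseteq> (\<lambda>(b, r). (r, b)) ` (SIGMA b:B. Cr b) \<union> (SIGMA r:R. Y r) \<union> inc Rs B \<union> inc R Bs"
  proof
    fix p assume "p \<in> inc R B"
    then obtain r b where p: "p = (r, b)" "r \<in> R" "b \<in> B" "meets r b" by (auto simp: inc_def)
    have f: "\<phi> r \<in> Fs" using \<phi> p by simp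
    consider "r \<in> Cr b" | "b \<in> Bf (\<phi> r)" using p by (auto simp: Cr_def Bf_def)
    then show "p \<in> (\<lambda>(b, r). (r, b)) ` (SIGMA b:B. Cr b) \<union> (SIGMA r:R. Y r) \<union> inc Rs B \<union> inc R Bs"
    proof cases
      case 2
      have "r \<in> Rf (\<phi> r)" using p by (simp add: Rf_def)
      then have "r \<in> Rs \<or> b \<in> Bs \<or> b \<in> Y r"
        using 2 by (auto simp: Rs_def Bs_def Y_def)
      then show ?thesis using p by (auto simp: inc_def)
    next
      case 1
      then show ?thesis using p by auto
    qed
  qed
  have finCr: "finite (Cr b)" for b using fin by (simp add: Cr_def)
  have finY: "finite (Y r)" for r using fin by (simp add: Y_def Bf_def)
  have finRs: "finite Rs" "finite Bs" using RsR BsB fin finite_subset by auto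
  have "card (inc R B) \<le> card ((\<lambda>(b, r). (r, b)) ` (SIGMA b:B. Cr b) \<union> (SIGMA r:R. Y r) \<union> inc Rs B \<union> inc R Bs)"
    using fin finCr finY finRs by (intro card_mono[OF _ cover]) auto
  also have "\<dots> \<le> card ((\<lambda>(b, r). (r, b)) ` (SIGMA b:B. Cr b)) + card (SIGMA r:R. Y r) + card (inc Rs B) + card (inc R Bs)"
    by (meson add_mono card_Un_le le_refl le_trans)
  also have "card ((\<lambda>(b, r). (r, b)) ` (SIGMA b:B. Cr b)) \<le> card (SIGMA b:B. Cr b)"
    using fin finCr by (intro card_image_le) auto
  also have "card (SIGMA b:B. Cr b) = (\<Sum>b\<in>B. card (Cr b))" using fin finCr by simp
  also have "\<dots> \<le> card B * (2 * d)" using cCr by (intro sum_bounded_above[where K = "2 * d", simplified])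
  also have "\<dots> \<le> n * (2 * d)" using n by (intro mult_right_mono) auto
  also have "card (SIGMA r:R. Y r) = (\<Sum>r\<in>R. card (Y r))" using fin finY by simp
  also have "\<dots> \<le> card R * \<kappa>" using cY by (intro sum_bounded_above[where K = \<kappa>, simplified])
  also have "\<dots> \<le> n * \<kappa>" using n by (intro mult_right_mono) auto
  finally have le: "card (inc R B) \<le> n * (2 * d) + n * \<kappa> + card (inc Rs B) + card (inc R Bs)" by simp
  have 1: "real (card (inc Rs B)) \<le> n + 12 * d\<^sup>2 * sqrt (\<kappa> * n)"
  proof -
    have "real (card (inc Rs B)) \<le> card B + card Rs * sqrt (\<kappa> * card B)"
      using finRs fin \<kappa> inj_on_subset[OF inj(1) RsR] by (intro card_inc_codegree) auto
    also have "\<dots> \<le> n + real (12 * d\<^sup>2) * sqrt (\<kappa> * n)"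
      using n cRs by (intro add_mono mult_mono real_sqrt_le_mono of_nat_mono mult_left_mono) auto
    finally show ?thesis by simp
  qed
  have 2: "real (card (inc R Bs)) \<le> 12 * d\<^sup>2 + n * sqrt (\<kappa> * (12 * d\<^sup>2))"
  proof -
    have "card (bilinear_blues Bs \<alpha> \<beta> \<gamma> \<delta>) \<le> \<kappa>" for \<alpha> \<beta> \<gamma> \<delta>
    proof -
      have "card (bilinear_blues Bs \<alpha> \<beta> \<gamma> \<delta>) \<le> card (bilinear_blues B \<alpha> \<beta> \<gamma> \<delta>)"
        using fin BsB by (intro card_mono) (auto simp: bilinear_blues_def intro: finite_subset[of _ B])
      then show ?thesis using \<kappa> le_trans by blast
    qed
    then have "real (card (inc R Bs)) \<le> card Bs + card R * sqrt (\<kappa> * card Bs)"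
      using finRs fin inj by (intro card_inc_codegree) auto
    also have "\<dots> \<le> real (12 * d\<^sup>2) + n * sqrt (\<kappa> * (12 * d\<^sup>2))"
      using n cBs by (intro add_mono mult_mono real_sqrt_le_mono of_nat_mono mult_left_mono) auto
    finally show ?thesis by simp
  qed
  have "real (card (inc R B)) \<le> real (n * (2 * d) + n * \<kappa> + card (inc Rs B) + card (inc R Bs))"
    using le by (rule of_nat_mono)
  then show ?thesis using 1 2 by (simp add: algebra_simps)
qed

text \<open>A sample of about \<open>n / q\<close> red lines, which is at most
  \<open>d^2 / 8\<close>, lies in the zero set of some \<open>P\<close> of degree at most
  \<open>d\<close> in each variable. A blue line outside this set meets at most \<open>2 * d\<close>
  sampled lines; if it meets far more than \<open>q * d\<close> red lines, the sample deviates from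
  its mean, and the second moment bounds such deviations. A red line outside the set meets at most
  \<open>2 * d\<close> of the blue lines inside. The other incidences are left to
  \<open>card_inc_surface\<close>.\<close>

theorem card_inc_le:
  fixes R B :: "('a::field_gcd \<times> 'a \<times> 'a) set" and n d q \<kappa> :: nat
  assumes fin: "finite R" "finite B" and inj: "inj_on fst R" "inj_on (fst \<circ> snd) B"
    and n: "card R \<le> n" "card B \<le> n"
    and char: "\<And>s. 0 < s \<Longrightarrow> s \<le> 2 * d \<Longrightarrow> of_nat s \<noteq> (0::'a)"
    and \<kappa>: "\<And>\<alpha> \<beta> \<gamma> \<delta>. card (bilinear_blues B \<alpha> \<beta> \<gamma> \<delta>) \<le> \<kappa>"
    and d: "d \<ge> 2" and q: "q \<ge> 1" "8 * n \<le> q * d\<^sup>2"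
  shows "real (card (inc R B)) \<le> 2 * (8 * q * d * n + 4 * d * n + n * \<kappa> + n + 12 * d\<^sup>2 * sqrt (\<kappa> * n)
            + 12 * d\<^sup>2 + n * sqrt (\<kappa> * (12 * d\<^sup>2)))"
proof (cases "inc R B = {}")
  case False
  define I where "I = real (card (inc R B))"
  have I0: "I > 0" unfolding I_def using False fin by (simp add: card_gt_0_iff)
  define D where "D b = {r\<in>R. meets r b}" for b
  have ID: "I = (\<Sum>b\<in>B. real (card (D b)))" unfolding I_def D_def using card_inc_blue[OF fin] by simp
  have "R \<noteq> {}" using False by (auto simp: inc_def)
  then have n0: "n > 0" using n(1) fin(1) card_gt_0_iff[of R] by linarith
  \<comment> \<open>The extra index \<open>None\<close> stands for the test set \<open>R\<close> and
    controls the size of the sample. With the weight \<open>I / n\<close> it adds at most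
    \<open>q * I\<close> to the bound, as do all blue lines together.\<close>
  define w where "w = (\<lambda>b::('a \<times> 'a \<times> 'a) option. case b of None \<Rightarrow> I / n | Some _ \<Rightarrow> 1)"
  define D' where "D' = (\<lambda>b. case b of None \<Rightarrow> R | Some b \<Rightarrow> D b)"
  have w0: "w b \<ge> 0" for b using I0 by (simp add: w_def split: option.split)
  obtain S where S: "S \<subseteq> R" and "(\<Sum>b\<in>insert None (Some ` B). w b * (real q * card (S \<inter> D' b) - card (R \<inter> D' b))\<^sup>2)
            \<le> (\<Sum>b\<in>insert None (Some ` B). w b * ((real q - 1) * card (R \<inter> D' b)))"
    using second_moment_sample[OF fin(1) q(1), of "insert None (Some ` B)" w D', OF w0]
    by (elim exE conjE)
  moreover have split: "(\<Sum>b\<in>insert None (Some ` B). g b) = g None + (\<Sum>b\<in>B. g (Some b))" for g :: "_ \<Rightarrow> real"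
    using fin by (simp add: sum.reindex)
  moreover have "R \<inter> D b = D b" for b by (auto simp: D_def)
  moreover have "S \<inter> R = S" using S by auto
  ultimately have sm: "I / n * (real q * card S - card R)\<^sup>2 + (\<Sum>b\<in>B. (real q * card (S \<inter> D b) - card (D b))\<^sup>2)
      \<le> I / n * ((real q - 1) * card R) + (\<Sum>b\<in>B. (real q - 1) * card (D b))"
    by (simp add: w_def D'_def)
  have "I / n * ((real q - 1) * card R) \<le> I / n * (real q * n)"
    using n I0 q(1) by (intro mult_left_mono mult_mono) auto
  then have "I / n * ((real q - 1) * card R) \<le> real q * I" using n0 by (simp add: mult.commute)
  moreover have "(\<Sum>b\<in>B. (real q - 1) * card (D b)) \<le> real q * I"
    unfolding ID using q(1) I0 by (simp flip: sum_distrib_left) (intro mult_right_mono sum_nonneg, auto)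
  ultimately have sm2: "I / n * (real q * card S - card R)\<^sup>2 + (\<Sum>b\<in>B. (real q * card (S \<inter> D b) - card (D b))\<^sup>2)
      \<le> 2 * real q * I" using sm by linarith
  have s1: "(real q * card S - card R)\<^sup>2 \<le> 2 * real q * n"
  proof -
    have "I / n * (real q * card S - card R)\<^sup>2 \<le> 2 * real q * I"
      using sm2 sum_nonneg[of B "\<lambda>b. (real q * card (S \<inter> D b) - card (D b))\<^sup>2"] by simp
    then have "I * (real q * card S - card R)\<^sup>2 \<le> I * (2 * real q * n)" using n0 by (simp add: field_simps)
    then show ?thesis using I0 by simp
  qed
  have s2: "(\<Sum>b\<in>B. (real q * card (S \<inter> D b) - card (D b))\<^sup>2) \<le> 2 * real q * I"
    using sm2 I0 by (smt (verit) divide_nonneg_nonneg mult_nonneg_nonneg of_nat_0_le_iff zero_le_power2)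
  \<comment> \<open>\<open>q |S|\<close> exceeds \<open>|R|\<close> by at most
    \<open>sqrt (2 q n) <= q d / 2\<close>, so \<open>|S| <= d^2 / 8 + d / 2\<close>; the linear
    term is absorbed because \<open>d >= 2\<close>.\<close>
  have cS: "real (card S) \<le> (real d)\<^sup>2 / 2"
  proof -
    have qd: "8 * real n \<le> real q * (real d)\<^sup>2"
      using of_nat_mono[OF q(2), where 'a = real] by simp
    have "(real q * card S - card R)\<^sup>2 \<le> (real q * real d / 2)\<^sup>2"
    proof -
      have "2 * real q * n \<le> real q * (real q * (real d)\<^sup>2) / 4"
        using mult_left_mono[OF qd, of "real q"] by simp
      moreover have "real q * (real q * (real d)\<^sup>2) / 4 = (real q * real d / 2)\<^sup>2"
        by (simp add: power2_eq_square)
      ultimately show ?thesis using s1 by linarith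
    qed
    then have "real q * card S - card R \<le> real q * real d / 2"
      by (rule power2_le_imp_le) simp
    then have "real q * card S \<le> real q * (real d)\<^sup>2 / 8 + real q * real d / 2"
      using qd of_nat_mono[OF n(1), where 'a = real] by linarith
    also have "\<dots> = real q * ((real d)\<^sup>2 / 8 + real d / 2)" by (simp add: algebra_simps)
    finally have "card S \<le> (real d)\<^sup>2 / 8 + real d / 2" using q(1) by simp
    moreover have "real d * 2 \<le> (real d)\<^sup>2" using d by (simp add: power2_eq_square)
    ultimately show ?thesis by linarith
  qed
  have "card S * (2 * d + 1) < (d + 1) ^ 3"
  proof -
    have "real (card S) * (2 * real d + 1) \<le> (real d)\<^sup>2 / 2 * (2 * real d + 1)"
      using cS by (intro mult_right_mono) auto
    also have "\<dots> < (real d + 1) ^ 3"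
    proof -
      have "(real d + 1) ^ 3 = (real d)\<^sup>2 / 2 * (2 * real d + 1) + (5 / 2 * (real d)\<^sup>2 + 3 * real d + 1)"
        by (simp add: power2_eq_square power3_eq_cube field_simps)
      moreover have "5 / 2 * (real d)\<^sup>2 + 3 * real d + 1 > 0" by (intro add_nonneg_pos) auto
      ultimately show ?thesis by linarith
    qed
    finally have "real (card S * (2 * d + 1)) < real ((d + 1) ^ 3)" by (simp add: algebra_simps)
    then show ?thesis by (simp only: of_nat_less_iff)
  qed
  then obtain P where P: "P \<noteq> 0" "degX P \<le> d" "degY P \<le> d" "degree P \<le> d" "\<And>r. r \<in> S \<Longrightarrow> red_eval r P = 0"
    using interpolate_red_lines[of S d] finite_subset[OF S fin(1)] by blast
  define B1 where "B1 = {b\<in>B. blue_eval b P = 0}"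
  define R1 where "R1 = {r\<in>R. red_eval r P = 0}"
  have few: "card (S \<inter> D b) \<le> 2 * d" if "b \<in> B - B1" for b
  proof -
    have "card (S \<inter> D b) \<le> degX P + degree P"
      using that inj(1) S P(5)
      by (intro card_meeting_reds_le) (auto simp: B1_def D_def inj_on_def)
    then show ?thesis using P by linarith
  qed
  \<comment> \<open>With more than \<open>8 * q * d\<close> incidences,
    \<open>q |S \<inter> D b| <= 2 q d\<close> is less than a quarter of \<open>|D b|\<close>, so
    the deviation is at least three quarters of \<open>|D b|\<close>. The factor 16 / 9 is the
    inverse square of 3 / 4.\<close>
  have "(\<Sum>b\<in>B - B1. real (card (D b))) \<le> (\<Sum>b\<in>B - B1. 8 * q * d + (real q * card (S \<inter> D b) - card (D b))\<^sup>2 * (16 / (9 * (8 * real q * d))))"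
  proof (rule sum_mono)
    fix b assume b: "b \<in> B - B1"
    let ?t = "8 * real q * d" let ?D = "real (card (D b))"
    have t0: "?t > 0" using d q by simp
    show "?D \<le> real (8 * q * d) + (real q * card (S \<inter> D b) - ?D)\<^sup>2 * (16 / (9 * ?t))"
    proof (cases "?D \<le> ?t")
      case True
      then show ?thesis using t0 by (simp add: add_increasing2)
    next
      case False
      have "real q * card (S \<inter> D b) \<le> real q * (2 * d)"
        using few[OF b] by (intro mult_left_mono) auto
      then have "?D - real q * card (S \<inter> D b) \<ge> 3 / 4 * ?D" using False by simp
      then have "(3 / 4 * ?D)\<^sup>2 \<le> (?D - real q * card (S \<inter> D b))\<^sup>2" by (intro power_mono) auto
      also have "\<dots> = (real q * card (S \<inter> D b) - ?D)\<^sup>2" by (simp add: power2_commute)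
      finally have "(3 / 4 * ?D)\<^sup>2 * (16 / (9 * ?t)) \<le> (real q * card (S \<inter> D b) - ?D)\<^sup>2 * (16 / (9 * ?t))"
        using t0 by (intro mult_right_mono) auto
      moreover have "(3 / 4 * ?D)\<^sup>2 * (16 / (9 * ?t)) = ?D * ?D / ?t" by (simp add: power2_eq_square)
      moreover have "?D * ?D / ?t \<ge> ?D" using False t0 by (simp add: pos_le_divide_eq mult_left_mono)
      moreover have "real (8 * q * d) \<ge> 0" by simp
      ultimately show ?thesis by linarith
    qed
  qed
  also have "\<dots> = card (B - B1) * (8 * real q * d)
      + (\<Sum>b\<in>B - B1. (real q * card (S \<inter> D b) - card (D b))\<^sup>2) * (16 / (9 * (8 * real q * d)))"
    unfolding sum.distrib sum_distrib_right[symmetric] by simp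
  also have "\<dots> \<le> n * (8 * real q * d) + 2 * real q * I * (16 / (9 * (8 * real q * d)))"
  proof (intro add_mono mult_right_mono)
    have "card (B - B1) \<le> card B" using fin by (intro card_mono) auto
    then show "real (card (B - B1)) \<le> real n" using n by simp
    show "(\<Sum>b\<in>B - B1. (real q * card (S \<inter> D b) - card (D b))\<^sup>2) \<le> 2 * real q * I"
      using fin by (intro order.trans[OF sum_mono2 s2]) auto
  qed auto
  also have "2 * real q * I * (16 / (9 * (8 * real q * d))) \<le> I / 4"
  proof -
    have "2 * real q * I * (16 / (9 * (8 * real q * d))) = I * 4 / (9 * d)"
      using q d by (simp add: field_simps)
    also have "\<dots> \<le> I / 4" using d I0 by (simp add: field_simps)
    finally show ?thesis .
  qed
  finally have b1: "(\<Sum>b\<in>B - B1. real (card (D b))) \<le> n * (8 * real q * d) + I / 4" by simp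
  have c1: "real (card (inc R (B - B1))) \<le> n * (8 * real q * d) + I / 4"
    using b1 card_inc_blue[of R "B - B1"] fin by (simp add: D_def)
  have "card (inc (R - R1) B1) = (\<Sum>r\<in>R - R1. card {b\<in>B1. meets r b})"
    using fin by (intro card_inc_red) (auto simp: B1_def)
  also have "\<dots> \<le> card (R - R1) * (2 * d)"
  proof (rule sum_bounded_above[where K = "2 * d", simplified])
    fix r assume "r \<in> R - R1"
    then have "card {b\<in>B1. meets r b} \<le> degY P + degree P"
      using inj(2) by (intro card_meeting_blues_le) (auto simp: R1_def B1_def inj_on_def)
    then show "card {b\<in>B1. meets r b} \<le> 2 * d" using P by linarith
  qed
  also have "card (R - R1) \<le> card R" using fin by (intro card_mono) auto
  finally have "card (inc (R - R1) B1) \<le> n * (2 * d)" using n by (meson le_trans mult_le_mono1)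
  then have c2: "real (card (inc (R - R1) B1)) \<le> n * (2 * real d)"
    by (metis of_nat_mono of_nat_mult of_nat_numeral)
  have c3: "real (card (inc R1 B1)) \<le> 2 * d * n + n * \<kappa> + (n + 12 * d\<^sup>2 * sqrt (\<kappa> * n))
            + (12 * d\<^sup>2 + n * sqrt (\<kappa> * (12 * d\<^sup>2)))"
  proof (rule card_inc_surface[OF _ _ _ _ _ _ char _ P(1-4)])
    show "card R1 \<le> n" using n card_mono[OF fin(1), of R1] by (auto simp: R1_def)
    show "card B1 \<le> n" using n card_mono[OF fin(2), of B1] by (auto simp: B1_def)
    fix \<alpha> \<beta> \<gamma> \<delta>
    have "card (bilinear_blues B1 \<alpha> \<beta> \<gamma> \<delta>) \<le> card (bilinear_blues B \<alpha> \<beta> \<gamma> \<delta>)"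
      using fin by (intro card_mono) (auto simp: bilinear_blues_def B1_def intro: finite_subset[of _ B])
    then show "card (bilinear_blues B1 \<alpha> \<beta> \<gamma> \<delta>) \<le> \<kappa>" using \<kappa> le_trans by blast
  qed (use fin inj in \<open>auto simp: R1_def B1_def inj_on_def\<close>)
  have "inc R B \<subseteq> inc R (B - B1) \<union> inc (R - R1) B1 \<union> inc R1 B1"
    by (auto simp: inc_def)
  then have "card (inc R B) \<le> card (inc R (B - B1) \<union> inc (R - R1) B1 \<union> inc R1 B1)"
    using fin by (intro card_mono) (auto simp: R1_def B1_def)
  also have "\<dots> \<le> card (inc R (B - B1)) + card (inc (R - R1) B1) + card (inc R1 B1)"
    by (meson add_mono card_Un_le le_refl le_trans)
  finally have "I \<le> real (card (inc R (B - B1))) + card (inc (R - R1) B1) + card (inc R1 B1)"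
    unfolding I_def by linarith
  define E where "E = 8 * real q * d * n + 4 * real d * n + real n * \<kappa> + n + 12 * (real d)\<^sup>2 * sqrt (\<kappa> * n)
            + 12 * (real d)\<^sup>2 + n * sqrt (\<kappa> * (12 * (real d)\<^sup>2))"
  have "I \<le> I / 4 + E"
    using \<open>I \<le> _\<close> c1 c2 c3 unfolding E_def by (simp add: algebra_simps)
  then have "I \<le> 2 * E" using I0 by linarith
  then show ?thesis unfolding I_def E_def by simp
qed simp

section \<open>Circles and equidistant pairs\<close>

definition dst :: "'a::comm_ring_1 \<times> 'a \<Rightarrow> 'a \<times> 'a \<Rightarrow> 'a" where
  "dst a b = (fst a - fst b) * (snd a - snd b)"

text \<open>On the hyperbola, \<open>s\<close> times the linear form is the polynomial
  \<open>f2 * t + f0 * s + f1 * s^2\<close> in \<open>s\<close> alone.\<close>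

lemma card_hyperbola_line_le_2:
  fixes S :: "('a::field \<times> 'a) set"
  assumes t: "t \<noteq> 0" and f: "f0 \<noteq> 0 \<or> f1 \<noteq> 0 \<or> f2 \<noteq> 0"
    and S: "\<And>s s'. (s, s') \<in> S \<Longrightarrow> s * s' = t \<and> f0 + f1 * s + f2 * s' = 0"
  shows "finite S \<and> card S \<le> 2"
proof -
  let ?p = "[:f2 * t, f0, f1:]"
  have p: "?p \<noteq> 0" using f t by auto
  have inj: "inj_on fst S"
  proof (rule inj_onI)
    fix p q assume "p \<in> S" "q \<in> S" "fst p = fst q"
    then show "p = q" using S t by (cases p; cases q) (metis fst_conv mult_cancel_left mult_zero_left)
  qed
  have sub: "fst ` S \<subseteq> {s. poly ?p s = 0}"
  proof
    fix s assume "s \<in> fst ` S"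
    then obtain s' where "(s, s') \<in> S" by force
    then have *: "s * s' = t" "f0 + f1 * s + f2 * s' = 0" using S by auto
    have "poly ?p s = s * (f0 + f1 * s + f2 * s')" unfolding *(1)[symmetric] by (simp add: algebra_simps)
    then show "s \<in> {s. poly ?p s = 0}" using * by simp
  qed
  have fin: "finite {s. poly ?p s = 0}" using p by (rule poly_roots_finite)
  have "card S = card (fst ` S)" using card_image[OF inj] by simp
  also have "\<dots> \<le> card {s. poly ?p s = 0}" using fin sub by (rule card_mono)
  also have "\<dots> \<le> degree ?p" using p by (rule card_poly_roots_bound)
  also have "\<dots> \<le> 2" by simp
  finally show ?thesis using finite_imageD[OF finite_subset[OF sub fin] inj] by simp
qed

text \<open>Circles and lines have equations of this form. Seen from a point \<open>a\<close> of the
  curve, the points at a given nonzero distance lie on a hyperbola and on a line, so there are at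
  most two; the points at distance 0 lie on the two isotropic lines through \<open>a\<close>.
  Together this is \<open>2 * D + D + D\<close>.\<close>

lemma card_curve_le:
  fixes A :: "('a::field \<times> 'a) set"
  assumes A: "finite A" and D: "\<And>a. a \<in> A \<Longrightarrow> card (dst a ` A) \<le> D"
    and iso: "\<And>t. card {b\<in>A. fst b = t} \<le> D" "\<And>t. card {b\<in>A. snd b = t} \<le> D"
    and e: "e0 \<noteq> 0 \<or> e1 \<noteq> 0 \<or> e2 \<noteq> 0 \<or> e3 \<noteq> 0"
  shows "card {b\<in>A. e0 * fst b * snd b + e1 * fst b + e2 * snd b + e3 = 0} \<le> 4 * D" (is "card ?C \<le> _")
proof (cases "?C = {}")
  case False
  then obtain a where a: "a \<in> A" "e0 * fst a * snd a + e1 * fst a + e2 * snd a + e3 = 0" by auto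
  define f1 f2 where "f1 = e0 * snd a + e1" and "f2 = e0 * fst a + e2"
  have f: "e0 \<noteq> 0 \<or> f1 \<noteq> 0 \<or> f2 \<noteq> 0" using e a unfolding f1_def f2_def by auto
  define h where "h b = (fst b - fst a, snd b - snd a)" for b
  have h: "inj h" by (rule injI) (auto simp: h_def prod_eq_iff)
  have C: "e0 * dst a b + f1 * (fst b - fst a) + f2 * (snd b - snd a) = 0" if "b \<in> ?C" for b
  proof -
    have "e0 * dst a b + f1 * (fst b - fst a) + f2 * (snd b - snd a)
       = (e0 * fst b * snd b + e1 * fst b + e2 * snd b + e3) - (e0 * fst a * snd a + e1 * fst a + e2 * snd a + e3)"
      by (simp add: dst_def f1_def f2_def algebra_simps)
    then show ?thesis using that a by simp
  qed
  have Ct: "card {b\<in>?C. dst a b = t} \<le> 2" if "t \<noteq> 0" for t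
  proof -
    have "finite (h ` {b\<in>?C. dst a b = t}) \<and> card (h ` {b\<in>?C. dst a b = t}) \<le> 2"
    proof (rule card_hyperbola_line_le_2[OF that, of "e0 * t" f1 f2])
      show "e0 * t \<noteq> 0 \<or> f1 \<noteq> 0 \<or> f2 \<noteq> 0" using f that by auto
      fix s s' assume "(s, s') \<in> h ` {b\<in>?C. dst a b = t}"
      then obtain b where b: "b \<in> ?C" "dst a b = t" "s = fst b - fst a" "s' = snd b - snd a" by (auto simp: h_def)
      have "s * s' = dst a b" unfolding b(3,4) dst_def by (simp add: algebra_simps)
      then show "s * s' = t \<and> e0 * t + f1 * s + f2 * s' = 0"
        using C[OF b(1)] b by simp
    qed
    then show ?thesis using card_image[OF inj_on_subset[OF h subset_UNIV]] by metis
  qed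
  have sub: "?C \<subseteq> (\<Union>t\<in>dst a ` A - {0}. {b\<in>?C. dst a b = t}) \<union> {b\<in>A. fst b = fst a} \<union> {b\<in>A. snd b = snd a}"
    by (auto simp: dst_def)
  have "card ?C \<le> card ((\<Union>t\<in>dst a ` A - {0}. {b\<in>?C. dst a b = t}) \<union> {b\<in>A. fst b = fst a} \<union> {b\<in>A. snd b = snd a})"
    using A by (intro card_mono[OF _ sub]) auto
  also have "\<dots> \<le> card (\<Union>t\<in>dst a ` A - {0}. {b\<in>?C. dst a b = t}) + card {b\<in>A. fst b = fst a} + card {b\<in>A. snd b = snd a}"
    by (meson add_mono card_Un_le le_refl le_trans)
  also have "card (\<Union>t\<in>dst a ` A - {0}. {b\<in>?C. dst a b = t}) \<le> (\<Sum>t\<in>dst a ` A - {0}. card {b\<in>?C. dst a b = t})"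
    using A by (intro card_UN_le) simp
  also have "\<dots> \<le> (\<Sum>t\<in>dst a ` A - {0}. 2)" by (rule sum_mono, rule Ct) simp
  also have "\<dots> = card (dst a ` A - {0}) * 2" by simp
  also have "card (dst a ` A - {0}) \<le> card (dst a ` A)" using A by (intro card_mono) auto
  also have "card (dst a ` A) \<le> D" using D a by simp
  finally show ?thesis using iso(1)[of "fst a"] iso(2)[of "snd a"] by linarith
next
  case True
  show ?thesis unfolding True by simp
qed

section \<open>Pairs at a fixed distance and their coordinates\<close>

definition pairs_at :: "('a::comm_ring_1 \<times> 'a) set \<Rightarrow> 'a \<Rightarrow> (('a \<times> 'a) \<times> ('a \<times> 'a)) set" where
  "pairs_at A r = {(b, c). b \<in> A \<and> c \<in> A \<and> dst b c = r}"

lemma finite_pairs_at [simp]: "finite A \<Longrightarrow> finite (pairs_at A r)"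
  by (rule finite_subset[of _ "A \<times> A"]) (auto simp: pairs_at_def)

text \<open>The difference of the two circle equations is linear.\<close>

lemma card_common_neighbours_le_2:
  fixes A :: "('a::field \<times> 'a) set"
  assumes "r \<noteq> 0" "b \<noteq> b'"
  shows "card {c\<in>A. dst b c = r \<and> dst b' c = r} \<le> 2"
proof -
  define h where "h c = (fst c - fst b, snd c - snd b)" for c
  have h: "inj h" by (rule injI) (auto simp: h_def prod_eq_iff)
  let ?u = "fst b' - fst b" and ?u' = "snd b' - snd b"
  let ?S = "{c\<in>A. dst b c = r \<and> dst b' c = r}"
  have "finite (h ` ?S) \<and> card (h ` ?S) \<le> 2"
  proof (rule card_hyperbola_line_le_2[OF assms(1), of "?u * ?u'" "- ?u'" "- ?u"])
    show "?u * ?u' \<noteq> 0 \<or> - ?u' \<noteq> 0 \<or> - ?u \<noteq> 0" using assms(2) by (auto simp: prod_eq_iff)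
    fix s s' assume "(s, s') \<in> h ` ?S"
    then obtain c where c: "dst b c = r" "dst b' c = r" "s = fst c - fst b" "s' = snd c - snd b" by (auto simp: h_def)
    have "?u * ?u' + - ?u' * s + - ?u * s' = dst b' c - dst b c"
      unfolding c(3,4) dst_def by (simp add: algebra_simps)
    moreover have "s * s' = dst b c" unfolding c(3,4) dst_def by (simp add: algebra_simps)
    ultimately show "s * s' = r \<and> ?u * ?u' + - ?u' * s + - ?u * s' = 0"
      using c(1,2) by simp
  qed
  then show ?thesis using card_image[OF inj_on_subset[OF h subset_UNIV]] by metis
qed

text \<open>The elementary exponent 3/2 suffices here: its purpose is to bound the degrees of the
  interpolating polynomials, which must stay below the characteristic.\<close>

lemma card_pairs_at_le:
  fixes A :: "('a::field \<times> 'a) set"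
  assumes A: "finite A" and r: "r \<noteq> 0"
  shows "real (card (pairs_at A r)) \<le> 3 * real (card A) * sqrt (card A)"
proof -
  let ?N = "real (card A)"
  have "real (card (pairs_at A r)) \<le> card A + card A * sqrt (real (2 * card A))"
    using card_relation_codegree[OF A A, of "\<lambda>b c. dst b c = r" 2] card_common_neighbours_le_2[OF r]
    by (simp add: pairs_at_def)
  also have "card A * sqrt (real (2 * card A)) \<le> ?N * (2 * sqrt ?N)"
    by (intro mult_left_mono) (simp_all add: real_sqrt_mult, intro mult_right_mono real_le_lsqrt, auto)
  finally have "real (card (pairs_at A r)) \<le> ?N + ?N * (2 * sqrt ?N)" by simp
  moreover have "?N \<le> ?N * sqrt ?N"
  proof (cases "card A = 0")
    case False
    then have "sqrt ?N \<ge> 1" by simp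
    then show ?thesis by (simp add: mult_le_cancel_left1)
  qed simp
  ultimately show ?thesis by simp
qed

definition fst_diff :: "('a::comm_ring_1 \<times> 'a) \<times> ('a \<times> 'a) \<Rightarrow> 'a" where
  "fst_diff p = fst (fst p) - fst (snd p)"

text \<open>For fixed \<open>r\<close> a pair is coded by its first point and one nonzero
  scalar.\<close>

lemma pairs_at_fst_diff:
  fixes A :: "('a::field \<times> 'a) set"
  assumes "p \<in> pairs_at A r" "r \<noteq> 0"
  shows "fst_diff p \<noteq> 0" "snd p = (fst (fst p) - fst_diff p, snd (fst p) - r / fst_diff p)" "fst p \<in> A" "snd p \<in> A"
proof -
  obtain g g' h h' where p: "p = ((g, g'), (h, h'))" by (metis prod.collapse)
  have r: "(g - h) * (g' - h') = r" using assms(1) by (simp add: pairs_at_def p dst_def)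
  show w: "fst_diff p \<noteq> 0" using r assms(2) by (auto simp: fst_diff_def p)
  have "g' - h' = r / (g - h)" using r w by (simp add: fst_diff_def p nonzero_eq_divide_eq mult.commute)
  from this[symmetric] show "snd p = (fst (fst p) - fst_diff p, snd (fst p) - r / fst_diff p)"
    by (simp add: p fst_diff_def)
  show "fst p \<in> A" "snd p \<in> A" using assms(1) by (auto simp: pairs_at_def)
qed

text \<open>A line of \<open>P\<^sup>3\<close> corresponds to pairs \<open>(c, c\<^sub>2)\<close> for which \<open>c\<close> lies on a circle or line; the pair is
  determined by \<open>c\<close>, except possibly for one \<open>c\<close>.\<close>

lemma card_pencil_le:
  fixes A :: "('a::field \<times> 'a) set"
  assumes A: "finite A" and D: "\<And>a. a \<in> A \<Longrightarrow> card (dst a ` A) \<le> D"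
    and iso: "\<And>t. card {b\<in>A. fst b = t} \<le> D" "\<And>t. card {b\<in>A. snd b = t} \<le> D"
    and r: "r \<noteq> 0"
    and S: "S \<subseteq> pairs_at A r" "\<And>p. p \<in> S \<Longrightarrow> r * fst (fst p) = \<alpha> * (1 + \<mu> * a p) + \<gamma> * (fst_diff p + \<rho> * a p)"
       "\<And>p. p \<in> S \<Longrightarrow> a p = \<beta> * (1 + \<mu> * a p) + \<delta> * (fst_diff p + \<rho> * a p)"
    and a: "\<And>p. a p = fst_diff p * snd (fst p) - \<nu> * r * fst (fst p)"
  shows "card S \<le> 8 * D"
proof (cases "S = {}")
  case False
  \<comment> \<open>These constants arise by collecting the terms in \<open>a p\<close>; both
    hypotheses become linear in \<open>fst_diff p\<close>, with coefficients affine in the first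
    point.\<close>
  define m1 m2 l1 where "m1 = \<alpha> * \<mu> + \<gamma> * \<rho>" and "m2 = 1 - \<beta> * \<mu> - \<delta> * \<rho>" and "l1 = 1 + \<nu> * m1"
  have 1: "r * fst (fst p) * l1 - \<alpha> = fst_diff p * (m1 * snd (fst p) + \<gamma>)" if "p \<in> S" for p
  proof -
    have "r * fst (fst p) = \<alpha> + m1 * a p + \<gamma> * fst_diff p" using S(2)[OF that] by (simp add: m1_def algebra_simps)
    then show ?thesis unfolding a l1_def by (simp add: algebra_simps)
  qed
  have 2: "- (\<nu> * m2 * r * fst (fst p) + \<beta>) = fst_diff p * (\<delta> - m2 * snd (fst p))" if "p \<in> S" for p
  proof -
    have "m2 * a p = \<beta> + \<delta> * fst_diff p" using S(3)[OF that] by (simp add: m2_def algebra_simps)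
    then have "m2 * (fst_diff p * snd (fst p) - \<nu> * r * fst (fst p)) = \<beta> + \<delta> * fst_diff p" unfolding a .
    then show ?thesis by (simp add: algebra_simps)
  qed
  \<comment> \<open>Cross multiplication of the two equations eliminates \<open>fst_diff p\<close>
    and leaves a curve for the first point.\<close>
  define e0 e1 e2 e3 where "e0 = - r * m2" and "e1 = r * (l1 * \<delta> + \<nu> * m2 * \<gamma>)"
    and "e2 = \<alpha> * m2 + \<beta> * m1" and "e3 = \<beta> * \<gamma> - \<alpha> * \<delta>"
  have w0: "fst_diff p \<noteq> 0" if "p \<in> S" for p using pairs_at_fst_diff(1)[OF _ r] S(1) that by blast
  have m2: "m2 \<noteq> 0 \<or> (\<delta> \<noteq> 0 \<and> \<beta> \<noteq> 0)"
  proof -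
    obtain p where p: "p \<in> S" using False by auto
    have "\<beta> = 0 \<Longrightarrow> \<delta> = 0 \<Longrightarrow> m2 = 1" by (simp add: m2_def)
    moreover have "m2 = 0 \<Longrightarrow> - \<beta> = fst_diff p * \<delta>" using 2[OF p] by simp
    ultimately show ?thesis using w0[OF p] by auto
  qed
  have l1: "l1 \<noteq> 0 \<or> (\<nu> \<noteq> 0 \<and> m1 \<noteq> 0)" by (auto simp: l1_def)
  have e: "e0 \<noteq> 0 \<or> e1 \<noteq> 0 \<or> e2 \<noteq> 0 \<or> e3 \<noteq> 0"
    using m2 l1 r by (cases "m2 = 0") (auto simp: e0_def e1_def e2_def)
  have conic: "e0 * fst (fst p) * snd (fst p) + e1 * fst (fst p) + e2 * snd (fst p) + e3 = 0" if "p \<in> S" for p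
  proof -
    let ?g = "fst (fst p)" and ?g' = "snd (fst p)"
    have "(r * ?g * l1 - \<alpha>) * (\<delta> - m2 * ?g') = - (\<nu> * m2 * r * ?g + \<beta>) * (m1 * ?g' + \<gamma>)"
      unfolding 1[OF that] 2[OF that] by (simp add: mult_ac)
    then have "(r * ?g * l1 - \<alpha>) * (\<delta> - m2 * ?g') + (\<nu> * m2 * r * ?g + \<beta>) * (m1 * ?g' + \<gamma>) = 0"
      by (simp only: mult_minus_left left_minus)
    then show ?thesis unfolding e0_def e1_def e2_def e3_def l1_def by (simp add: algebra_simps)
  qed
  \<comment> \<open>Here both coefficients of \<open>fst_diff p\<close> vanish, so the first point
    does not determine the pair. All these pairs share one first point \<open>c\<close>, and their
    second points lie on the circle \<open>dst c b = r\<close>.\<close>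
  define T where "T = {p\<in>S. \<delta> = m2 * snd (fst p) \<and> m1 * snd (fst p) + \<gamma> = 0}"
  have finS: "finite S" using S(1) A by (meson finite_pairs_at finite_subset)
  have inj: "inj_on fst (S - T)"
  proof (rule inj_onI)
    fix p q assume p: "p \<in> S - T" and q: "q \<in> S - T" and eq: "fst p = fst q"
    have "fst_diff p * (m1 * snd (fst p) + \<gamma>) = fst_diff q * (m1 * snd (fst p) + \<gamma>)"
      using 1[of p] 1[of q] p q eq by auto
    moreover have "fst_diff p * (\<delta> - m2 * snd (fst p)) = fst_diff q * (\<delta> - m2 * snd (fst p))"
      using 2[of p] 2[of q] p q eq by auto
    ultimately have "fst_diff p = fst_diff q" using p by (auto simp: T_def)
    moreover have "snd p = (fst (fst p) - fst_diff p, snd (fst p) - r / fst_diff p)"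
      "snd q = (fst (fst q) - fst_diff q, snd (fst q) - r / fst_diff q)"
      using pairs_at_fst_diff(2)[OF _ r] S(1) p q by blast+
    ultimately show "p = q" using eq by (simp add: prod_eq_iff)
  qed
  have "fst ` (S - T) \<subseteq> {b\<in>A. e0 * fst b * snd b + e1 * fst b + e2 * snd b + e3 = 0}"
    using conic pairs_at_fst_diff(3)[OF _ r] S(1) by auto
  then have "card (fst ` (S - T)) \<le> card {b\<in>A. e0 * fst b * snd b + e1 * fst b + e2 * snd b + e3 = 0}"
    using A by (intro card_mono) auto
  then have c1: "card (S - T) \<le> 4 * D"
    using card_curve_le[OF A D iso e] card_image[OF inj] by simp
  have c2: "card T \<le> 4 * D"
  proof (cases "T = {}")
    case False
    then obtain p where p: "p \<in> T" by auto
    define c where "c = fst p"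
    have same: "fst q = c" if "q \<in> T" for q
    proof -
      have T: "r * fst (fst q) * l1 = \<alpha>" "- (\<nu> * m2 * r * fst (fst q)) = \<beta>" "\<delta> = m2 * snd (fst q)" if "q \<in> T" for q
      proof -
        have q: "q \<in> S" "\<delta> = m2 * snd (fst q)" "m1 * snd (fst q) + \<gamma> = 0" using that by (auto simp: T_def)
        show "\<delta> = m2 * snd (fst q)" by (rule q)
        show "r * fst (fst q) * l1 = \<alpha>" using 1[OF q(1)] q(3) by simp
        show "- (\<nu> * m2 * r * fst (fst q)) = \<beta>" using 2[OF q(1)] q(2) by simp
      qed
      have m20: "m2 \<noteq> 0" using m2 T(3)[OF that] by auto
      have "snd (fst q) = snd (fst p)" using T(3)[OF that] T(3)[OF p] m20 by simp
      moreover have "fst (fst q) = fst (fst p)"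
      proof -
        have "r * fst (fst q) * l1 = r * fst (fst p) * l1" using T(1)[OF that] T(1)[OF p] by simp
        moreover have "\<nu> * m2 * r * fst (fst q) = \<nu> * m2 * r * fst (fst p)"
          using T(2)[OF that] T(2)[OF p] neg_equal_iff_equal by metis
        ultimately show ?thesis using m20 l1 r by auto
      qed
      ultimately show ?thesis by (simp add: c_def prod_eq_iff)
    qed
    have "T \<subseteq> Pair c ` {b\<in>A. 1 * fst b * snd b + (- snd c) * fst b + (- fst c) * snd b + (fst c * snd c - r) = 0}"
    proof
      fix q assume q: "q \<in> T"
      then have "q \<in> pairs_at A r" using S(1) by (auto simp: T_def)
      then have "snd q \<in> A" "dst c (snd q) = r" using same[OF q] by (auto simp: pairs_at_def)
      then have "snd q \<in> {b\<in>A. 1 * fst b * snd b + (- snd c) * fst b + (- fst c) * snd b + (fst c * snd c - r) = 0}"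
        by (simp add: dst_def algebra_simps)
      moreover have "q = Pair c (snd q)" using same[OF q] by (simp add: prod_eq_iff)
      ultimately show "q \<in> Pair c ` {b\<in>A. 1 * fst b * snd b + (- snd c) * fst b + (- fst c) * snd b + (fst c * snd c - r) = 0}"
        by (rule rev_image_eqI)
    qed
    then have "card T \<le> card {b\<in>A. 1 * fst b * snd b + (- snd c) * fst b + (- fst c) * snd b + (fst c * snd c - r) = 0}"
      by (rule surj_card_le[rotated]) (use A in simp)
    also have "\<dots> \<le> 4 * D" by (rule card_curve_le[OF A D iso]) auto
    finally show ?thesis .
  qed simp
  have "card S \<le> card (S - T) + card T"
    using finS card_Un_le[of "S - T" T] card_mono[of "(S - T) \<union> T" S] by (auto simp: T_def)
  then show ?thesis using c1 c2 by linarith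
qed simp

lemma linear_eq_0_solve:
  fixes t :: "'a::field"
  assumes "u + t * v = 0" "v \<noteq> 0"
  shows "t = - u / v"
proof -
  have "t * v = - u" using assms(1) by (simp add: eq_neg_iff_add_eq_0 add.commute)
  then show ?thesis using assms(2) by (metis nonzero_eq_divide_eq)
qed

text \<open>A generic change of coordinates makes the red lines pairwise disjoint, and the blue lines as well.\<close>

lemma generic_coordinates:
  fixes J :: "'i set" and x0 y z w a :: "'i \<Rightarrow> 'a::field"
  assumes inf: "infinite (UNIV :: 'a set)" and fin: "finite J"
    and red: "\<And>p q. p \<in> J \<Longrightarrow> q \<in> J \<Longrightarrow> x0 p = x0 q \<Longrightarrow> y p = y q \<Longrightarrow> z p = z q \<Longrightarrow> p = q"
    and blue: "\<And>p q. p \<in> J \<Longrightarrow> q \<in> J \<Longrightarrow> w p = w q \<Longrightarrow> a p = a q \<Longrightarrow> p = q"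
  obtains \<mu> \<rho> where "\<And>p. p \<in> J \<Longrightarrow> 1 + \<mu> * a p \<noteq> 0"
    "inj_on (\<lambda>p. x0 p + \<rho> * y p + \<mu> * z p) J"
    "inj_on (\<lambda>p. (w p + \<rho> * a p) / (1 + \<mu> * a p)) J"
proof -
  \<comment> \<open>\<open>\<mu>\<close> keeps the denominators nonzero and separates red lines with
    equal \<open>y\<close>; \<open>\<rho>\<close> then separates the rest. A division by 0 in these
    images merely excludes the value 0 as well.\<close>
  have "finite ((\<lambda>p. - 1 / a p) ` J \<union> (\<lambda>(p, q). - (x0 p - x0 q) / (z p - z q)) ` (J \<times> J))" using fin by simp
  then obtain \<mu> where \<mu>: "\<mu> \<notin> (\<lambda>p. - 1 / a p) ` J \<union> (\<lambda>(p, q). - (x0 p - x0 q) / (z p - z q)) ` (J \<times> J)"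
    using ex_new_if_finite[OF inf] by blast
  have \<psi>: "1 + \<mu> * a p \<noteq> 0" if "p \<in> J" for p
  proof
    assume *: "1 + \<mu> * a p = 0"
    then have "a p \<noteq> 0" by auto
    then have "\<mu> = - 1 / a p" by (rule linear_eq_0_solve[OF *])
    then show False using \<mu> that by blast
  qed
  have red': "x0 p - x0 q + \<mu> * (z p - z q) \<noteq> 0" if "p \<in> J" "q \<in> J" "p \<noteq> q" "y p = y q" for p q
  proof
    assume *: "x0 p - x0 q + \<mu> * (z p - z q) = 0"
    show False
    proof (cases "z p = z q")
      case True
      then show False using * red[OF that(1,2)] that by auto
    next
      case False
      then have "\<mu> = - (x0 p - x0 q) / (z p - z q)" by (intro linear_eq_0_solve[OF *]) simp
      then show False using \<mu> that by force
    qed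
  qed
  have "finite ((\<lambda>(p, q). - (x0 p - x0 q + \<mu> * (z p - z q)) / (y p - y q)) ` (J \<times> J)
      \<union> (\<lambda>(p, q). - (w p - w q + \<mu> * (w p * a q - w q * a p)) / (a p - a q)) ` (J \<times> J))" using fin by simp
  then obtain \<rho> where \<rho>: "\<rho> \<notin> (\<lambda>(p, q). - (x0 p - x0 q + \<mu> * (z p - z q)) / (y p - y q)) ` (J \<times> J)
      \<union> (\<lambda>(p, q). - (w p - w q + \<mu> * (w p * a q - w q * a p)) / (a p - a q)) ` (J \<times> J)"
    using ex_new_if_finite[OF inf] by blast
  show ?thesis
  proof
    show "1 + \<mu> * a p \<noteq> 0" if "p \<in> J" for p by (rule \<psi>[OF that])
    show "inj_on (\<lambda>p. x0 p + \<rho> * y p + \<mu> * z p) J"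
    proof (rule inj_onI, rule ccontr)
      fix p q assume p: "p \<in> J" "q \<in> J" and eq: "x0 p + \<rho> * y p + \<mu> * z p = x0 q + \<rho> * y q + \<mu> * z q" and "p \<noteq> q"
      have *: "x0 p - x0 q + \<mu> * (z p - z q) + \<rho> * (y p - y q) = 0" using eq by (simp add: algebra_simps)
      show False
      proof (cases "y p = y q")
        case True
        then show False using * red'[OF p \<open>p \<noteq> q\<close>] by simp
      next
        case False
        then have "\<rho> = - (x0 p - x0 q + \<mu> * (z p - z q)) / (y p - y q)"
          by (intro linear_eq_0_solve[OF *]) simp
        then show False using \<rho> p by force
      qed
    qed
    show "inj_on (\<lambda>p. (w p + \<rho> * a p) / (1 + \<mu> * a p)) J"
    proof (rule inj_onI, rule ccontr)
      fix p q assume p: "p \<in> J" "q \<in> J"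
        and eq: "(w p + \<rho> * a p) / (1 + \<mu> * a p) = (w q + \<rho> * a q) / (1 + \<mu> * a q)" and "p \<noteq> q"
      have "(w p + \<rho> * a p) * (1 + \<mu> * a q) = (w q + \<rho> * a q) * (1 + \<mu> * a p)"
        using eq \<psi>[OF p(1)] \<psi>[OF p(2)] by (simp add: frac_eq_eq)
      then have *: "w p - w q + \<mu> * (w p * a q - w q * a p) + \<rho> * (a p - a q) = 0"
        by (simp add: algebra_simps)
      show False
      proof (cases "a p = a q")
        case True
        then have "(w p - w q) * (1 + \<mu> * a p) = 0" using * by (simp add: algebra_simps)
        then show False using \<psi>[OF p(1)] blue[OF p] True \<open>p \<noteq> q\<close> by simp
      next
        case False
        then have "\<rho> = - (w p - w q + \<mu> * (w p * a q - w q * a p)) / (a p - a q)"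
          by (intro linear_eq_0_solve[OF *]) simp
        then show False using \<rho> p by force
      qed
    qed
  qed
qed

text \<open>If a reflection maps \<open>b\<close> to \<open>c\<close> and \<open>b\<^sub>2\<close> to \<open>c\<^sub>2\<close>, then the following equation holds for \<open>p = (b, b\<^sub>2)\<close> and
  \<open>q = (c, c\<^sub>2)\<close>. With \<open>u = fst_diff p\<close> and \<open>b = (\<beta>, \<beta>')\<close> it is linear in \<open>(r \<beta>, 1, u \<beta>', u)\<close>, and likewise for \<open>q\<close>, so it is
  an incidence between a point and a plane of \<open>P\<^sup>3\<close>.\<close>

definition refl_inc :: "('a::comm_ring_1 \<times> 'a) set \<Rightarrow> 'a \<Rightarrow> _" where
  "refl_inc A r = {(p, q). p \<in> pairs_at A r \<and> q \<in> pairs_at A r \<and>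
     r * (fst (fst p) - fst (fst q)) + fst_diff p * fst_diff q * (snd (fst p) - snd (fst q)) = 0}"

text \<open>In suitable coordinates the equation of \<open>refl_inc\<close> says that the red line
  of \<open>p\<close> meets the blue line of \<open>q\<close>. The blue lines on one bilinear
  surface come from a set of pairs as in \<open>card_pencil_le\<close>, so the codegree bound is
  \<open>8 * D\<close>.\<close>

lemma card_refl_inc_le:
  fixes A :: "('a::field_gcd \<times> 'a) set" and d q n D :: nat
  assumes inf: "infinite (UNIV :: 'a set)"
    and A: "finite A" and D: "\<And>a. a \<in> A \<Longrightarrow> card (dst a ` A) \<le> D"
    and iso: "\<And>t. card {b\<in>A. fst b = t} \<le> D" "\<And>t. card {b\<in>A. snd b = t} \<le> D"
    and r: "r \<noteq> 0" and n: "n = card (pairs_at A r)"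
    and char: "\<And>s. 0 < s \<Longrightarrow> s \<le> 2 * d \<Longrightarrow> of_nat s \<noteq> (0::'a)"
    and d: "d \<ge> 2" and q: "q \<ge> 1" "8 * n \<le> q * d\<^sup>2"
  shows "real (card (refl_inc A r)) \<le> 2 * (8 * q * d * n + 4 * d * n + n * (8 * D) + n + 12 * d\<^sup>2 * sqrt ((8 * D) * n)
            + 12 * d\<^sup>2 + n * sqrt ((8 * D) * (12 * d\<^sup>2)))"
proof -
  let ?X = "pairs_at A r"
  have finX: "finite ?X" using A by simp
  have w0: "fst_diff p \<noteq> 0" if "p \<in> ?X" for p using pairs_at_fst_diff(1)[OF that r] .
  have eqI: "p = p'" if "p \<in> ?X" "p' \<in> ?X" "fst_diff p = fst_diff p'" "fst p = fst p'" for p p'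
    using pairs_at_fst_diff(2)[OF that(1) r] pairs_at_fst_diff(2)[OF that(2) r] that by (simp add: prod_eq_iff)
  \<comment> \<open>For \<open>\<nu> = 0\<close>, two pairs with equal \<open>fst_diff\<close> and
    first points of equal second coordinate would have blue lines in the same plane, whatever
    \<open>\<mu>\<close> and \<open>\<rho>\<close> are. \<open>\<nu>\<close> mixes
    \<open>r * fst (fst p)\<close> into \<open>a p\<close>, so that \<open>fst_diff p\<close> and
    \<open>a p\<close> determine the pair.\<close>
  have "finite ((\<lambda>p. - 1 / fst_diff p) ` ?X \<union>
      (\<lambda>(p, p'). fst_diff p * (snd (fst p) - snd (fst p')) / (r * (fst (fst p) - fst (fst p')))) ` (?X \<times> ?X))" using finX by simp
  then obtain \<nu> where \<nu>: "\<nu> \<notin> (\<lambda>p. - 1 / fst_diff p) ` ?X \<union>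
      (\<lambda>(p, p'). fst_diff p * (snd (fst p) - snd (fst p')) / (r * (fst (fst p) - fst (fst p')))) ` (?X \<times> ?X)"
    using ex_new_if_finite[OF inf] by blast
  define \<phi> where "\<phi> p = 1 + \<nu> * fst_diff p" for p :: "('a \<times> 'a) \<times> ('a \<times> 'a)"
  have \<phi>: "\<phi> p \<noteq> 0" if "p \<in> ?X" for p
  proof
    assume "\<phi> p = 0"
    then have "\<nu> = - 1 / fst_diff p" using w0[OF that] by (intro linear_eq_0_solve) (simp_all add: \<phi>_def)
    then show False using \<nu> that by blast
  qed
  define x0 where "x0 p = fst_diff p / \<phi> p" for p
  define y where "y p = fst_diff p * snd (fst p) / \<phi> p" for p
  define z where "z p = r * fst (fst p) / \<phi> p" for p
  define a where "a p = fst_diff p * snd (fst p) - \<nu> * r * fst (fst p)" for p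
  have red: "p = p'" if "p \<in> ?X" "p' \<in> ?X" "x0 p = x0 p'" "y p = y p'" "z p = z p'" for p p'
  proof -
    have "fst_diff p * \<phi> p' = fst_diff p' * \<phi> p" using that(3) \<phi>[OF that(1)] \<phi>[OF that(2)] by (simp add: x0_def frac_eq_eq)
    then have w: "fst_diff p = fst_diff p'" by (simp add: \<phi>_def algebra_simps)
    then have "\<phi> p = \<phi> p'" by (simp add: \<phi>_def)
    then have "fst p = fst p'" using that(4,5) w w0[OF that(2)] \<phi>[OF that(2)] r
      by (simp add: y_def z_def prod_eq_iff)
    then show ?thesis using eqI that w by blast
  qed
  have blue: "p = p'" if "p \<in> ?X" "p' \<in> ?X" "fst_diff p = fst_diff p'" "a p = a p'" for p p'
  proof -
    have *: "fst_diff p * (snd (fst p) - snd (fst p')) = \<nu> * (r * (fst (fst p) - fst (fst p')))"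
      using that(3,4) by (simp add: a_def algebra_simps)
    have "fst (fst p) = fst (fst p')"
    proof (rule ccontr)
      assume "fst (fst p) \<noteq> fst (fst p')"
      then have "\<nu> = fst_diff p * (snd (fst p) - snd (fst p')) / (r * (fst (fst p) - fst (fst p')))"
        unfolding * using r by simp
      then show False using \<nu> that by force
    qed
    then have "fst p = fst p'" using * w0[OF that(1)] by (simp add: prod_eq_iff)
    then show ?thesis using eqI that by blast
  qed
  obtain \<mu> \<rho> where \<psi>: "\<And>p. p \<in> ?X \<Longrightarrow> 1 + \<mu> * a p \<noteq> 0"
    and injx: "inj_on (\<lambda>p. x0 p + \<rho> * y p + \<mu> * z p) ?X"
    and injb: "inj_on (\<lambda>p. (fst_diff p + \<rho> * a p) / (1 + \<mu> * a p)) ?X"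
    using generic_coordinates[OF inf finX, of x0 y z fst_diff a, OF red blue] by blast
  define f where "f p = (x0 p + \<rho> * y p + \<mu> * z p, y p, z p)" for p
  define g where "g p = (a p / (1 + \<mu> * a p), (fst_diff p + \<rho> * a p) / (1 + \<mu> * a p), r * fst (fst p) / (1 + \<mu> * a p))" for p
  have injf: "inj_on f ?X" and injf1: "inj_on fst (f ` ?X)"
    using injx by (auto simp: inj_on_def f_def)
  have injg: "inj_on g ?X" and injg1: "inj_on (fst \<circ> snd) (g ` ?X)"
    using injb by (auto simp: inj_on_def g_def)
  have meets: "meets (f p) (g p') \<longleftrightarrow> r * (fst (fst p) - fst (fst p')) + fst_diff p * fst_diff p' * (snd (fst p) - snd (fst p')) = 0"
    if "p \<in> ?X" "p' \<in> ?X" for p p'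
  proof -
    let ?\<psi> = "1 + \<mu> * a p'"
    let ?x = "x0 p + \<rho> * y p + \<mu> * z p"
    have 1: "z p + y p * ((fst_diff p' + \<rho> * a p') / ?\<psi>) = (z p * ?\<psi> + y p * (fst_diff p' + \<rho> * a p')) / ?\<psi>"
      unfolding add_divide_distrib[of "z p * ?\<psi>"] using \<psi>[OF that(2)] by simp
    have 2: "r * fst (fst p') / ?\<psi> + a p' / ?\<psi> * ?x = (r * fst (fst p') + a p' * ?x) / ?\<psi>"
      by (simp add: add_divide_distrib)
    have "meets (f p) (g p') \<longleftrightarrow> z p * ?\<psi> + y p * (fst_diff p' + \<rho> * a p') = r * fst (fst p') + a p' * ?x"
      unfolding f_def g_def meets_def prod.case 1 2 divide_cancel_right using \<psi>[OF that(2)] by blast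
    also have "\<dots> \<longleftrightarrow> z p + y p * fst_diff p' = r * fst (fst p') + a p' * x0 p"
      by (simp add: algebra_simps)
    also have "\<dots> \<longleftrightarrow> (z p + y p * fst_diff p') * \<phi> p = (r * fst (fst p') + a p' * x0 p) * \<phi> p"
      using \<phi>[OF that(1)] by simp
    also have "(z p + y p * fst_diff p') * \<phi> p = r * fst (fst p) + fst_diff p * snd (fst p) * fst_diff p'"
      using \<phi>[OF that(1)] by (simp add: z_def y_def distrib_right)
    also have "(r * fst (fst p') + a p' * x0 p) * \<phi> p = r * fst (fst p') * \<phi> p + a p' * fst_diff p"
      using \<phi>[OF that(1)] by (simp add: x0_def distrib_right)
    also have "\<dots> = r * fst (fst p') + fst_diff p * fst_diff p' * snd (fst p')"
      by (simp add: \<phi>_def a_def algebra_simps)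
    finally show ?thesis by (simp add: algebra_simps)
  qed
  have "bij_betw (map_prod f g) (refl_inc A r) (inc (f ` ?X) (g ` ?X))"
    unfolding bij_betw_def
  proof
    have "inj_on (map_prod f g) (?X \<times> ?X)" using map_prod_inj_on[OF injf injg] .
    then show "inj_on (map_prod f g) (refl_inc A r)" by (rule inj_on_subset) (auto simp: refl_inc_def)
    show "map_prod f g ` refl_inc A r = inc (f ` ?X) (g ` ?X)"
    proof (intro equalityI subsetI)
      fix t assume "t \<in> map_prod f g ` refl_inc A r"
      then obtain p p' where t: "t = (f p, g p')" "p \<in> ?X" "p' \<in> ?X"
        "r * (fst (fst p) - fst (fst p')) + fst_diff p * fst_diff p' * (snd (fst p) - snd (fst p')) = 0"
        by (auto simp: refl_inc_def)
      then show "t \<in> inc (f ` ?X) (g ` ?X)" using meets[OF t(2,3)] by (auto simp: inc_def)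
    next
      fix t assume "t \<in> inc (f ` ?X) (g ` ?X)"
      then obtain p p' where t: "t = (f p, g p')" "p \<in> ?X" "p' \<in> ?X" "meets (f p) (g p')"
        by (auto simp: inc_def)
      then have "(p, p') \<in> refl_inc A r" using meets[OF t(2,3)] by (simp add: refl_inc_def)
      then show "t \<in> map_prod f g ` refl_inc A r" using t(1) by force
    qed
  qed
  then have card: "card (refl_inc A r) = card (inc (f ` ?X) (g ` ?X))" by (rule bij_betw_same_card)
  have \<kappa>: "card (bilinear_blues (g ` ?X) \<alpha> \<beta> \<gamma> \<delta>) \<le> 8 * D" for \<alpha> \<beta> \<gamma> \<delta>
  proof -
    define S where "S = {p\<in>?X. g p \<in> bilinear_blues (g ` ?X) \<alpha> \<beta> \<gamma> \<delta>}"
    have "bilinear_blues (g ` ?X) \<alpha> \<beta> \<gamma> \<delta> = g ` S"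
    proof -
      have "bilinear_blues (g ` ?X) \<alpha> \<beta> \<gamma> \<delta> \<subseteq> g ` ?X" by (auto simp: bilinear_blues_def)
      then show ?thesis unfolding S_def by blast
    qed
    then have "card (bilinear_blues (g ` ?X) \<alpha> \<beta> \<gamma> \<delta>) \<le> card S"
      using card_image_le[of S g] finX by (simp add: S_def)
    also have "card S \<le> 8 * D"
    proof (rule card_pencil_le[OF A D iso r, where \<alpha> = \<alpha> and \<beta> = \<beta> and \<gamma> = \<gamma> and \<delta> = \<delta> and \<rho> = \<rho> and \<mu> = \<mu> and \<nu> = \<nu> and a = a])
      show "S \<subseteq> ?X" by (auto simp: S_def)
      show "a p = fst_diff p * snd (fst p) - \<nu> * r * fst (fst p)" for p by (rule a_def)
      fix p assume p: "p \<in> S"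
      let ?\<psi> = "1 + \<mu> * a p"
      have pX: "p \<in> ?X" using p by (simp add: S_def)
      have *: "r * fst (fst p) / ?\<psi> = \<alpha> + \<gamma> * ((fst_diff p + \<rho> * a p) / ?\<psi>)"
        "a p / ?\<psi> = \<beta> + \<delta> * ((fst_diff p + \<rho> * a p) / ?\<psi>)"
        using p by (auto simp: S_def bilinear_blues_def g_def)
      show "r * fst (fst p) = \<alpha> * ?\<psi> + \<gamma> * (fst_diff p + \<rho> * a p)"
      proof -
        have "r * fst (fst p) = r * fst (fst p) / ?\<psi> * ?\<psi>" using \<psi>[OF pX] by simp
        also have "\<dots> = \<alpha> * ?\<psi> + \<gamma> * (fst_diff p + \<rho> * a p)"
          unfolding *(1) using \<psi>[OF pX] by (simp add: distrib_right)
        finally show ?thesis .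
      qed
      show "a p = \<beta> * ?\<psi> + \<delta> * (fst_diff p + \<rho> * a p)"
      proof -
        have "a p = a p / ?\<psi> * ?\<psi>" using \<psi>[OF pX] by simp
        also have "\<dots> = \<beta> * ?\<psi> + \<delta> * (fst_diff p + \<rho> * a p)"
          unfolding *(2) using \<psi>[OF pX] by (simp add: distrib_right)
        finally show ?thesis .
      qed
    qed
    finally show ?thesis .
  qed
  have "real (card (inc (f ` ?X) (g ` ?X))) \<le> 2 * (8 * q * d * n + 4 * d * n + n * (8 * D) + n + 12 * d\<^sup>2 * sqrt ((8 * D) * n)
            + 12 * d\<^sup>2 + n * sqrt ((8 * D) * (12 * d\<^sup>2)))"
    by (rule card_inc_le[OF _ _ injf1 injg1 _ _ char \<kappa> d q])
      (use finX n in \<open>auto simp: card_image injf injg\<close>)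
  then show ?thesis unfolding card .
qed

section \<open>Reflections and isosceles triangles\<close>

text \<open>The reflection \<open>(x, x') \<mapsto> (\<kappa> x' + \<tau>, (x - \<tau>) / \<kappa>)\<close> swapping \<open>b\<close> and \<open>c\<close>, as the pair \<open>(\<kappa>, \<tau>)\<close>.\<close>

definition refl :: "('a::field \<times> 'a) \<times> ('a \<times> 'a) \<Rightarrow> 'a \<times> 'a" where
  "refl p = (let \<kappa> = (fst (snd p) - fst (fst p)) / (snd (fst p) - snd (snd p))
             in (\<kappa>, fst (snd p) - \<kappa> * snd (fst p)))"

text \<open>The pairs at nonzero distance, for which the slope \<open>\<kappa>\<close> of
  \<open>refl\<close> is a nonzero quotient with nonzero denominator.\<close>

definition gen_pairs :: "('a \<times> 'a) set \<Rightarrow> (('a \<times> 'a) \<times> ('a \<times> 'a)) set" where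
  "gen_pairs A = {(b, c). b \<in> A \<and> c \<in> A \<and> fst b \<noteq> fst c \<and> snd b \<noteq> snd c}"

lemma finite_gen_pairs [simp]: "finite A \<Longrightarrow> finite (gen_pairs A)"
  by (rule finite_subset[of _ "A \<times> A"]) (auto simp: gen_pairs_def)

lemma card_gen_pairs_le: "finite A \<Longrightarrow> card (gen_pairs A) \<le> (card A)\<^sup>2"
  using card_mono[of "A \<times> A" "gen_pairs A"]
  by (auto simp: gen_pairs_def card_cartesian_product power2_eq_square)

text \<open>The last property identifies the perpendicular bisector with the line fixed by the
  reflection.\<close>

lemma refl_props:
  fixes A :: "('a::field \<times> 'a) set"
  assumes "(b, c) \<in> gen_pairs A" and r: "refl (b, c) = (\<kappa>, \<tau>)"
  shows "\<kappa> \<noteq> 0" "fst c = \<kappa> * snd b + \<tau>" "fst b = \<kappa> * snd c + \<tau>"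
    "dst a b = dst a c \<longleftrightarrow> fst a = \<kappa> * snd a + \<tau>"
proof -
  have ne: "fst b \<noteq> fst c" "snd b - snd c \<noteq> 0" using assms(1) by (auto simp: gen_pairs_def)
  have k: "\<kappa> = (fst c - fst b) / (snd b - snd c)" and t: "\<tau> = fst c - \<kappa> * snd b"
    using r by (auto simp: refl_def Let_def)
  show "\<kappa> \<noteq> 0" using ne by (simp add: k)
  show c: "fst c = \<kappa> * snd b + \<tau>" by (simp add: t)
  have "\<kappa> * (snd b - snd c) = fst c - fst b" using ne by (simp add: k)
  then show b: "fst b = \<kappa> * snd c + \<tau>" by (simp add: t algebra_simps)
  have "dst a b - dst a c = (snd b - snd c) * (\<kappa> * snd a + \<tau> - fst a)"
    unfolding dst_def b c by (simp add: algebra_simps)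
  then show "dst a b = dst a c \<longleftrightarrow> fst a = \<kappa> * snd a + \<tau>"
    using ne(2) by (metis eq_iff_diff_eq_0 mult_eq_0_iff)
qed

definition refl_energy :: "('a::field \<times> 'a) set \<Rightarrow> ((('a \<times> 'a) \<times> ('a \<times> 'a)) \<times> (('a \<times> 'a) \<times> ('a \<times> 'a))) set" where
  "refl_energy A = {(p, q). p \<in> gen_pairs A \<and> q \<in> gen_pairs A \<and> refl p = refl q}"

lemma card_share_coordinate_le:
  assumes A: "finite A" and iso: "\<And>t. card {b\<in>A. fst b = t} \<le> D" "\<And>t. card {b\<in>A. snd b = t} \<le> D"
  shows "card {(b, c). b \<in> A \<and> c \<in> A \<and> (fst b = fst c \<or> snd b = snd c)} \<le> 2 * card A * D"
proof -
  have "{(b, c). b \<in> A \<and> c \<in> A \<and> (fst b = fst c \<or> snd b = snd c)}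
     = (SIGMA b:A. {c\<in>A. fst c = fst b}) \<union> (SIGMA b:A. {c\<in>A. snd c = snd b})" by auto
  then have "card {(b, c). b \<in> A \<and> c \<in> A \<and> (fst b = fst c \<or> snd b = snd c)}
     \<le> card (SIGMA b:A. {c\<in>A. fst c = fst b}) + card (SIGMA b:A. {c\<in>A. snd c = snd b})"
    by (simp add: card_Un_le)
  also have "\<dots> = (\<Sum>b\<in>A. card {c\<in>A. fst c = fst b}) + (\<Sum>b\<in>A. card {c\<in>A. snd c = snd b})"
    using A by simp
  also have "\<dots> \<le> (\<Sum>b\<in>A. D) + (\<Sum>b\<in>A. D)" by (intro add_mono sum_mono iso)
  finally show ?thesis by simp
qed

text \<open>Reflections preserve \<open>dst\<close>, so two pairs \<open>(b, c)\<close>,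
  \<open>(b2, c2)\<close> with the same reflection have \<open>(b, b2)\<close> and
  \<open>(c, c2)\<close> at one distance \<open>r\<close>. If \<open>r\<close> is 0, then
  \<open>b\<close> and \<open>b2\<close> share a coordinate and \<open>c2\<close> is determined by
  the other points; nonzero \<open>r\<close> leads to \<open>refl_inc A r\<close>, and the pairs at
  the various \<open>r\<close> number at most \<open>|A|^2\<close>.\<close>

lemma card_refl_energy_le:
  fixes A :: "('a::field \<times> 'a) set" and k :: real
  assumes A: "finite A" and iso: "\<And>t. card {b\<in>A. fst b = t} \<le> D" "\<And>t. card {b\<in>A. snd b = t} \<le> D"
    and k: "k \<ge> 0" "\<And>r. r \<noteq> 0 \<Longrightarrow> real (card (refl_inc A r)) \<le> k * card (pairs_at A r)"
  shows "real (card (refl_energy A)) \<le> 2 * (card A)\<^sup>2 * D + k * (card A)\<^sup>2"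
proof -
  define h where "h = (\<lambda>((b, c), (b2, c2)). ((b, b2), (c, c2)) :: (('a \<times> 'a) \<times> ('a \<times> 'a)) \<times> (('a \<times> 'a) \<times> ('a \<times> 'a)))"
  have injh: "inj h" by (rule injI) (auto simp: h_def)
  define \<Delta> where "\<Delta> = (\<lambda>(b, c). dst b c) ` (A \<times> A) - {0}"
  define Z where "Z = {(b, c). b \<in> A \<and> c \<in> A \<and> (fst b = fst c \<or> snd b = snd c)}"
  define E0 where "E0 = {(p, q) \<in> refl_energy A. (fst p, fst q) \<in> Z}"
  have finZ: "finite Z" unfolding Z_def by (rule finite_subset[of _ "A \<times> A"]) (use A in auto)
  have det: "snd c2 * \<kappa> = fst b2 - \<tau> \<and> fst c2 = \<kappa> * snd b2 + \<tau>"
    if "(b2, c2) \<in> gen_pairs A" "refl (b2, c2) = (\<kappa>, \<tau>)" for b2 c2 \<kappa> \<tau>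
    using refl_props(2,3)[OF that] by (simp add: algebra_simps)
  have inj0: "inj_on (\<lambda>(p, q). ((fst p, fst q), snd p)) E0"
  proof (rule inj_onI)
    fix s s' assume s: "s \<in> E0" "s' \<in> E0" and eq: "(\<lambda>(p, q). ((fst p, fst q), snd p)) s = (\<lambda>(p, q). ((fst p, fst q), snd p)) s'"
    obtain b c b2 c2 where s1: "s = ((b, c), (b2, c2))" by (metis prod.collapse)
    obtain c2' where s2: "s' = ((b, c), (b2, c2'))" using eq s1 by (cases s') (auto simp: prod_eq_iff)
    obtain \<kappa> \<tau> where r: "refl (b, c) = (\<kappa>, \<tau>)" by fastforce
    have g: "(b, c) \<in> gen_pairs A" "(b2, c2) \<in> gen_pairs A" "(b2, c2') \<in> gen_pairs A"
      "refl (b2, c2) = (\<kappa>, \<tau>)" "refl (b2, c2') = (\<kappa>, \<tau>)"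
      using s r unfolding s1 s2 by (auto simp: E0_def refl_energy_def)
    have "c2 = c2'" using det[OF g(2,4)] det[OF g(3,5)] refl_props(1)[OF g(1) r]
      by (auto simp: prod_eq_iff) (metis mult_cancel_right)
    then show "s = s'" by (simp add: s1 s2)
  qed
  have "(\<lambda>(p, q). ((fst p, fst q), snd p)) ` E0 \<subseteq> Z \<times> A"
    by (auto simp: E0_def refl_energy_def gen_pairs_def)
  then have "card ((\<lambda>(p, q). ((fst p, fst q), snd p)) ` E0) \<le> card (Z \<times> A)"
    using finZ A by (intro card_mono) auto
  then have "card E0 \<le> card Z * card A" using card_image[OF inj0] by (simp add: card_cartesian_product)
  also have "\<dots> \<le> 2 * card A * D * card A"
    unfolding Z_def using card_share_coordinate_le[OF A iso] by (intro mult_right_mono) auto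
  finally have cE0: "card E0 \<le> 2 * (card A)\<^sup>2 * D" by (simp add: power2_eq_square algebra_simps)
  have sub: "h ` (refl_energy A - E0) \<subseteq> (\<Union>r\<in>\<Delta>. refl_inc A r)"
  proof
    fix s assume "s \<in> h ` (refl_energy A - E0)"
    then obtain b c b2 c2 where s: "s = ((b, b2), (c, c2))" and e: "((b, c), (b2, c2)) \<in> refl_energy A" "((b, c), (b2, c2)) \<notin> E0"
      by (auto simp: h_def)
    obtain \<kappa> \<tau> where r: "refl (b, c) = (\<kappa>, \<tau>)" by fastforce
    have g: "(b, c) \<in> gen_pairs A" "(b2, c2) \<in> gen_pairs A" "refl (b2, c2) = (\<kappa>, \<tau>)"
      using e(1) r by (auto simp: refl_energy_def)
    have mem: "b \<in> A" "c \<in> A" "b2 \<in> A" "c2 \<in> A" using g by (auto simp: gen_pairs_def)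
    define r where "r = dst b b2"
    have "(b, b2) \<notin> Z" using e by (auto simp: E0_def)
    then have "fst b \<noteq> fst b2" "snd b \<noteq> snd b2" using mem by (auto simp: Z_def)
    then have r0: "r \<noteq> 0" by (simp add: r_def dst_def)
    note P = refl_props(2,3)[OF g(1) \<open>refl (b, c) = _\<close>] refl_props(2,3)[OF g(2,3)]
    have "dst c c2 = r" unfolding r_def dst_def P by (simp add: algebra_simps)
    moreover have "r * (fst b - fst c) + fst_diff (b, b2) * fst_diff (c, c2) * (snd b - snd c) = 0"
      unfolding r_def dst_def fst_diff_def fst_conv snd_conv P by (simp add: algebra_simps)
    ultimately have "s \<in> refl_inc A r" using mem by (simp add: s refl_inc_def pairs_at_def r_def)
    moreover have "r \<in> \<Delta>" using mem r0 by (auto simp: \<Delta>_def r_def)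
    ultimately show "s \<in> (\<Union>r\<in>\<Delta>. refl_inc A r)" by blast
  qed
  have fin\<Delta>: "finite \<Delta>" using A by (simp add: \<Delta>_def)
  have finIr: "finite (refl_inc A r)" for r
    by (rule finite_subset[of _ "pairs_at A r \<times> pairs_at A r"]) (use A in \<open>auto simp: refl_inc_def\<close>)
  have "card (refl_energy A - E0) = card (h ` (refl_energy A - E0))"
    using card_image[OF inj_on_subset[OF injh subset_UNIV]] by metis
  also have "\<dots> \<le> card (\<Union>r\<in>\<Delta>. refl_inc A r)" using sub fin\<Delta> finIr by (intro card_mono) auto
  also have "\<dots> \<le> (\<Sum>r\<in>\<Delta>. card (refl_inc A r))" using fin\<Delta> by (rule card_UN_le)
  finally have "real (card (refl_energy A - E0)) \<le> (\<Sum>r\<in>\<Delta>. real (card (refl_inc A r)))"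
    by (metis of_nat_mono of_nat_sum)
  also have "\<dots> \<le> (\<Sum>r\<in>\<Delta>. k * card (pairs_at A r))" by (intro sum_mono k(2)) (auto simp: \<Delta>_def)
  also have "\<dots> = k * real (\<Sum>r\<in>\<Delta>. card (pairs_at A r))" by (simp add: sum_distrib_left)
  finally have c1: "real (card (refl_energy A - E0)) \<le> k * real (\<Sum>r\<in>\<Delta>. card (pairs_at A r))" .
  have "(\<Sum>r\<in>\<Delta>. card (pairs_at A r)) = card (\<Union>r\<in>\<Delta>. pairs_at A r)"
  proof (rule card_UN_disjoint[symmetric])
    show "\<forall>r\<in>\<Delta>. finite (pairs_at A r)" using A by simp
    show "\<forall>r\<in>\<Delta>. \<forall>r'\<in>\<Delta>. r \<noteq> r' \<longrightarrow> pairs_at A r \<inter> pairs_at A r' = {}" by (auto simp: pairs_at_def)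
  qed (rule fin\<Delta>)
  also have "\<dots> \<le> card (A \<times> A)" using A by (intro card_mono) (auto simp: pairs_at_def)
  finally have "real (\<Sum>r\<in>\<Delta>. card (pairs_at A r)) \<le> real ((card A)\<^sup>2)"
    by (intro of_nat_mono) (simp add: card_cartesian_product power2_eq_square)
  then have "k * real (\<Sum>r\<in>\<Delta>. card (pairs_at A r)) \<le> k * real ((card A)\<^sup>2)" using k(1) by (rule mult_left_mono)
  then have c1: "real (card (refl_energy A - E0)) \<le> k * real ((card A)\<^sup>2)" using c1 by linarith
  have finE: "finite (refl_energy A)"
    by (rule finite_subset[of _ "gen_pairs A \<times> gen_pairs A"]) (use A in \<open>auto simp: refl_energy_def\<close>)
  have "E0 \<subseteq> refl_energy A" by (auto simp: E0_def)
  then have "card (refl_energy A) = card E0 + card (refl_energy A - E0)"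
    using finE by (metis card_Diff_subset card_mono finite_subset le_add_diff_inverse)
  then show ?thesis using c1 of_nat_mono[OF cE0, where 'a = real] by simp
qed

text \<open>Group the triangles by axis, with \<open>p\<close> points of \<open>A\<close> on the
  axis and \<open>w\<close> pairs having it as bisector. For \<open>p <= 1\<close> use
  \<open>p w <= w\<close>; otherwise \<open>p^2 <= 2 p (p - 1)\<close> and AM-GM with weight
  \<open>s\<close>. Two points lie on at most one axis, so the sum of \<open>p (p - 1)\<close> is at
  most \<open>|A|^2\<close>; with \<open>p^2\<close> instead, the possibly numerous axes through one
  point of \<open>A\<close> would count.\<close>

lemma card_isosceles_le:
  fixes A :: "('a::field \<times> 'a) set" and s :: real
  assumes A: "finite A" and s: "s > 0"
  shows "real (card {(a, p). a \<in> A \<and> p \<in> gen_pairs A \<and> dst a (fst p) = dst a (snd p)})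
     \<le> (card A)\<^sup>2 + s * (card A)\<^sup>2 + card (refl_energy A) / (2 * s)" (is "real (card ?T) \<le> _")
proof -
  define L where "L = refl ` gen_pairs A"
  define P where "P l = {a\<in>A. fst a = fst l * snd a + snd l}" for l
  define W where "W l = {p\<in>gen_pairs A. refl p = l}" for l
  have finL: "finite L" and finP: "finite (P l)" and finW: "finite (W l)" for l
    using A by (auto simp: L_def P_def W_def)
  have "?T = (\<Union>l\<in>L. P l \<times> W l)"
  proof (intro equalityI subsetI)
    fix t assume "t \<in> ?T"
    then obtain a b c where t: "t = (a, (b, c))" "a \<in> A" "(b, c) \<in> gen_pairs A" "dst a b = dst a c" by auto
    obtain \<kappa> \<tau> where r: "refl (b, c) = (\<kappa>, \<tau>)" by fastforce
    have "a \<in> P (\<kappa>, \<tau>)" using t refl_props(4)[OF t(3) r, of a] by (simp add: P_def)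
    then show "t \<in> (\<Union>l\<in>L. P l \<times> W l)" using t r by (force simp: L_def W_def)
  next
    fix t assume "t \<in> (\<Union>l\<in>L. P l \<times> W l)"
    then obtain a b c \<kappa> \<tau> where t: "t = (a, (b, c))" "a \<in> A" "(b, c) \<in> gen_pairs A" "refl (b, c) = (\<kappa>, \<tau>)" "fst a = \<kappa> * snd a + \<tau>"
      by (auto simp: P_def W_def)
    then show "t \<in> ?T" using refl_props(4)[OF t(3,4), of a] by auto
  qed
  then have "card ?T \<le> (\<Sum>l\<in>L. card (P l \<times> W l))" using finL by (simp add: card_UN_le)
  then have "real (card ?T) \<le> (\<Sum>l\<in>L. real (card (P l)) * card (W l))"
    by (simp add: card_cartesian_product flip: of_nat_mult of_nat_sum)
  also have "\<dots> \<le> (\<Sum>l\<in>L. card (W l) + s * (real (card (P l)) * (real (card (P l)) - 1)) + (real (card (W l)))\<^sup>2 / (2 * s))"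
  proof (rule sum_mono)
    fix l assume "l \<in> L"
    let ?p = "real (card (P l))" and ?w = "real (card (W l))"
    show "?p * ?w \<le> ?w + s * (?p * (?p - 1)) + ?w\<^sup>2 / (2 * s)"
    proof (cases "card (P l) \<le> 1")
      case True
      then have "?p * ?w \<le> 1 * ?w" by (intro mult_right_mono) auto
      moreover have "?p = 0 \<or> ?p = 1" using True by auto
      then have "s * (?p * (?p - 1)) = 0" by auto
      moreover have "?w\<^sup>2 / (2 * s) \<ge> 0" using s by simp
      ultimately show ?thesis by linarith
    next
      case False
      then have "?p \<ge> 2" by simp
      then have "?p * (?p - 1) \<ge> ?p * (?p / 2)" by (intro mult_left_mono) auto
      then have 1: "s * (?p * (?p - 1)) \<ge> s * (?p * (?p / 2))" by (rule mult_left_mono) (use s in simp)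
      have "0 \<le> (s * ?p - ?w)\<^sup>2 / (2 * s)" using s by simp
      also have "\<dots> = s * (?p * (?p / 2)) - ?p * ?w + ?w\<^sup>2 / (2 * s)"
      proof -
        have "(s * ?p - ?w)\<^sup>2 = 2 * s * (s * (?p * (?p / 2)) - ?p * ?w) + ?w\<^sup>2"
          by (simp add: power2_eq_square algebra_simps)
        then show ?thesis using s by (simp add: add_divide_distrib)
      qed
      finally show ?thesis using 1 by simp
    qed
  qed
  also have "\<dots> = (\<Sum>l\<in>L. real (card (W l))) + s * (\<Sum>l\<in>L. real (card (P l)) * (real (card (P l)) - 1))
      + (\<Sum>l\<in>L. (real (card (W l)))\<^sup>2) / (2 * s)"
    by (simp add: sum.distrib sum_distrib_left sum_divide_distrib)
  also have "(\<Sum>l\<in>L. real (card (W l))) \<le> (card A)\<^sup>2"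
  proof -
    have "(\<Sum>l\<in>L. card (W l)) = card (\<Union>l\<in>L. W l)"
      using finL finW by (intro card_UN_disjoint[symmetric]) (auto simp: W_def)
    also have "\<dots> \<le> card (gen_pairs A)" using A by (intro card_mono) (auto simp: W_def)
    also have "\<dots> \<le> (card A)\<^sup>2" using A by (rule card_gen_pairs_le)
    finally show ?thesis by (metis of_nat_mono of_nat_sum)
  qed
  also have "(\<Sum>l\<in>L. real (card (P l)) * (real (card (P l)) - 1)) \<le> (card A)\<^sup>2"
  proof -
    define Q where "Q l = {(a, a'). a \<in> P l \<and> a' \<in> P l \<and> a \<noteq> a'}" for l
    have finO: "finite (Q l)" for l
      unfolding Q_def by (rule finite_subset[of _ "P l \<times> P l"]) (use finP in auto)
    have cO: "real (card (P l)) * (real (card (P l)) - 1) = card (Q l)" for l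
    proof -
      have "P l \<times> P l = (\<lambda>a. (a, a)) ` P l \<union> Q l" by (auto simp: Q_def)
      then have "card (P l \<times> P l) = card ((\<lambda>a. (a, a)) ` P l) + card (Q l)"
        using finP finO by (subst card_Un_disjoint[symmetric]) (auto simp: Q_def)
      then have "card (P l) * card (P l) = card (P l) + card (Q l)"
        by (simp add: card_cartesian_product card_image inj_on_def)
      then have "real (card (P l)) * real (card (P l)) = real (card (P l)) + real (card (Q l))"
        by (metis of_nat_add of_nat_mult)
      then show ?thesis by (simp add: algebra_simps)
    qed
    have disj: "Q l \<inter> Q l' = {}" if "l \<noteq> l'" for l l'
    proof (rule ccontr)
      assume "Q l \<inter> Q l' \<noteq> {}"
      then obtain a a' where a: "(a, a') \<in> Q l" "(a, a') \<in> Q l'" by auto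
      have e: "fst a = fst l * snd a + snd l" "fst a' = fst l * snd a' + snd l"
        "fst a = fst l' * snd a + snd l'" "fst a' = fst l' * snd a' + snd l'" "a \<noteq> a'"
        using a by (auto simp: Q_def P_def)
      have "snd a \<noteq> snd a'" using e by (auto simp: prod_eq_iff)
      moreover have "fst a - fst a' = fst l * (snd a - snd a')"
        by (simp only: e(1,2)) (simp add: algebra_simps)
      moreover have "fst a - fst a' = fst l' * (snd a - snd a')"
        by (simp only: e(3,4)) (simp add: algebra_simps)
      ultimately have "fst l = fst l'" by simp
      then have "snd l = snd l'" using e(1,3) by simp
      then show False using that \<open>fst l = fst l'\<close> by (simp add: prod_eq_iff)
    qed
    have "(\<Sum>l\<in>L. card (Q l)) = card (\<Union>l\<in>L. Q l)"
      using finL finO disj by (intro card_UN_disjoint[symmetric]) auto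
    also have "\<dots> \<le> card (A \<times> A)" using A by (intro card_mono) (auto simp: Q_def P_def)
    finally show ?thesis unfolding cO
      by (simp add: card_cartesian_product power2_eq_square flip: of_nat_sum of_nat_mult)
  qed
  also have "(\<Sum>l\<in>L. (real (card (W l)))\<^sup>2) = card (refl_energy A)"
  proof -
    have "refl_energy A = (\<Union>l\<in>L. W l \<times> W l)" by (auto simp: refl_energy_def L_def W_def)
    then have "card (refl_energy A) = (\<Sum>l\<in>L. card (W l \<times> W l))"
      using finL finW by (simp only:) (intro card_UN_disjoint, auto simp: W_def)
    then show ?thesis by (simp add: card_cartesian_product power2_eq_square)
  qed
  finally show ?thesis using s by simp
qed

text \<open>For each \<open>a\<close>, Cauchy-Schwarz over its at most \<open>D\<close> distances
  gives at least \<open>N^2 / D\<close> pairs \<open>(b, c)\<close> equidistant from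
  \<open>a\<close>. If \<open>b\<close> and \<open>c\<close> are distinct and share a coordinate,
  then \<open>a\<close> shares it too, so such triangles number at most
  \<open>2 N D^2\<close>.\<close>

lemma pinned_energy_inequality:
  fixes A :: "('a::field \<times> 'a) set" and k s :: real
  assumes A: "finite A" and D: "\<And>a. a \<in> A \<Longrightarrow> card (dst a ` A) \<le> D"
    and iso: "\<And>t. card {b\<in>A. fst b = t} \<le> D" "\<And>t. card {b\<in>A. snd b = t} \<le> D"
    and k: "k \<ge> 0" "\<And>r. r \<noteq> 0 \<Longrightarrow> real (card (refl_inc A r)) \<le> k * card (pairs_at A r)"
    and s: "s > 0" and N: "N = real (card A)"
  shows "N ^ 3 \<le> D * (2 * N\<^sup>2 + 2 * N * (real D)\<^sup>2 + s * N\<^sup>2 + (2 * N\<^sup>2 * D + k * N\<^sup>2) / (2 * s))"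
proof -
  define T where "T = (SIGMA a:A. {(b, c). b \<in> A \<and> c \<in> A \<and> dst a b = dst a c})"
  have fin2: "finite {(b, c). b \<in> A \<and> c \<in> A \<and> dst a b = dst a c}" for a
    by (rule finite_subset[of _ "A \<times> A"]) (use A in auto)
  have one: "N\<^sup>2 \<le> D * real (card {(b, c). b \<in> A \<and> c \<in> A \<and> dst a b = dst a c})" if "a \<in> A" for a
  proof -
    define F where "F t = {b\<in>A. dst a b = t}" for t
    have finF: "finite (F t)" for t using A by (simp add: F_def)
    have "A = (\<Union>t\<in>dst a ` A. F t)" by (auto simp: F_def)
    then have "card A = (\<Sum>t\<in>dst a ` A. card (F t))"
      using A by (subst (1) \<open>A = _\<close>) (intro card_UN_disjoint, auto simp: F_def)
    then have "N = (\<Sum>t\<in>dst a ` A. real (card (F t)))" unfolding N by simp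
    then have "N\<^sup>2 \<le> card (dst a ` A) * (\<Sum>t\<in>dst a ` A. (real (card (F t)))\<^sup>2)"
      using sum_squared_le_card_sum_squares[of "dst a ` A" "\<lambda>t. real (card (F t))"] A by simp
    also have "\<dots> \<le> real D * (\<Sum>t\<in>dst a ` A. (real (card (F t)))\<^sup>2)"
      using D[OF that] by (intro mult_right_mono sum_nonneg) auto
    also have "(\<Sum>t\<in>dst a ` A. (real (card (F t)))\<^sup>2) = card (\<Union>t\<in>dst a ` A. F t \<times> F t)"
      using A finF by (subst card_UN_disjoint) (auto simp: F_def card_cartesian_product power2_eq_square)
    also have "(\<Union>t\<in>dst a ` A. F t \<times> F t) = {(b, c). b \<in> A \<and> c \<in> A \<and> dst a b = dst a c}"
      by (auto simp: F_def)
    finally show ?thesis .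
  qed
  have "N ^ 3 = (\<Sum>a\<in>A. N\<^sup>2)" by (simp add: N power2_eq_square power3_eq_cube)
  also have "\<dots> \<le> (\<Sum>a\<in>A. D * real (card {(b, c). b \<in> A \<and> c \<in> A \<and> dst a b = dst a c}))"
    by (rule sum_mono) (rule one)
  also have "\<dots> = D * real (card T)"
    unfolding T_def using A fin2 by (simp add: sum_distrib_left)
  finally have N3: "N ^ 3 \<le> D * real (card T)" .
  define T1 where "T1 = (\<lambda>(a, b). (a, (b, b))) ` (A \<times> A)"
  define T2 where "T2 = (SIGMA a:A. {b\<in>A. fst b = fst a} \<times> {b\<in>A. fst b = fst a})"
  define T3 where "T3 = (SIGMA a:A. {b\<in>A. snd b = snd a} \<times> {b\<in>A. snd b = snd a})"
  define T4 where "T4 = {(a, p). a \<in> A \<and> p \<in> gen_pairs A \<and> dst a (fst p) = dst a (snd p)}"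
  have "T \<subseteq> T1 \<union> T2 \<union> T3 \<union> T4"
  proof
    fix t assume "t \<in> T"
    then obtain a b c where t: "t = (a, (b, c))" "a \<in> A" "b \<in> A" "c \<in> A" "dst a b = dst a c" by (auto simp: T_def)
    consider "b = c" | "b \<noteq> c" "fst b = fst c" | "b \<noteq> c" "snd b = snd c" | "fst b \<noteq> fst c" "snd b \<noteq> snd c"
      by blast
    then show "t \<in> T1 \<union> T2 \<union> T3 \<union> T4"
    proof cases
      case 1
      then show ?thesis using t by (auto simp: T1_def)
    next
      case 2
      then have "snd b \<noteq> snd c" by (auto simp: prod_eq_iff)
      then have "fst a = fst c" using t(5) 2 by (auto simp: dst_def)
      then show ?thesis using t 2 by (auto simp: T2_def)
    next
      case 3
      then have "fst b \<noteq> fst c" by (auto simp: prod_eq_iff)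
      then have "snd a = snd c" using t(5) 3 by (auto simp: dst_def)
      then show ?thesis using t 3 by (auto simp: T3_def)
    next
      case 4
      then show ?thesis using t by (auto simp: T4_def gen_pairs_def)
    qed
  qed
  moreover have fin4: "finite T4"
    by (rule finite_subset[of _ "A \<times> gen_pairs A"]) (use A in \<open>auto simp: T4_def\<close>)
  ultimately have "card T \<le> card (T1 \<union> T2 \<union> T3 \<union> T4)"
    using A by (intro card_mono) (auto simp: T1_def T2_def T3_def)
  also have "\<dots> \<le> card T1 + card T2 + card T3 + card T4"
    by (meson add_mono card_Un_le le_refl le_trans)
  finally have cT: "real (card T) \<le> real (card T1) + card T2 + card T3 + card T4" by linarith
  have 1: "real (card T1) \<le> N\<^sup>2"
  proof -
    have "card T1 \<le> card (A \<times> A)" unfolding T1_def using A by (intro card_image_le) simp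
    then show ?thesis unfolding N by (simp add: card_cartesian_product power2_eq_square flip: of_nat_mult)
  qed
  have aux: "real (card (SIGMA a:A. G a \<times> G a)) \<le> N * (real D)\<^sup>2"
    if "\<And>a. finite (G a)" "\<And>a. card (G a) \<le> D" for G :: "'a \<times> 'a \<Rightarrow> ('a \<times> 'a) set"
  proof -
    have "card (SIGMA a:A. G a \<times> G a) = (\<Sum>a\<in>A. card (G a) * card (G a))"
      using A that(1) by (simp add: card_cartesian_product)
    also have "\<dots> \<le> (\<Sum>a\<in>A. D * D)" by (intro sum_mono mult_mono that(2)) auto
    finally show ?thesis unfolding N by (simp add: power2_eq_square flip: of_nat_mult)
  qed
  have 2: "real (card T2) \<le> N * (real D)\<^sup>2" unfolding T2_def by (rule aux) (use A iso in auto)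
  have 3: "real (card T3) \<le> N * (real D)\<^sup>2" unfolding T3_def by (rule aux) (use A iso in auto)
  have 4: "real (card T4) \<le> N\<^sup>2 + s * N\<^sup>2 + (2 * N\<^sup>2 * D + k * N\<^sup>2) / (2 * s)"
  proof -
    have "real (card T4) \<le> N\<^sup>2 + s * N\<^sup>2 + card (refl_energy A) / (2 * s)"
      using card_isosceles_le[OF A s] unfolding T4_def N by simp
    moreover have "card (refl_energy A) / (2 * s) \<le> (2 * N\<^sup>2 * D + k * N\<^sup>2) / (2 * s)"
      using card_refl_energy_le[OF A iso k] s unfolding N by (intro divide_right_mono) auto
    ultimately show ?thesis by linarith
  qed
  have "real (card T) \<le> 2 * N\<^sup>2 + 2 * N * (real D)\<^sup>2 + s * N\<^sup>2 + (2 * N\<^sup>2 * D + k * N\<^sup>2) / (2 * s)"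
    using cT 1 2 3 4 by linarith
  then have "D * real (card T) \<le> D * (2 * N\<^sup>2 + 2 * N * (real D)\<^sup>2 + s * N\<^sup>2 + (2 * N\<^sup>2 * D + k * N\<^sup>2) / (2 * s))"
    by (intro mult_left_mono) auto
  then show ?thesis using N3 by linarith
qed

section \<open>Numerical estimates\<close>

text \<open>Every additional factor \<open>t\<close> absorbs a constant up to 1000.\<close>

lemma const_mult_power_le:
  fixes t :: real
  assumes t: "t \<ge> 1000" and c: "c \<le> 1000 ^ m" and e: "e = a + m"
  shows "c * t ^ a \<le> t ^ e"
proof -
  have "c * t ^ a \<le> 1000 ^ m * t ^ a" using c t by (intro mult_right_mono) auto
  also have "\<dots> \<le> t ^ m * t ^ a" using t by (intro mult_right_mono power_mono) auto
  finally show ?thesis by (simp add: e power_add mult.commute)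
qed

text \<open>Here \<open>t\<close> is \<open>|A|\<close> to the power \<open>1/74\<close>, which makes all exponents integers.\<close>

lemma incidence_numerics:
  fixes t n k d q D :: real
  assumes t: "t \<ge> 1000" and k: "k = t ^ 68 / 100" and n: "n > k" "n \<le> 3 * t ^ 111"
    and D: "0 \<le> D" "D \<le> t ^ 40" and d: "512 * n / k \<le> d" "d \<le> 513 * n / k"
    and q: "q \<le> 8 * n / d\<^sup>2 + 1"
  shows "2 * (8 * q * d * n + 4 * d * n + n * (8 * D) + n + 12 * d\<^sup>2 * sqrt (8 * D * n)
            + 12 * d\<^sup>2 + n * sqrt (8 * D * (12 * d\<^sup>2))) \<le> k * n"
    and "2 * d \<le> t ^ 46"
proof -
  have t0: "t > 0" using t by simp
  have k0: "k > 0" unfolding k using t0 by simp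
  have n0: "n > 0" using n k0 by simp
  have d0: "d > 0" using d(1) n0 k0 by (meson divide_pos_pos less_le_trans mult_pos_pos zero_less_numeral)
  \<comment> \<open>\<open>t ^ 111\<close> is \<open>|A|\<close> to the power 3/2. The resulting
    \<open>t ^ 43\<close> leaves room below \<open>t ^ 46\<close>, which in turn is less than
    \<open>|A|\<close> to the power 5/8.\<close>
  have "513 * n / k \<le> 513 * (3 * t ^ 111) / k" using n(2) k0 by (intro divide_right_mono) auto
  also have "\<dots> = 153900 * t ^ 43" using t0 by (simp add: k field_simps flip: power_add)
  finally have d43: "d \<le> 160000 * t ^ 43" using d(2) zero_le_power[of t 43] t0 by linarith
  show "2 * d \<le> t ^ 46"
  proof -
    have "320000 * t ^ 43 \<le> t ^ 46" by (rule const_mult_power_le[OF t, where m = 3]) auto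
    then show ?thesis using d43 by linarith
  qed
  \<comment> \<open>The main term is at most \<open>64 n^2 / d\<close>, and
    \<open>d >= 512 n / k\<close> makes it at most an eighth of \<open>k n\<close>;
    \<open>8 * d * n\<close> comes from rounding \<open>q\<close> up.\<close>
  have A1: "8 * q * d * n \<le> k * n / 8 + 8 * d * n"
  proof -
    have "8 * q * d * n \<le> 8 * (8 * n / d\<^sup>2 + 1) * d * n"
      using q d0 n0 by (intro mult_right_mono mult_left_mono) auto
    also have "\<dots> = 8 * n * (8 * n / d\<^sup>2 * d) + 8 * d * n"
    proof -
      have "8 * (v + 1) * d * n = 8 * n * (v * d) + 8 * d * n" for v by (simp add: algebra_simps)
      then show ?thesis .
    qed
    also have "8 * n / d\<^sup>2 * d = 8 * (n / d)" using d0 by (simp add: power2_eq_square)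
    finally have *: "8 * q * d * n \<le> 64 * (n * (n / d)) + 8 * d * n" by simp
    have "512 * n \<le> d * k" using d(1) k0 by (simp add: pos_divide_le_eq)
    then have "n / d \<le> k / 512" using d0 by (simp add: pos_divide_le_eq mult.commute)
    then have "n * (n / d) \<le> n * (k / 512)" using n0 by (intro mult_left_mono) auto
    moreover have "n * (k / 512) = k * n / 512" by simp
    ultimately show ?thesis using * by linarith
  qed
  \<comment> \<open>Covers \<open>4 * d * n\<close> and the rounding term \<open>8 * d * n\<close>
    of \<open>A1\<close>.\<close>
  have A2: "12 * d * n \<le> k * n / 100"
  proof -
    have "(12 * 160000 * 10000) * t ^ 43 \<le> t ^ 68" by (rule const_mult_power_le[OF t, where m = 25]) auto
    then have "12 * d \<le> k / 100" using d43 k by linarith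
    then have "12 * d * n \<le> k / 100 * n" using n0 by (intro mult_right_mono) auto
    then show ?thesis by simp
  qed
  have A3: "n * (8 * D) \<le> k * n / 100"
  proof -
    have "(8 * 10000) * t ^ 40 \<le> t ^ 68" by (rule const_mult_power_le[OF t, where m = 28]) auto
    then have "8 * D \<le> k / 100" using D k by linarith
    then have "8 * D * n \<le> k / 100 * n" using n0 by (intro mult_right_mono) auto
    then show ?thesis by (simp add: mult.commute)
  qed
  have A4: "n \<le> k * n / 100"
  proof -
    have "10000 * t ^ 0 \<le> t ^ 68" by (rule const_mult_power_le[OF t, where m = 68]) auto
    then have "1 \<le> k / 100" using k by simp
    then have "1 * n \<le> k / 100 * n" using n0 by (intro mult_right_mono) auto
    then show ?thesis by simp
  qed
  have dn: "d\<^sup>2 \<le> n * (513 * d / k)"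
  proof -
    have "d * d \<le> d * (513 * n / k)" using d(2) d0 by (intro mult_left_mono) auto
    then show ?thesis by (simp add: power2_eq_square algebra_simps)
  qed
  have A5: "12 * d\<^sup>2 * v \<le> k * n / 100" if v: "0 \<le> v" "v \<le> 5 * t ^ 76" for v
  proof -
    have "12 * 513 * (d * v) \<le> 12 * 513 * ((160000 * t ^ 43) * (5 * t ^ 76))"
      using d43 v d0 t0 by (intro mult_left_mono mult_mono) auto
    also have "\<dots> = (12 * 513 * 160000 * 5) * t ^ 119" by (simp flip: power_add)
    also have "\<dots> \<le> t ^ 136 / 1000000"
    proof -
      have "(12 * 513 * 160000 * 5 * 1000000) * t ^ 119 \<le> t ^ 136"
        by (rule const_mult_power_le[OF t, where m = 17]) auto
      then show ?thesis by linarith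
    qed
    also have "\<dots> = k * k / 100" by (simp add: k flip: power_add)
    finally have le: "12 * 513 * (d * v) \<le> k * k / 100" .
    have "12 * d\<^sup>2 * v \<le> 12 * (n * (513 * d / k)) * v" using dn v by (intro mult_right_mono) auto
    also have "\<dots> = n / k * (12 * 513 * (d * v))" by simp
    also have "\<dots> \<le> n / k * (k * k / 100)" using le n0 k0 by (intro mult_left_mono) auto
    also have "\<dots> = k * n / 100" using k0 by simp
    finally show ?thesis .
  qed
  have A6: "12 * d\<^sup>2 * sqrt (8 * D * n) \<le> k * n / 100"
  proof (rule A5)
    show "0 \<le> sqrt (8 * D * n)" using D n0 by simp
    have "8 * D * n \<le> 8 * t ^ 40 * (3 * t ^ 111)" using D n n0 t0 by (intro mult_mono) auto
    also have "\<dots> = 24 * t ^ 151" by (simp flip: power_add)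
    also have "\<dots> \<le> 25 * t ^ 152"
    proof -
      have "1 * t ^ 151 \<le> t ^ 152" by (rule const_mult_power_le[OF t, where m = 1]) auto
      then show ?thesis using zero_le_power[of t 152] t0 by linarith
    qed
    also have "\<dots> = (5 * t ^ 76)\<^sup>2" by (simp add: power_mult_distrib flip: power_mult)
    finally show "sqrt (8 * D * n) \<le> 5 * t ^ 76" using t0 by (intro real_le_lsqrt) auto
  qed
  have A7: "12 * d\<^sup>2 \<le> k * n / 100"
  proof -
    have "1 * t ^ 0 \<le> t ^ 76" by (rule const_mult_power_le[OF t, where m = 76]) auto
    then show ?thesis using A5[of 1] by simp
  qed
  have A8: "n * sqrt (8 * D * (12 * d\<^sup>2)) \<le> k * n / 100"
  proof -
    have "8 * D * (12 * d\<^sup>2) \<le> (10 * t ^ 20 * d)\<^sup>2"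
    proof -
      have "8 * D * (12 * d\<^sup>2) = 96 * D * d\<^sup>2" by simp
      also have "\<dots> \<le> 100 * t ^ 40 * d\<^sup>2" using D by (intro mult_right_mono) auto
      also have "\<dots> = (10 * t ^ 20 * d)\<^sup>2" by (simp add: power_mult_distrib flip: power_mult)
      finally show ?thesis .
    qed
    then have "sqrt (8 * D * (12 * d\<^sup>2)) \<le> 10 * t ^ 20 * d" using t0 d0 by (intro real_le_lsqrt) auto
    also have "\<dots> \<le> 10 * t ^ 20 * (160000 * t ^ 43)" using d43 t0 by (intro mult_left_mono) auto
    also have "\<dots> = 1600000 * t ^ 63" by (simp flip: power_add)
    also have "\<dots> \<le> k / 100"
    proof -
      have "(1600000 * 10000) * t ^ 63 \<le> t ^ 68" by (rule const_mult_power_le[OF t, where m = 5]) auto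
      then show ?thesis using k by linarith
    qed
    finally have "n * sqrt (8 * D * (12 * d\<^sup>2)) \<le> n * (k / 100)" using n0 by (intro mult_left_mono) auto
    then show ?thesis by (simp add: mult.commute)
  qed
  have pos: "k * n > 0" using k0 n0 by simp
  have "8 * q * d * n + 4 * d * n + n * (8 * D) + n + 12 * d\<^sup>2 * sqrt (8 * D * n)
            + 12 * d\<^sup>2 + n * sqrt (8 * D * (12 * d\<^sup>2)) \<le> k * n / 8 + 6 * (k * n / 100)"
    using A1 A2 A3 A4 A6 A7 A8 by linarith
  also have "\<dots> \<le> k * n / 2" using pos by linarith
  finally have half: "8 * q * d * n + 4 * d * n + n * (8 * D) + n + 12 * d\<^sup>2 * sqrt (8 * D * n)
            + 12 * d\<^sup>2 + n * sqrt (8 * D * (12 * d\<^sup>2)) \<le> k * n / 2" .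
  show "2 * (8 * q * d * n + 4 * d * n + n * (8 * D) + n + 12 * d\<^sup>2 * sqrt (8 * D * n)
            + 12 * d\<^sup>2 + n * sqrt (8 * D * (12 * d\<^sup>2))) \<le> k * n"
    by (rule order.trans[OF mult_left_mono[OF half]]) simp_all
qed

text \<open>A class of at most \<open>k\<close> pairs satisfies the bound trivially, by counting all
  pairs of its elements. Only larger classes need the polynomial argument.\<close>

lemma card_refl_inc_le_pairs_at:
  fixes A :: "('a::field_gcd \<times> 'a) set" and t :: real
  assumes inf: "infinite (UNIV :: 'a set)"
    and A: "finite A" and D: "\<And>a. a \<in> A \<Longrightarrow> card (dst a ` A) \<le> D"
    and iso: "\<And>t. card {b\<in>A. fst b = t} \<le> D" "\<And>t. card {b\<in>A. snd b = t} \<le> D"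
    and r: "r \<noteq> 0" and t: "t \<ge> 1000" "real (card A) = t ^ 74" "real D \<le> t ^ 40"
    and char: "\<And>s. 0 < s \<Longrightarrow> real s \<le> t ^ 46 \<Longrightarrow> of_nat s \<noteq> (0::'a)"
  shows "real (card (refl_inc A r)) \<le> t ^ 68 / 100 * card (pairs_at A r)"
proof -
  define k where "k = t ^ 68 / 100"
  define n where "n = card (pairs_at A r)"
  have k0: "k > 0" using t by (simp add: k_def)
  show ?thesis
  proof (cases "real n \<le> k")
    case True
    have "card (refl_inc A r) \<le> card (pairs_at A r \<times> pairs_at A r)"
      using A by (intro card_mono) (auto simp: refl_inc_def)
    then have "real (card (refl_inc A r)) \<le> real n * real n"
      by (simp add: n_def card_cartesian_product flip: of_nat_mult)
    also have "\<dots> \<le> k * real n" using True by (intro mult_right_mono) auto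
    finally show ?thesis by (simp add: k_def n_def)
  next
    case False
    then have nk: "real n > k" by simp
    have n3: "real n \<le> 3 * t ^ 111"
    proof -
      have "real n \<le> 3 * t ^ 74 * sqrt (t ^ 74)" using card_pairs_at_le[OF A r] t(2) by (simp add: n_def)
      also have "sqrt (t ^ 74) = t ^ 37"
        by (rule real_sqrt_unique) (use t(1) in \<open>auto simp flip: power_mult\<close>)
      finally show ?thesis by (simp add: mult.assoc flip: power_add)
    qed
    \<comment> \<open>In \<open>d2\<close> below, 513 in place of 512 pays for rounding up, as
      \<open>n / k > 1\<close>.\<close>
    define d where "d = nat \<lceil>512 * real n / k\<rceil>"
    define q where "q = nat \<lceil>8 * real n / (real d)\<^sup>2\<rceil>"
    have nk1: "real n / k > 1" using nk k0 by simp
    have "512 * real n / k \<ge> 0" using k0 by simp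
    then have d1: "512 * real n / k \<le> real d" and "real d \<le> 512 * real n / k + 1"
      unfolding d_def by linarith+
    then have d2: "real d \<le> 513 * real n / k" using nk1 by (simp add: add_divide_distrib)
    have dge: "real d \<ge> 512" using d1 nk1 by simp
    then have d0: "(real d)\<^sup>2 > 0" by simp
    have "8 * real n / (real d)\<^sup>2 \<ge> 0" by simp
    then have q1: "8 * real n / (real d)\<^sup>2 \<le> real q" and q2: "real q \<le> 8 * real n / (real d)\<^sup>2 + 1"
      unfolding q_def by linarith+
    have "8 * real n / (real d)\<^sup>2 > 0" using nk k0 d0 by simp
    then have qpos: "q \<ge> 1" using q1 by linarith
    have "8 * real n \<le> real q * (real d)\<^sup>2" using q1 d0 by (simp add: field_simps)
    then have q8: "8 * n \<le> q * d\<^sup>2" by (metis of_nat_le_iff of_nat_mult of_nat_numeral of_nat_power)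
    note num = incidence_numerics[OF t(1) k_def nk n3 _ t(3) d1 d2 q2, simplified]
    have "real (card (refl_inc A r)) \<le> 2 * (8 * q * d * n + 4 * d * n + n * (8 * D) + n + 12 * d\<^sup>2 * sqrt ((8 * D) * n)
            + 12 * d\<^sup>2 + n * sqrt ((8 * D) * (12 * d\<^sup>2)))"
    proof (rule card_refl_inc_le[OF inf A D iso r n_def _ _ qpos q8])
      show "d \<ge> 2" using dge by linarith
      fix s :: nat assume s: "0 < s" "s \<le> 2 * d"
      then have "real s \<le> 2 * real d" by linarith
      then show "of_nat s \<noteq> (0::'a)" using s num(2) by (intro char) auto
    qed
    also have "\<dots> \<le> k * real n" using num(1) by (simp add: algebra_simps)
    finally show ?thesis by (simp add: k_def n_def)
  qed
qed

text \<open>If \<open>D <= t^40\<close>, the energy inequality reads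
  \<open>t^222 <= t^40 * (s + k / (2 * s)) * t^148\<close> up to smaller terms. With
  \<open>k = t^68 / 100\<close> and \<open>s = sqrt k\<close> the right side is 3/20 of
  \<open>t^222\<close>.\<close>

lemma split_pinned_distances:
  fixes A :: "('a::field_gcd \<times> 'a) set" and t :: real
  assumes inf: "infinite (UNIV :: 'a set)"
    and A: "finite A" and D: "\<And>a. a \<in> A \<Longrightarrow> card (dst a ` A) \<le> D"
    and iso: "\<And>t. card {b\<in>A. fst b = t} \<le> D" "\<And>t. card {b\<in>A. snd b = t} \<le> D"
    and t: "t \<ge> 1000" "real (card A) = t ^ 74"
    and char: "\<And>s. 0 < s \<Longrightarrow> real s \<le> t ^ 46 \<Longrightarrow> of_nat s \<noteq> (0::'a)"
  shows "real D > t ^ 40"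
proof (rule ccontr)
  assume "\<not> ?thesis"
  then have D40: "real D \<le> t ^ 40" by simp
  have t0: "t > 0" using t by simp
  define N where "N = real (card A)"
  have N: "N = t ^ 74" using t by (simp add: N_def)
  define k where "k = t ^ 68 / 100"
  define s where "s = t ^ 34 / 10"
  have s0: "s > 0" using t0 by (simp add: s_def)
  have k0: "k \<ge> 0" using t0 by (simp add: k_def)
  have "N ^ 3 \<le> D * (2 * N\<^sup>2 + 2 * N * (real D)\<^sup>2 + s * N\<^sup>2 + (2 * N\<^sup>2 * D + k * N\<^sup>2) / (2 * s))"
    using card_refl_inc_le_pairs_at[OF inf A D iso _ t D40 char]
    by (intro pinned_energy_inequality[OF A D iso k0 _ s0 N_def]) (auto simp: k_def)
  also have "\<dots> \<le> t ^ 40 * (2 * N\<^sup>2 + 2 * N * (t ^ 40)\<^sup>2 + s * N\<^sup>2 + (2 * N\<^sup>2 * t ^ 40 + k * N\<^sup>2) / (2 * s))"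
    using D40 s0 k0 t0 N
    by (intro mult_mono add_mono divide_right_mono mult_left_mono power_mono) (auto intro!: add_nonneg_nonneg divide_nonneg_pos)
  also have "\<dots> = 2 * t ^ 188 + 2 * t ^ 194 + t ^ 222 / 10 + 10 * t ^ 194 + t ^ 222 / 20"
  proof -
    have e1: "(2 * N\<^sup>2 * t ^ 40 + k * N\<^sup>2) / (2 * s) = 10 * t ^ 154 + t ^ 182 / 20"
      using t0 by (simp add: N k_def s_def field_simps flip: power_mult power_add)
    have e2: "s * N\<^sup>2 = t ^ 182 / 10" and e3: "2 * N * (t ^ 40)\<^sup>2 = 2 * t ^ 154"
      by (simp_all add: N s_def flip: power_mult power_add)
    have e4: "2 * N\<^sup>2 = 2 * t ^ 148" by (simp add: N flip: power_mult)
    have "t ^ 40 * (2 * N\<^sup>2 + 2 * N * (t ^ 40)\<^sup>2 + s * N\<^sup>2 + (2 * N\<^sup>2 * t ^ 40 + k * N\<^sup>2) / (2 * s))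
      = t ^ 40 * (2 * t ^ 148 + 2 * t ^ 154 + t ^ 182 / 10 + (10 * t ^ 154 + t ^ 182 / 20))"
      unfolding e1 e2 e3 unfolding e4 ..
    also have "\<dots> = 2 * t ^ 188 + 2 * t ^ 194 + t ^ 222 / 10 + 10 * t ^ 194 + t ^ 222 / 20"
      by (simp add: distrib_left mult.left_commute flip: power_add)
    finally show ?thesis .
  qed
  finally have "N ^ 3 \<le> 2 * t ^ 188 + 12 * t ^ 194 + t ^ 222 / 10 + t ^ 222 / 20" by simp
  moreover have "N ^ 3 = t ^ 222" by (simp add: N flip: power_mult)
  moreover have "100 * t ^ 188 \<le> t ^ 222" by (rule const_mult_power_le[OF t(1), where m = 34]) auto
  moreover have "100 * t ^ 194 \<le> t ^ 222" by (rule const_mult_power_le[OF t(1), where m = 28]) auto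
  moreover have "t ^ 222 > 0" using t0 by simp
  ultimately show False by linarith
qed

section \<open>Pinned distances over a field type\<close>

instance alg_closure :: (field) field_gcd ..

text \<open>In the manner of Euclid: if the field were finite, \<open>p + 1\<close> would have no
  root. Generic coordinates need this in order to avoid finitely many scalars.\<close>

lemma infinite_UNIV_alg_closed: "infinite (UNIV :: 'a::alg_closed_field set)"
proof
  assume fin: "finite (UNIV :: 'a set)"
  define p where "p = (\<Prod>a\<in>(UNIV :: 'a set). [:- a, 1:])"
  have "Polynomial.degree p = (\<Sum>a\<in>(UNIV :: 'a set). 1)"
    unfolding p_def by (subst degree_poly.prod_eq) auto
  then have "Polynomial.degree p > 0" using fin by (simp add: card_gt_0_iff)
  then have "Polynomial.degree (p + 1) > 0" using degree_add_eq_left[of 1 p] by simp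
  then obtain x where x: "poly (p + 1) x = 0" using alg_closed_imp_poly_has_root by blast
  have "poly p x = 0" unfolding p_def poly_prod using fin by (intro prod_zero) (auto intro: exI[of _ x])
  then show False using x by simp
qed

definition edist :: "'a::field \<times> 'a \<Rightarrow> 'a \<times> 'a \<Rightarrow> 'a" where
  "edist a b = (fst a - fst b)\<^sup>2 + (snd a - snd b)\<^sup>2"

text \<open>Over the algebraic closure \<open>x\<^sub>1\<^sup>2 + x\<^sub>2\<^sup>2\<close> splits as \<open>(x\<^sub>1 + i x\<^sub>2) (x\<^sub>1 - i x\<^sub>2)\<close>.\<close>

lemma exists_split_coordinates:
  assumes "(2::'a::field) \<noteq> 0"
  obtains h :: "'a::field \<times> 'a \<Rightarrow> 'a alg_closure \<times> 'a alg_closure"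
    where "inj h" "\<And>a b. dst (h a) (h b) = to_ac (edist a b)"
proof -
  obtain i :: "'a alg_closure" where i: "i ^ 2 = - 1" using nth_root_exists[of 2 "- 1"] by auto
  define h where "h a = (to_ac (fst a) + i * to_ac (snd a), to_ac (fst a) - i * to_ac (snd a))" for a :: "'a \<times> 'a"
  have i0: "i \<noteq> 0" using i by auto
  have two: "(2 :: 'a alg_closure) \<noteq> 0"
    using assms to_ac_eq_0_iff[of "2::'a"] by simp
  have "inj h"
  proof (rule injI)
    fix a b assume "h a = h b"
    then have 1: "to_ac (fst a) + i * to_ac (snd a) = to_ac (fst b) + i * to_ac (snd b)"
      and 2: "to_ac (fst a) - i * to_ac (snd a) = to_ac (fst b) - i * to_ac (snd b)" by (auto simp: h_def)
    have "2 * to_ac (fst a) = (to_ac (fst a) + i * to_ac (snd a)) + (to_ac (fst a) - i * to_ac (snd a))" by simp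
    also have "\<dots> = 2 * to_ac (fst b)" unfolding 1 2 by simp
    finally have f: "fst a = fst b" using two by simp
    then show "a = b" using 1 i0 by (simp add: prod_eq_iff)
  qed
  moreover have "dst (h a) (h b) = to_ac (edist a b)" for a b
  proof -
    have "dst (h a) (h b) = (to_ac (fst a) - to_ac (fst b))\<^sup>2 - i\<^sup>2 * (to_ac (snd a) - to_ac (snd b))\<^sup>2"
      by (simp add: dst_def h_def power2_eq_square algebra_simps)
    then show ?thesis by (simp add: i edist_def)
  qed
  ultimately show ?thesis by (rule that)
qed

text \<open>The constant \<open>1 / 1000 ^ 74\<close> makes the bound at most 1 when
  \<open>|A| <= 1000 ^ 74\<close>, where a single distance suffices; in the other case
  \<open>t >= 1000\<close>.\<close>

lemma pinned_distances_field:
  fixes A :: "('a::field \<times> 'a) set"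
  assumes two: "(2::'a) \<noteq> 0" and A: "finite A"
    and char: "CHAR('a) > 0 \<Longrightarrow> real (card A) \<le> real CHAR('a) powr (8/5)"
    and nz: "\<exists>a\<in>A. \<exists>b\<in>A. edist a b \<noteq> 0"
  shows "\<exists>a\<in>A. real (card (edist a ` A)) \<ge> 1 / 1000 ^ 74 * real (card A) powr (20/37)"
proof (rule ccontr)
  assume "\<not> ?thesis"
  then have small: "real (card (edist a ` A)) < 1 / 1000 ^ 74 * real (card A) powr (20/37)" if "a \<in> A" for a
    using that by force
  obtain a0 where a0: "a0 \<in> A" using nz by blast
  define N where "N = real (card A)"
  have N1: "N \<ge> 1" unfolding N_def using a0 A card_gt_0_iff[of A] by auto
  have big: "N > 1000 ^ 74"
  proof (rule ccontr)
    assume "\<not> ?thesis"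
    moreover have "N powr (20/37) \<le> N powr 1" using N1 by (intro powr_mono) auto
    ultimately have "N powr (20/37) \<le> 1000 ^ 74" using N1 by simp
    then have "1 / 1000 ^ 74 * N powr (20/37) \<le> 1 / 1000 ^ 74 * 1000 ^ 74" by (intro mult_left_mono) auto
    then have "real (card (edist a0 ` A)) < 1" using small[OF a0] unfolding N_def by simp
    then show False using a0 A by auto
  qed
  define t where "t = N powr (1/74)"
  have t74: "t ^ 74 = N" unfolding t_def using N1 by (simp add: powr_powr flip: powr_realpow)
  have t40: "N powr (20/37) = t ^ 40" unfolding t_def using N1 by (simp add: powr_powr flip: powr_realpow)
  have t1000: "t \<ge> 1000"
  proof (rule ccontr)
    assume "\<not> ?thesis"
    then have "t ^ 74 \<le> 1000 ^ 74" by (intro power_mono) (auto simp: t_def)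
    then show False using big t74 by simp
  qed
  obtain h :: "'a \<times> 'a \<Rightarrow> 'a alg_closure \<times> 'a alg_closure"
    where h: "inj h" "\<And>a b. dst (h a) (h b) = to_ac (edist a b)"
    using exists_split_coordinates[OF two] by blast
  define B where "B = h ` A"
  define D where "D = Max ((\<lambda>a. card (edist a ` A)) ` A)"
  have finB: "finite B" using A by (simp add: B_def)
  have cB: "card B = card A" unfolding B_def using h(1) by (simp add: card_image inj_on_subset)
  have pin: "card (dst b ` B) \<le> D" if b: "b \<in> B" for b
  proof -
    obtain a where a: "a \<in> A" "b = h a" using b by (auto simp: B_def)
    have "dst b ` B = to_ac ` edist a ` A" unfolding B_def a(2) image_image h(2) ..
    then have "card (dst b ` B) = card (edist a ` A)" by (simp add: card_image inj_on_def)
    also have "\<dots> \<le> D" unfolding D_def using A a by (intro Max_ge) auto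
    finally show ?thesis .
  qed
  obtain a b where ab: "a \<in> A" "b \<in> A" "edist a b \<noteq> 0" using nz by blast
  have dnz: "dst (h a) (h b) \<noteq> 0" "h a \<in> B" "h b \<in> B" using ab h by (auto simp: B_def)
  \<comment> \<open>As some distance is nonzero, some point \<open>c\<close> of \<open>B\<close>
    lies off this isotropic line, and the points on the line have pairwise distinct distances from
    \<open>c\<close>.\<close>
  have iso1: "card {b\<in>B. fst b = v} \<le> D" for v
  proof -
    have "fst (h a) \<noteq> fst (h b)" using dnz by (auto simp: dst_def)
    then obtain c where c: "c \<in> B" "fst c \<noteq> v" using dnz by metis
    have "inj_on (dst c) {b\<in>B. fst b = v}"
      using c by (auto simp: inj_on_def dst_def prod_eq_iff)
    then have "card {b\<in>B. fst b = v} = card (dst c ` {b\<in>B. fst b = v})" by (simp add: card_image)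
    also have "\<dots> \<le> card (dst c ` B)" using finB by (intro card_mono) auto
    finally show ?thesis using pin[OF c(1)] by simp
  qed
  have iso2: "card {b\<in>B. snd b = v} \<le> D" for v
  proof -
    have "snd (h a) \<noteq> snd (h b)" using dnz by (auto simp: dst_def)
    then obtain c where c: "c \<in> B" "snd c \<noteq> v" using dnz by metis
    have "inj_on (dst c) {b\<in>B. snd b = v}"
      using c by (auto simp: inj_on_def dst_def prod_eq_iff)
    then have "card {b\<in>B. snd b = v} = card (dst c ` {b\<in>B. snd b = v})" by (simp add: card_image)
    also have "\<dots> \<le> card (dst c ` B)" using finB by (intro card_mono) auto
    finally show ?thesis using pin[OF c(1)] by simp
  qed
  have "real D > t ^ 40"
  proof (rule split_pinned_distances[OF infinite_UNIV_alg_closed finB pin iso1 iso2 t1000])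
    show "real (card B) = t ^ 74" using t74 by (simp add: cB N_def)
    fix s :: nat assume s: "0 < s" "real s \<le> t ^ 46"
    show "of_nat s \<noteq> (0 :: 'a alg_closure)"
    proof
      assume "of_nat s = (0 :: 'a alg_closure)"
      then have dvd: "CHAR('a) dvd s" by (simp add: of_nat_eq_0_iff_char_dvd)
      then have p: "CHAR('a) > 0" "CHAR('a) \<le> s" using s(1) by (auto intro: Nat.gr0I dvd_imp_le)
      then have "real CHAR('a) \<le> t ^ 46" using s(2) by linarith
      \<comment> \<open>Since \<open>46 * 8 / 5 = 73.6\<close> is less than 74, so small a
        characteristic would contradict the bound on \<open>|A|\<close>.\<close>
      then have "real CHAR('a) powr (8/5) \<le> (t ^ 46) powr (8/5)" using p by (intro powr_mono2) auto
      also have "t ^ 46 = t powr real 46" using t1000 by (intro powr_realpow[symmetric]) simp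
      also have "(t powr real 46) powr (8/5) = t powr (real 46 * (8/5))" by (rule powr_powr)
      also have "\<dots> < t powr real 74" using t1000 by (intro powr_less_mono) auto
      also have "\<dots> = t ^ 74" using t1000 by (intro powr_realpow) simp
      also have "\<dots> = N" by (rule t74)
      finally show False using char[OF p(1)] by (simp add: N_def)
    qed
  qed
  moreover have "D \<in> (\<lambda>a. card (edist a ` A)) ` A" unfolding D_def using A a0 by (intro Max_in) auto
  then obtain a where "a \<in> A" "D = card (edist a ` A)" by auto
  then have "real D < 1 / 1000 ^ 74 * t ^ 40" using small[of a] t40 by (simp add: N_def)
  moreover have "1 / 1000 ^ 74 * t ^ 40 \<le> 1 * t ^ 40" using t1000 by (intro mult_right_mono) auto
  ultimately show False by linarith
qed

section \<open>Transfer to field structures\<close>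

lemma setcompr_eq_singleton:
  assumes "A \<noteq> {}" "\<And>a b. a \<in> A \<Longrightarrow> b \<in> A \<Longrightarrow> h a b = z"
  shows "{h a b |a b. a \<in> A \<and> b \<in> A} = {z}"
  using assms by auto

lemma ring_char_eqI:
  assumes "\<And>n::nat. [n] \<cdot>\<^bsub>F\<^esub> \<one>\<^bsub>F\<^esub> = \<zero>\<^bsub>F\<^esub> \<longleftrightarrow> c dvd n"
  shows "ring_char F = c"
proof (cases "c = 0")
  case True
  then show ?thesis unfolding ring_char_def assms by auto
next
  case False
  then have "(LEAST n::nat. n > 0 \<and> c dvd n) = c"
    by (intro Least_equality) (auto intro: dvd_imp_le)
  then show ?thesis unfolding ring_char_def assms using False by (auto intro: exI[of _ c])
qed

lemma ring_char_cong:
  assumes "\<And>n::nat. [n] \<cdot>\<^bsub>F\<^esub> \<one>\<^bsub>F\<^esub> = \<zero>\<^bsub>F\<^esub> \<longleftrightarrow> [n] \<cdot>\<^bsub>G\<^esub> \<one>\<^bsub>G\<^esub> = \<zero>\<^bsub>G\<^esub>"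
  shows "ring_char F = ring_char G"
  unfolding ring_char_def assms ..

text \<open>A field carried by \<open>nat\<close>, for the case without counterexample:
  \<open>bad_field\<close> is then still a field.\<close>

definition two_element_ring :: "nat ring" where
  "two_element_ring = \<lparr>carrier = {0, 1}, monoid.mult = (\<lambda>x y. x * y), one = 1,
     ring.zero = 0, add = (\<lambda>x y. (x + y) mod 2)\<rparr>"

lemma field_two_element_ring: "field two_element_ring"
proof -
  have "cring two_element_ring"
  proof (rule cringI)
    show "abelian_group two_element_ring"
      by (rule abelian_groupI) (auto simp: two_element_ring_def)
    show "comm_monoid two_element_ring"
      by (rule comm_monoidI) (auto simp: two_element_ring_def)
  qed (auto simp: two_element_ring_def)
  then show ?thesis
  proof (rule cring.cring_fieldI)
    show "Units two_element_ring = carrier two_element_ring - {\<zero>\<^bsub>two_element_ring\<^esub>}"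
      by (auto simp: Units_def two_element_ring_def)
  qed
qed

text \<open>HOL has no types depending on terms, but a counterexample over the type \<open>nat\<close> can be fixed once and for all by
  choice; its carrier is then a closed term and becomes a type of class \<open>field\<close>.\<close>

definition bad_field :: "nat ring" where
  "bad_field = (SOME F. field F \<and> ((\<exists>G :: nat ring. \<not> pinned_distance_bound (1 / 1000 ^ 74) G) \<longrightarrow>
                  \<not> pinned_distance_bound (1 / 1000 ^ 74) F))"

lemma bad_field:
  "field bad_field"
  "\<not> pinned_distance_bound (1 / 1000 ^ 74) (G :: nat ring) \<Longrightarrow> \<not> pinned_distance_bound (1 / 1000 ^ 74) bad_field"
proof -
  have "\<exists>F :: nat ring. field F \<and> ((\<exists>G :: nat ring. \<not> pinned_distance_bound (1 / 1000 ^ 74) G) \<longrightarrow>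
                  \<not> pinned_distance_bound (1 / 1000 ^ 74) F)"
  proof (cases "\<exists>G :: nat ring. \<not> pinned_distance_bound (1 / 1000 ^ 74) G")
    case True
    then obtain G :: "nat ring" where "\<not> pinned_distance_bound (1 / 1000 ^ 74) G" by blast
    then show ?thesis by (intro exI[of _ G]) (auto simp: pinned_distance_bound_def)
  qed (use field_two_element_ring in blast)
  from someI_ex[OF this] show "field bad_field"
    "\<not> pinned_distance_bound (1 / 1000 ^ 74) (G :: nat ring) \<Longrightarrow> \<not> pinned_distance_bound (1 / 1000 ^ 74) bad_field"
    unfolding bad_field_def by blast+
qed

interpretation bad: cring bad_field
  by (rule domain.axioms(1)[OF field.axioms(1)[OF bad_field(1)]])

section \<open>The chosen field as a type\<close>

typedef bad_elem = "carrier bad_field"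
  using bad.one_closed by blast

instantiation bad_elem :: field
begin

definition "0 = Abs_bad_elem \<zero>\<^bsub>bad_field\<^esub>"
definition "1 = Abs_bad_elem \<one>\<^bsub>bad_field\<^esub>"
definition "x + y = Abs_bad_elem (Rep_bad_elem x \<oplus>\<^bsub>bad_field\<^esub> Rep_bad_elem y)"
definition "x * y = Abs_bad_elem (Rep_bad_elem x \<otimes>\<^bsub>bad_field\<^esub> Rep_bad_elem y)"
definition "- x = Abs_bad_elem (\<ominus>\<^bsub>bad_field\<^esub> Rep_bad_elem x)"
definition "x - y = x + - (y :: bad_elem)"
definition "inverse x = (if x = 0 then 0 else Abs_bad_elem (inv\<^bsub>bad_field\<^esub> Rep_bad_elem x))"
definition "x div y = x * inverse (y :: bad_elem)"

lemma Rep_closed [simp]: "Rep_bad_elem x \<in> carrier bad_field"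
  by (rule Rep_bad_elem)

lemma Rep_bad_elem_simps:
  "Rep_bad_elem 0 = \<zero>\<^bsub>bad_field\<^esub>" "Rep_bad_elem 1 = \<one>\<^bsub>bad_field\<^esub>"
  "Rep_bad_elem (x + y) = Rep_bad_elem x \<oplus>\<^bsub>bad_field\<^esub> Rep_bad_elem y"
  "Rep_bad_elem (x * y) = Rep_bad_elem x \<otimes>\<^bsub>bad_field\<^esub> Rep_bad_elem y"
  "Rep_bad_elem (- x) = \<ominus>\<^bsub>bad_field\<^esub> Rep_bad_elem x"
  by (simp_all add: zero_bad_elem_def one_bad_elem_def plus_bad_elem_def times_bad_elem_def
        uminus_bad_elem_def Abs_bad_elem_inverse)

instance
proof
  fix a b c :: bad_elem
  note [simp] = Rep_bad_elem_simps Rep_bad_elem_inject[symmetric]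
  show "a * b * c = a * (b * c)" by (simp add: bad.m_assoc)
  show "a * b = b * a" by (simp add: bad.m_comm)
  show "1 * a = a" by simp
  show "a + b + c = a + (b + c)" by (simp add: bad.a_assoc)
  show "a + b = b + a" by (simp add: bad.a_comm)
  show "0 + a = a" by simp
  show "- a + a = 0" by (simp add: bad.l_neg)
  show "a - b = a + - b" by (simp only: minus_bad_elem_def)
  show "(a + b) * c = a * c + b * c" by (simp add: bad.l_distr)
  show "(0 :: bad_elem) \<noteq> 1"
    using domain.one_not_zero[OF field.axioms(1)[OF bad_field(1)]] by simp
  show "a div b = a * inverse b" by (simp only: divide_bad_elem_def)
  show "inverse (0 :: bad_elem) = 0" by (simp only: inverse_bad_elem_def simp_thms if_True)
  show "inverse a * a = 1" if "a \<noteq> 0"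
  proof -
    have u: "Rep_bad_elem a \<in> Units bad_field" using that by (simp add: field.field_Units[OF bad_field(1)])
    then have "Rep_bad_elem (inverse a) = inv\<^bsub>bad_field\<^esub> Rep_bad_elem a"
      using that by (simp add: inverse_bad_elem_def Abs_bad_elem_inverse)
    then show ?thesis using u by simp
  qed
qed

end

lemma Rep_bad_elem_diff: "Rep_bad_elem (x - y) = Rep_bad_elem x \<ominus>\<^bsub>bad_field\<^esub> Rep_bad_elem y"
  unfolding minus_bad_elem_def Rep_bad_elem_simps by (simp add: a_minus_def)

lemma Rep_bad_elem_of_nat: "Rep_bad_elem (of_nat n) = [n] \<cdot>\<^bsub>bad_field\<^esub> \<one>\<^bsub>bad_field\<^esub>"
proof (induction n)
  case (Suc n)
  show ?case unfolding of_nat_Suc add.commute[of 1] Rep_bad_elem_simps Suc by (simp add: add_pow_def)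
qed (simp add: Rep_bad_elem_simps add_pow_def)

lemma ring_char_bad_field: "ring_char bad_field = CHAR(bad_elem)"
  by (rule ring_char_eqI)
    (simp flip: Rep_bad_elem_of_nat Rep_bad_elem_simps(1)
       add: Rep_bad_elem_inject of_nat_eq_0_iff_char_dvd)

lemma Rep_bad_elem_edist:
  "Rep_bad_elem (edist a b) = alg_dist bad_field (map_prod Rep_bad_elem Rep_bad_elem a) (map_prod Rep_bad_elem Rep_bad_elem b)"
  by (simp add: edist_def alg_dist_def qnorm_def dot_def power2_eq_square Rep_bad_elem_simps Rep_bad_elem_diff)

lemma pinned_distance_bound_bad_field: "pinned_distance_bound (1 / 1000 ^ 74) bad_field"
  unfolding pinned_distance_bound_def
proof (intro impI allI, elim conjE)
  fix A assume ch2: "ring_char bad_field \<noteq> 2" and A: "A \<subseteq> carrier bad_field \<times> carrier bad_field" "finite A" "A \<noteq> {}"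
    and card: "ring_char bad_field > 0 \<longrightarrow> real (card A) \<le> real (ring_char bad_field) powr (8/5)"
  let ?R = "map_prod Rep_bad_elem Rep_bad_elem"
  define B where "B = map_prod Abs_bad_elem Abs_bad_elem ` A"
  have AB: "A = ?R ` B"
  proof -
    have "?R (map_prod Abs_bad_elem Abs_bad_elem a) = a" if "a \<in> A" for a
      using A(1) that by (cases a) (auto simp: Abs_bad_elem_inverse)
    then show ?thesis unfolding B_def image_image by simp
  qed
  have inj: "inj ?R" by (rule prod.inj_map) (auto simp: inj_def Rep_bad_elem_inject)
  have finB: "finite B" using A by (simp add: B_def)
  have cB: "card A = card B" unfolding AB using inj by (simp add: card_image inj_on_subset)
  have two: "(2::bad_elem) \<noteq> 0"
  proof
    assume "(2::bad_elem) = 0"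
    then have "of_nat 2 = (0::bad_elem)" by simp
    then have "CHAR(bad_elem) dvd 2" by (simp only: of_nat_eq_0_iff_char_dvd)
    then have "CHAR(bad_elem) = 1 \<or> CHAR(bad_elem) = 2" by (metis prime_nat_iff two_is_prime_nat)
    then show False using ch2 CHAR_not_1 by (auto simp: ring_char_bad_field)
  qed
  show "{alg_dist bad_field a b |a b. a \<in> A \<and> b \<in> A} = {\<zero>\<^bsub>bad_field\<^esub>} \<or>
    (\<exists>a\<in>A. 1 / 1000 ^ 74 * real (card A) powr (20/37) \<le> real (card {alg_dist bad_field a b |b. b \<in> A}))"
  proof (cases "\<exists>a\<in>B. \<exists>b\<in>B. edist a b \<noteq> 0")
    case True
    have "CHAR(bad_elem) > 0 \<Longrightarrow> real (card B) \<le> real CHAR(bad_elem) powr (8/5)"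
      using card cB by (simp add: ring_char_bad_field)
    from pinned_distances_field[OF two finB this True] obtain a where a: "a \<in> B"
      "1 / 1000 ^ 74 * real (card B) powr (20/37) \<le> real (card (edist a ` B))" by blast
    have "{alg_dist bad_field (?R a) b |b. b \<in> A} = Rep_bad_elem ` edist a ` B"
      unfolding AB Setcompr_eq_image image_image Collect_mem_eq Rep_bad_elem_edist ..
    then have "card {alg_dist bad_field (?R a) b |b. b \<in> A} = card (edist a ` B)"
      by (simp add: card_image inj_on_def Rep_bad_elem_inject)
    moreover have "?R a \<in> A" unfolding AB using a(1) by (rule imageI)
    ultimately show ?thesis using a(2) unfolding cB by (intro disjI2 bexI[of _ "?R a"]) simp_all
  next
    case False
    have "alg_dist bad_field a b = \<zero>\<^bsub>bad_field\<^esub>" if ab: "a \<in> A" "b \<in> A" for a b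
    proof -
      obtain a' where a': "a = ?R a'" "a' \<in> B" using ab(1) unfolding AB by (rule imageE)
      obtain b' where b': "b = ?R b'" "b' \<in> B" using ab(2) unfolding AB by (rule imageE)
      from a' b' show ?thesis using False Rep_bad_elem_edist[of a' b'] by (simp add: Rep_bad_elem_simps)
    qed
    then show ?thesis by (intro disjI1 setcompr_eq_singleton A(3))
  qed
qed

theorem pinned_distance_bound_nat: "pinned_distance_bound (1 / 1000 ^ 74) (F :: nat ring)"
proof (rule ccontr)
  assume "\<not> pinned_distance_bound (1 / 1000 ^ 74) F"
  from bad_field(2)[OF this] show False using pinned_distance_bound_bad_field by (rule notE)
qed

section \<open>Reduction of arbitrary carriers to countable ones\<close>

datatype field_term = One | Var nat | Neg field_term | Inv field_term
  | Add field_term field_term | Mul field_term field_term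

instance field_term :: countable
  by countable_datatype

primrec field_eval :: "('a, 'm) ring_scheme \<Rightarrow> (nat \<Rightarrow> 'a) \<Rightarrow> field_term \<Rightarrow> 'a" where
  "field_eval F v One = \<one>\<^bsub>F\<^esub>"
| "field_eval F v (Var n) = v n"
| "field_eval F v (Neg s) = \<ominus>\<^bsub>F\<^esub> field_eval F v s"
| "field_eval F v (Inv s) = inv\<^bsub>F\<^esub> field_eval F v s"
| "field_eval F v (Add s t) = field_eval F v s \<oplus>\<^bsub>F\<^esub> field_eval F v t"
| "field_eval F v (Mul s t) = field_eval F v s \<otimes>\<^bsub>F\<^esub> field_eval F v t"

text \<open>Terms over an enumeration of \<open>H\<close> name all elements of the generated field.
  Only an inclusion is needed, so a term may also invert a term of value zero.\<close>

lemma countable_generate_field: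
  assumes "countable H"
  shows "countable (generate_field F H)"
proof -
  define v where "v = from_nat_into H"
  have "generate_field F H \<subseteq> range (field_eval F v)"
  proof
    fix x assume "x \<in> generate_field F H"
    then show "x \<in> range (field_eval F v)"
    proof induction
      case one
      show ?case by (rule range_eqI[of _ _ One]) simp
    next
      case (incl h)
      then have "h = v (to_nat_on H h)" using assms by (simp add: v_def)
      then show ?case by (intro range_eqI[of _ _ "Var (to_nat_on H h)"]) simp
    next
      case (a_inv h)
      then obtain s where "h = field_eval F v s" by blast
      then show ?case by (intro range_eqI[of _ _ "Neg s"]) simp
    next
      case (m_inv h)
      then obtain s where "h = field_eval F v s" by blast
      then show ?case by (intro range_eqI[of _ _ "Inv s"]) simp
    next
      case (eng_add h1 h2)
      then obtain s1 s2 where "h1 = field_eval F v s1" "h2 = field_eval F v s2" by blast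
      then show ?case by (intro range_eqI[of _ _ "Add s1 s2"]) simp
    next
      case (eng_mult h1 h2)
      then obtain s1 s2 where "h1 = field_eval F v s1" "h2 = field_eval F v s2" by blast
      then show ?case by (intro range_eqI[of _ _ "Mul s1 s2"]) simp
    qed
  qed
  then show ?thesis by (rule countable_subset) simp
qed

text \<open>The finitely many coordinates of \<open>A\<close> generate a countable subfield.
  Transported along an injection into \<open>nat\<close>, it is a field to which
  \<open>bound\<close> applies, with the same characteristic and corresponding distances.\<close>

lemma pinned_distance_bound_transfer:
  fixes F :: "'a ring"
  assumes bound: "\<And>G :: nat ring. pinned_distance_bound c G"
  shows "pinned_distance_bound c F"
  unfolding pinned_distance_bound_def
proof (intro impI allI, elim conjE)
  fix A assume F: "field F" and ch2: "ring_char F \<noteq> 2"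
    and A: "A \<subseteq> carrier F \<times> carrier F" "finite A" "A \<noteq> {}"
    and card: "ring_char F > 0 \<longrightarrow> real (card A) \<le> real (ring_char F) powr (8/5)"
  interpret F: cring F by (rule domain.axioms(1)[OF field.axioms(1)[OF F]])
  define H where "H = fst ` A \<union> snd ` A"
  define S where "S = generate_field F H"
  have H: "H \<subseteq> carrier F" "countable H" using A by (auto simp: H_def countable_finite)
  have Sfield: "field (F\<lparr>carrier := S\<rparr>)" unfolding S_def by (rule field.generate_field_is_field[OF F H(1)])
  have Scar: "S \<subseteq> carrier F" unfolding S_def by (rule field.generate_field_incl[OF F H(1)])
  have AS: "A \<subseteq> S \<times> S"
  proof
    fix a assume "a \<in> A"
    then have "fst a \<in> H" "snd a \<in> H" by (auto simp: H_def)
    then show "a \<in> S \<times> S" by (cases a) (auto simp: S_def intro: generate_field.incl)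
  qed
  have cl: "\<one>\<^bsub>F\<^esub> \<in> S" "\<zero>\<^bsub>F\<^esub> \<in> S" "x \<in> S \<Longrightarrow> y \<in> S \<Longrightarrow> x \<oplus>\<^bsub>F\<^esub> y \<in> S"
    "x \<in> S \<Longrightarrow> y \<in> S \<Longrightarrow> x \<otimes>\<^bsub>F\<^esub> y \<in> S" "x \<in> S \<Longrightarrow> \<ominus>\<^bsub>F\<^esub> x \<in> S" for x y
    unfolding S_def by (auto intro: generate_field.intros field.zero_in_generate[OF F])
  define f where "f = to_nat_on S"
  have f: "inj_on f S" unfolding f_def S_def by (intro inj_on_to_nat_on countable_generate_field H)
  define g where "g = the_inv_into S f"
  have gf [simp]: "g (f x) = x" if "x \<in> S" for x unfolding g_def using the_inv_into_f_f[OF f that] .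
  define G :: "nat ring" where "G = \<lparr>carrier = f ` S, monoid.mult = (\<lambda>x y. f (g x \<otimes>\<^bsub>F\<^esub> g y)),
    one = f \<one>\<^bsub>F\<^esub>, ring.zero = f \<zero>\<^bsub>F\<^esub>, add = (\<lambda>x y. f (g x \<oplus>\<^bsub>F\<^esub> g y))\<rparr>"
  have ops: "f x \<otimes>\<^bsub>G\<^esub> f y = f (x \<otimes>\<^bsub>F\<^esub> y)" "f x \<oplus>\<^bsub>G\<^esub> f y = f (x \<oplus>\<^bsub>F\<^esub> y)" if "x \<in> S" "y \<in> S" for x y
    using that by (simp_all add: G_def)
  have cst: "\<one>\<^bsub>G\<^esub> = f \<one>\<^bsub>F\<^esub>" "\<zero>\<^bsub>G\<^esub> = f \<zero>\<^bsub>F\<^esub>" "carrier G = f ` S" by (simp_all add: G_def)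
  have "f \<in> ring_iso (F\<lparr>carrier := S\<rparr>) G"
    using f by (intro ring_iso_memI) (auto simp: ops cst bij_betw_def)
  from field.ring_iso_imp_img_field[OF Sfield this] have G: "field G"
    by (simp add: G_def)
  interpret G: cring G by (rule domain.axioms(1)[OF field.axioms(1)[OF G]])
  have uminus: "\<ominus>\<^bsub>G\<^esub> f x = f (\<ominus>\<^bsub>F\<^esub> x)" if "x \<in> S" for x
  proof -
    have xF: "x \<in> carrier F" using that Scar by blast
    have "f (\<ominus>\<^bsub>F\<^esub> x) \<oplus>\<^bsub>G\<^esub> f x = \<zero>\<^bsub>G\<^esub>"
      using that xF cl(5)[OF that] by (simp add: ops cst F.l_neg)
    then show ?thesis using that cl(5)[OF that] by (intro G.minus_equality) (auto simp: cst)
  qed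
  have minus: "f x \<ominus>\<^bsub>G\<^esub> f y = f (x \<ominus>\<^bsub>F\<^esub> y)" "x \<ominus>\<^bsub>F\<^esub> y \<in> S" if "x \<in> S" "y \<in> S" for x y
    using that cl(5)[OF that(2)] cl(3) by (simp_all add: a_minus_def uminus ops)
  let ?f = "map_prod f f"
  have dist: "alg_dist G (?f a) (?f b) = f (alg_dist F a b)" and distS: "alg_dist F a b \<in> S"
    if "a \<in> A" "b \<in> A" for a b
  proof -
    have "fst a \<in> S" "snd a \<in> S" "fst b \<in> S" "snd b \<in> S" using that AS by auto
    then show "alg_dist G (?f a) (?f b) = f (alg_dist F a b)" "alg_dist F a b \<in> S"
      by (simp_all add: alg_dist_def qnorm_def dot_def minus ops cl)
  qed
  have pow: "[n] \<cdot>\<^bsub>G\<^esub> \<one>\<^bsub>G\<^esub> = f ([n] \<cdot>\<^bsub>F\<^esub> \<one>\<^bsub>F\<^esub>) \<and> [n] \<cdot>\<^bsub>F\<^esub> \<one>\<^bsub>F\<^esub> \<in> S" for n :: nat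
    by (induction n) (auto simp: add_pow_def cst cl ops)
  have char: "ring_char G = ring_char F"
  proof (rule ring_char_cong)
    fix n :: nat
    show "[n] \<cdot>\<^bsub>G\<^esub> \<one>\<^bsub>G\<^esub> = \<zero>\<^bsub>G\<^esub> \<longleftrightarrow> [n] \<cdot>\<^bsub>F\<^esub> \<one>\<^bsub>F\<^esub> = \<zero>\<^bsub>F\<^esub>"
      using pow[of n] inj_on_eq_iff[OF f, of "[n] \<cdot>\<^bsub>F\<^esub> \<one>\<^bsub>F\<^esub>" "\<zero>\<^bsub>F\<^esub>"] cl(2) cst(2) by simp
  qed
  have finj: "inj_on ?f A"
    by (rule inj_on_subset[OF map_prod_inj_on[OF f f] AS])
  define B where "B = ?f ` A"
  have cB: "card B = card A" unfolding B_def using finj by (rule card_image)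
  have BG: "B \<subseteq> carrier G \<times> carrier G" using AS by (auto simp: B_def cst)
  have "{alg_dist G a b |a b. a \<in> B \<and> b \<in> B} = {\<zero>\<^bsub>G\<^esub>} \<or>
            (\<exists>a\<in>B. real (card {alg_dist G a b |b. b \<in> B}) \<ge> c * real (card B) powr (20/37))"
  proof (rule mp[OF spec[OF mp[OF bound[of G, unfolded pinned_distance_bound_def]]]])
    show "field G \<and> ring_char G \<noteq> 2" using G ch2 char by simp
    show "B \<subseteq> carrier G \<times> carrier G \<and> finite B \<and> B \<noteq> {} \<and>
        (ring_char G > 0 \<longrightarrow> real (card B) \<le> real (ring_char G) powr (8/5))"
      using BG A card unfolding char cB by (simp add: B_def)
  qed
  then show "{alg_dist F a b |a b. a \<in> A \<and> b \<in> A} = {\<zero>\<^bsub>F\<^esub>} \<or>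
            (\<exists>a\<in>A. real (card {alg_dist F a b |b. b \<in> A}) \<ge> c * real (card A) powr (20/37))"
  proof
    assume 0: "{alg_dist G a b |a b. a \<in> B \<and> b \<in> B} = {\<zero>\<^bsub>G\<^esub>}"
    have "alg_dist F a b = \<zero>\<^bsub>F\<^esub>" if "a \<in> A" "b \<in> A" for a b
    proof -
      have "alg_dist G (?f a) (?f b) \<in> {alg_dist G a b |a b. a \<in> B \<and> b \<in> B}"
        using that unfolding B_def by blast
      then have "alg_dist G (?f a) (?f b) = \<zero>\<^bsub>G\<^esub>" unfolding 0 by simp
      then show ?thesis using dist[OF that] distS[OF that] inj_on_eq_iff[OF f] cl(2) by (simp add: cst)
    qed
    then show ?thesis by (intro disjI1 setcompr_eq_singleton A(3))
  next
    assume "\<exists>a\<in>B. real (card {alg_dist G a b |b. b \<in> B}) \<ge> c * real (card B) powr (20/37)"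
    then obtain a where a: "a \<in> A" "real (card {alg_dist G (?f a) b |b. b \<in> B}) \<ge> c * real (card B) powr (20/37)"
      by (auto simp: B_def)
    have "{alg_dist G (?f a) b |b. b \<in> B} = f ` {alg_dist F a b |b. b \<in> A}"
      unfolding B_def Setcompr_eq_image image_image Collect_mem_eq
      by (rule image_cong[OF refl]) (use dist a(1) in simp)
    moreover have "inj_on f {alg_dist F a b |b. b \<in> A}"
      by (rule inj_on_subset[OF f]) (use distS[OF a(1)] in blast)
    ultimately have "card {alg_dist G (?f a) b |b. b \<in> B} = card {alg_dist F a b |b. b \<in> A}"
      by (simp add: card_image)
    then show ?thesis using a(2) unfolding cB by (intro disjI2 bexI[OF _ a(1)]) simp
  qed
qed

theorem theorem1:
  shows "(\<exists>c::real. c > 0 \<and> (\<forall>F :: nat ring. pinned_distance_bound c F)) \<and>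
         (\<forall>c::real. c > 0 \<and> (\<forall>F :: nat ring. pinned_distance_bound c F) \<longrightarrow>
            (\<forall>F :: 'a ring. pinned_distance_bound c F))"
proof (intro conjI allI impI)
  show "\<exists>c::real. c > 0 \<and> (\<forall>F :: nat ring. pinned_distance_bound c F)"
    using pinned_distance_bound_nat by (intro exI[of _ "1 / 1000 ^ 74"]) auto
  show "pinned_distance_bound c F"
    if "c > 0 \<and> (\<forall>F :: nat ring. pinned_distance_bound c F)" for c and F :: "'a ring"
    by (rule pinned_distance_bound_transfer) (use that in blast)
qed

end
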